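(* Let $X$ be a proper geodesic Gromov hyperbolic space, let $\Gamma$ be a non-elementary group acting properly and cocompactly by isometries on $X$, and let $\mu_o$ be the (unique class of) Patterson–Sullivan probability measure on the Gromov boundary $\partial X$. Let $H<\Gamma$ be a torsion-free subgroup. Then the action $H\curvearrowright(\partial X,\mu_o)$ is conservative if and only if the quotient growth of $H\curvearrowright X$ is slower than $\Gamma\curvearrowright X$, that is, $$\frac{\sharp N_{\Gamma/H}(o,n)}{\sharp N_\Gamma(o,n)}\to0\quad\text{as } n\to\infty.$$
   Context: Fix $o\in X$. A group is elementary if finite or virtually $\mathbb Z$. $N_\Gamma(o,n)=\{go:g\in\Gamma,d(o,go)\le n\}$, $\omega_\Gamma=\limsup_n\frac1n\log\sharp N_\Gamma(o,n)$, and $N_{\Gamma/H}(o,n)=\{Hgo:g\in\Gamma,\bar d(Ho,Hgo)\le n\}$, where $Hx$ is the $H$-orbit of $x$ and $\bar d(Hx,Hy)=\inf_{h\in H}d(x,hy)$. Patterson–Sullivan measure: weak limit on $X\cup\partial X$ along $s_i\searrow\omega_\Gamma$ of $\frac{1}{\mathcal P(s)}\sum_{g\in\Gamma}e^{-sd(o,go)}\delta_{go}$, $\mathcal P(s)=\sum_{g\in\Gamma}e^{-sd(o,go)}$. A measure-class-preserving action of a countable group $H$ on $(\partial X,m)$ is conservative if for every measurable $A$ with $m(A)>0$ there is $h\in H\setminus\{1\}$ with $hA\cap A\ne\emptyset$. *)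

theory Defs
  imports "HOL-Probability.Probability" "HOL-Algebra.Elementary_Groups" "HOL-Algebra.Group_Action"
begin

text \<open>Throughout, the space \<open>X\<close> is a whole type.  Class \<^class>\<open>heine_borel\<close> says exactly that the
  metric space is proper (closed bounded sets are compact).\<close>

definition geodesic_space :: "'a::metric_space itself \<Rightarrow> bool" where
  "geodesic_space _ \<longleftrightarrow> (\<forall>x y :: 'a. \<exists>c :: real \<Rightarrow> 'a. c 0 = x \<and> c (dist x y) = y \<and>
     (\<forall>s \<in> {0..dist x y}. \<forall>t \<in> {0..dist x y}. dist (c s) (c t) = \<bar>s - t\<bar>))"

definition gromov_product :: "'a::metric_space \<Rightarrow> 'a \<Rightarrow> 'a \<Rightarrow> real" where
  "gromov_product b x y = (dist b x + dist b y - dist x y) / 2"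

definition gromov_hyperbolic :: "'a::metric_space itself \<Rightarrow> bool" where
  "gromov_hyperbolic _ \<longleftrightarrow> (\<exists>\<delta>\<ge>0. \<forall>b x y z :: 'a.
     gromov_product b x z \<ge> min (gromov_product b x y) (gromov_product b y z) - \<delta>)"

text \<open>The Gromov boundary consists of equivalence classes of sequences \<open>u\<close> with
  \<open>(u\<^sub>i|u\<^sub>j)\<^sub>b \<rightarrow> \<infinity>\<close> as \<open>i, j \<rightarrow> \<infinity>\<close>; it does not depend on the base point \<open>b\<close>.\<close>

definition gromov_sequences :: "'a::metric_space \<Rightarrow> (nat \<Rightarrow> 'a) set" where
  "gromov_sequences b = {u.
     filterlim (\<lambda>(i, j). gromov_product b (u i) (u j)) at_top (sequentially \<times>\<^sub>F sequentially)}"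

definition gromov_rel :: "'a::metric_space \<Rightarrow> ((nat \<Rightarrow> 'a) \<times> (nat \<Rightarrow> 'a)) set" where
  "gromov_rel b = {(u, v). u \<in> gromov_sequences b \<and> v \<in> gromov_sequences b \<and>
     filterlim (\<lambda>(i, j). gromov_product b (u i) (v j)) at_top (sequentially \<times>\<^sub>F sequentially)}"

definition gromov_boundary :: "'a::metric_space \<Rightarrow> (nat \<Rightarrow> 'a) set set" where
  "gromov_boundary b = gromov_sequences b // gromov_rel b"

text \<open>The union of \<open>X\<close> and its boundary is a subset of a sum type: \<^const>\<open>Inl\<close> embeds \<open>X\<close> and
  \<^const>\<open>Inr\<close> embeds the boundary.\<close>

definition boundary_part :: "'a::metric_space \<Rightarrow> ('a + (nat \<Rightarrow> 'a) set) set" where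
  "boundary_part b = Inr ` gromov_boundary b"

definition bordification :: "'a::metric_space \<Rightarrow> ('a + (nat \<Rightarrow> 'a) set) set" where
  "bordification b = range Inl \<union> boundary_part b"

fun sequences_to :: "'a::metric_space + (nat \<Rightarrow> 'a) set \<Rightarrow> (nat \<Rightarrow> 'a) set" where
  "sequences_to (Inl x) = {u. u \<longlonglongrightarrow> x}"
| "sequences_to (Inr \<xi>) = \<xi>"

definition extended_product ::
    "'a::metric_space \<Rightarrow> 'a + (nat \<Rightarrow> 'a) set \<Rightarrow> 'a + (nat \<Rightarrow> 'a) set \<Rightarrow> ereal" where
  "extended_product b p q = (SUP (u, v) \<in> sequences_to p \<times> sequences_to q.
     Liminf (sequentially \<times>\<^sub>F sequentially) (\<lambda>(i, j). ereal (gromov_product b (u i) (v j))))"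

text \<open>The usual topology: \<open>X\<close> is open and keeps its metric topology, and the sets
  \<open>{p. (p|\<xi>)\<^sub>b > R}\<close> form a neighbourhood basis (of not necessarily open sets) at a boundary
  point \<open>\<xi>\<close>.\<close>

definition bordification_open ::
    "'a::metric_space \<Rightarrow> ('a + (nat \<Rightarrow> 'a) set) set \<Rightarrow> bool" where
  "bordification_open b U \<longleftrightarrow> U \<subseteq> bordification b \<and> open (Inl -` U) \<and>
     (\<forall>\<xi>. Inr \<xi> \<in> U \<longrightarrow>
       (\<exists>R::real. {p \<in> bordification b. extended_product b p (Inr \<xi>) > ereal R} \<subseteq> U))"

definition bordification_topology ::
    "'a::metric_space \<Rightarrow> ('a + (nat \<Rightarrow> 'a) set) topology" where
  "bordification_topology b = topology (bordification_open b)"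

lemma istopology_bordification_open: "istopology (bordification_open b)"
  unfolding istopology_def
proof (intro conjI allI impI)
  fix S T assume S: "bordification_open b S" and T: "bordification_open b T"
  have "open (Inl -` (S \<inter> T))"
    using S T by (simp add: bordification_open_def vimage_Int open_Int)
  moreover have "\<exists>R::real. {p \<in> bordification b. extended_product b p (Inr \<xi>) > ereal R} \<subseteq> S \<inter> T"
    if "Inr \<xi> \<in> S \<inter> T" for \<xi>
  proof -
    obtain R1 R2 :: real
      where "{p \<in> bordification b. extended_product b p (Inr \<xi>) > ereal R1} \<subseteq> S"
        and "{p \<in> bordification b. extended_product b p (Inr \<xi>) > ereal R2} \<subseteq> T"
      using S T \<open>Inr \<xi> \<in> S \<inter> T\<close> unfolding bordification_open_def by blast
    moreover have "extended_product b p (Inr \<xi>) > ereal R1 \<and> extended_product b p (Inr \<xi>) > ereal R2"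
      if "extended_product b p (Inr \<xi>) > ereal (max R1 R2)" for p
      using that by (meson ereal_less_eq(3) max.cobounded1 max.cobounded2 order_le_less_trans)
    ultimately show ?thesis by (intro exI[of _ "max R1 R2"]) blast
  qed
  ultimately show "bordification_open b (S \<inter> T)"
    using S unfolding bordification_open_def by blast
next
  fix \<K> assume K: "\<forall>K\<in>\<K>. bordification_open b K"
  have "open (Inl -` \<Union>\<K>)"
    using K by (auto simp: bordification_open_def vimage_Union)
  moreover have "\<exists>R::real. {p \<in> bordification b. extended_product b p (Inr \<xi>) > ereal R} \<subseteq> \<Union>\<K>"
    if "Inr \<xi> \<in> \<Union>\<K>" for \<xi>
  proof -
    from that obtain K where "K \<in> \<K>" "Inr \<xi> \<in> K" by blast
    moreover from this K have "\<exists>R::real. {p \<in> bordification b. extended_product b p (Inr \<xi>) > ereal R} \<subseteq> K"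
      unfolding bordification_open_def by blast
    ultimately show ?thesis by blast
  qed
  ultimately show "bordification_open b (\<Union>\<K>)"
    using K unfolding bordification_open_def by blast
qed

lemma openin_bordification_topology:
  "openin (bordification_topology b) U \<longleftrightarrow> bordification_open b U"
  by (simp add: bordification_topology_def istopology_bordification_open topology_inverse')

lemma topspace_bordification_topology: "topspace (bordification_topology b) = bordification b"
proof -
  have "Inl -` bordification b = (UNIV :: 'a set)"
    by (auto simp: bordification_def)
  then have "openin (bordification_topology b) (bordification b)"
    unfolding openin_bordification_topology by (auto simp: bordification_open_def)
  moreover have "U \<subseteq> bordification b" if "openin (bordification_topology b) U" for U
    using that unfolding openin_bordification_topology bordification_open_def by blast
  ultimately show ?thesis
    by (metis openin_subset openin_topspace subset_antisym)
qed

definition bordification_borel :: "'a::metric_space \<Rightarrow> ('a + (nat \<Rightarrow> 'a) set) measure" where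
  "bordification_borel b =
     sigma (bordification b) {U. openin (bordification_topology b) U}"

definition virtually_Z :: "('g, 'c) monoid_scheme \<Rightarrow> bool" where
  "virtually_Z G \<longleftrightarrow> (\<exists>K. subgroup K G \<and> finite (rcosets\<^bsub>G\<^esub> K) \<and>
     G\<lparr>carrier := K\<rparr> \<cong> integer_group)"

definition elementary_group :: "('g, 'c) monoid_scheme \<Rightarrow> bool" where
  "elementary_group G \<longleftrightarrow> finite (carrier G) \<or> virtually_Z G"

definition torsion_free :: "('g, 'c) monoid_scheme \<Rightarrow> bool" where
  "torsion_free G \<longleftrightarrow>
     (\<forall>x \<in> carrier G - {\<one>\<^bsub>G\<^esub>}. \<forall>n::nat. n > 0 \<longrightarrow> x [^]\<^bsub>G\<^esub> n \<noteq> \<one>\<^bsub>G\<^esub>)"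

definition isometric_action ::
    "('g, 'c) monoid_scheme \<Rightarrow> ('g \<Rightarrow> 'a::metric_space \<Rightarrow> 'a) \<Rightarrow> bool" where
  "isometric_action G \<phi> \<longleftrightarrow> group_action G UNIV \<phi> \<and>
     (\<forall>g \<in> carrier G. \<forall>x y. dist (\<phi> g x) (\<phi> g y) = dist x y)"

definition proper_action ::
    "('g, 'c) monoid_scheme \<Rightarrow> ('g \<Rightarrow> 'a::metric_space \<Rightarrow> 'a) \<Rightarrow> bool" where
  "proper_action G \<phi> \<longleftrightarrow>
     (\<forall>K. compact K \<longrightarrow> finite {g \<in> carrier G. \<phi> g ` K \<inter> K \<noteq> {}})"

definition cocompact_action ::
    "('g, 'c) monoid_scheme \<Rightarrow> ('g \<Rightarrow> 'a::metric_space \<Rightarrow> 'a) \<Rightarrow> bool" where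
  "cocompact_action G \<phi> \<longleftrightarrow> (\<exists>K. compact K \<and> (\<Union>g \<in> carrier G. \<phi> g ` K) = UNIV)"

text \<open>An element \<open>g\<close> acts on the boundary by moving the sequences that represent a point termwise.\<close>

definition boundary_action ::
    "'a::metric_space \<Rightarrow> ('g \<Rightarrow> 'a \<Rightarrow> 'a) \<Rightarrow> 'g \<Rightarrow>
       'a + (nat \<Rightarrow> 'a) set \<Rightarrow> 'a + (nat \<Rightarrow> 'a) set" where
  "boundary_action b \<phi> g =
     restrict (map_sum (\<phi> g) (\<lambda>\<xi>. (\<lambda>u. \<phi> g \<circ> u) ` \<xi>)) (boundary_part b)"

definition measure_class_preserving ::
    "('g, 'c) monoid_scheme \<Rightarrow> 'p measure \<Rightarrow> ('g \<Rightarrow> 'p \<Rightarrow> 'p) \<Rightarrow> bool" where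
  "measure_class_preserving G M \<psi> \<longleftrightarrow> group_action G (space M) \<psi> \<and>
     (\<forall>g \<in> carrier G. \<psi> g \<in> measurable M M \<and>
        (\<forall>A \<in> sets M. emeasure M (\<psi> g ` A) = 0 \<longleftrightarrow> emeasure M A = 0))"

text \<open>Conservativity is a property of measure-class-preserving actions of countable groups, so that
  requirement is part of the predicate.  For such actions, asking \<open>h A \<inter> A\<close> to be nonempty or to
  have positive measure gives the same notion.\<close>

definition conservative ::
    "('g, 'c) monoid_scheme \<Rightarrow> 'p measure \<Rightarrow> ('g \<Rightarrow> 'p \<Rightarrow> 'p) \<Rightarrow> bool" where
  "conservative G M \<psi> \<longleftrightarrow> countable (carrier G) \<and> measure_class_preserving G M \<psi> \<and>
     (\<forall>A \<in> sets M. emeasure M A > 0 \<longrightarrow> (\<exists>h \<in> carrier G - {\<one>\<^bsub>G\<^esub>}. \<psi> h ` A \<inter> A \<noteq> {}))"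

definition orbit_ball ::
    "('g, 'c) monoid_scheme \<Rightarrow> ('g \<Rightarrow> 'a::metric_space \<Rightarrow> 'a) \<Rightarrow> 'a \<Rightarrow> nat \<Rightarrow> 'a set" where
  "orbit_ball G \<phi> b n = {\<phi> g b | g. g \<in> carrier G \<and> dist b (\<phi> g b) \<le> real n}"

text \<open>The distance between the \<open>H\<close>-orbits of \<open>x\<close> and \<open>y\<close>, computed from representatives.\<close>

definition quotient_dist :: "'g set \<Rightarrow> ('g \<Rightarrow> 'a::metric_space \<Rightarrow> 'a) \<Rightarrow> 'a \<Rightarrow> 'a \<Rightarrow> real" where
  "quotient_dist H \<phi> x y = (INF h \<in> H. dist x (\<phi> h y))"

definition quotient_ball ::
    "('g, 'c) monoid_scheme \<Rightarrow> 'g set \<Rightarrow> ('g \<Rightarrow> 'a::metric_space \<Rightarrow> 'a) \<Rightarrow> 'a \<Rightarrow> nat \<Rightarrow> 'a set set"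
  where
  "quotient_ball G H \<phi> b n =
     {orbit (G\<lparr>carrier := H\<rparr>) \<phi> (\<phi> g b) | g.
        g \<in> carrier G \<and> quotient_dist H \<phi> b (\<phi> g b) \<le> real n}"

definition growth_rate ::
    "('g, 'c) monoid_scheme \<Rightarrow> ('g \<Rightarrow> 'a::metric_space \<Rightarrow> 'a) \<Rightarrow> 'a \<Rightarrow> ereal" where
  "growth_rate G \<phi> b =
     limsup (\<lambda>n. ereal (1 / real n * ln (real (card (orbit_ball G \<phi> b n)))))"

definition poincare_series ::
    "('g, 'c) monoid_scheme \<Rightarrow> ('g \<Rightarrow> 'a::metric_space \<Rightarrow> 'a) \<Rightarrow> 'a \<Rightarrow> real \<Rightarrow> real" where
  "poincare_series G \<phi> b s = (\<Sum>\<^sub>\<infinity>g \<in> carrier G. exp (- s * dist b (\<phi> g b)))"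

text \<open>The measure \<open>1/P(s) \<Sum>\<^sub>g exp(- s d(b, g b)) \<delta>\<^bsub>g b\<^esub>\<close>, as the image of a weighted counting
  measure on the group under \<open>g \<mapsto> g b\<close>.\<close>

definition orbital_measure ::
    "('g, 'c) monoid_scheme \<Rightarrow> ('g \<Rightarrow> 'a::metric_space \<Rightarrow> 'a) \<Rightarrow> 'a \<Rightarrow> real \<Rightarrow>
       ('a + (nat \<Rightarrow> 'a) set) measure" where
  "orbital_measure G \<phi> b s =
     distr (density (count_space (carrier G))
             (\<lambda>g. ennreal (exp (- s * dist b (\<phi> g b)) / poincare_series G \<phi> b s)))
       (bordification_borel b) (\<lambda>g. Inl (\<phi> g b))"

definition weak_limit ::
    "'p topology \<Rightarrow> (nat \<Rightarrow> 'p measure) \<Rightarrow> 'p measure \<Rightarrow> bool" where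
  "weak_limit T N M \<longleftrightarrow>
     (\<forall>f :: 'p \<Rightarrow> real. continuous_map T euclideanreal f \<and> bounded (f ` topspace T) \<longrightarrow>
        (\<lambda>i. \<integral>x. f x \<partial>N i) \<longlonglongrightarrow> (\<integral>x. f x \<partial>M))"

text \<open>The measure lives on the union of \<open>X\<close> and its boundary; that the boundary has full measure for
  a proper cocompact action is a theorem, not part of the definition.\<close>

definition patterson_sullivan ::
    "('g, 'c) monoid_scheme \<Rightarrow> ('g \<Rightarrow> 'a::metric_space \<Rightarrow> 'a) \<Rightarrow> 'a \<Rightarrow>
       ('a + (nat \<Rightarrow> 'a) set) measure \<Rightarrow> bool" where
  "patterson_sullivan G \<phi> b \<mu> \<longleftrightarrow>
     prob_space \<mu> \<and> sets \<mu> = sets (bordification_borel b) \<and>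
     (\<exists>s :: nat \<Rightarrow> real. decseq s \<and> (\<forall>i. ereal (s i) > growth_rate G \<phi> b) \<and>
        (\<lambda>i. ereal (s i)) \<longlonglongrightarrow> growth_rate G \<phi> b \<and>
        weak_limit (bordification_topology b) (\<lambda>i. orbital_measure G \<phi> b (s i)) \<mu>)"

end

theory Submission
  imports Defs "HOL-Real_Asymp.Real_Asymp"
begin

text \<open>The orbital measures whose limit is \<open>\<mu>\<close> are moved by \<open>g\<close> with density
  \<open>exp (- s (d(g b, x) - d(b, x)))\<close>, so \<open>\<mu>\<close> is quasi-conformal of dimension \<open>\<omega>\<close>. Since \<open>\<Gamma>\<close> is not
  elementary, it fixes no boundary point, and quasi-conformality gives the shadow lemma: the shadow
  of \<open>g b\<close> has mass comparable to \<open>exp (- \<omega> d(b, g b))\<close>, whence \<open>#N\<^sub>\<Gamma>(b, n)\<close> is comparable to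
  \<open>exp (\<omega> n)\<close>.

  If \<open>A\<close> is a wandering set of positive measure, then the masses of its translates are summable,
  so almost every \<open>\<xi> \<in> A\<close> has only finitely many \<open>h b\<close> in any horoball at \<open>\<xi>\<close>. On a subset of
  positive measure their number is bounded, and then each \<open>H\<close>-orbit meets the points of norm about
  \<open>n\<close> whose shadows meet that subset boundedly often; so there are at least \<open>c exp (\<omega> n)\<close> orbits.

  Conversely, if there are at least \<open>c exp (\<omega> n)\<close> orbits for infinitely many \<open>n\<close>, take the limit
  superior \<open>E\<close> of the shadows of those nearest-point representatives \<open>x\<close> for which boundedly many
  \<open>h \<in> H\<close> satisfy \<open>d(h b, x) \<le> d(b, x) + O(1)\<close>. It has positive measure, and each \<open>\<xi> \<in> E\<close> returns to
  \<open>E\<close> under a bounded number of \<open>h \<in> H\<close>. For a conservative action of a torsion-free group,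
  Poincare recurrence produces arbitrarily many returns.\<close>

text \<open>Hyperbolic inequalities hold up to additive errors and boundary points are classes of
  sequences, so products with a boundary point are only coarsely defined. Arguments about such
  points therefore take one late term of a representing sequence at which finitely many conditions
  hold at once; this is why shadows are made open. Weak convergence sees only continuous functions.
  The passage to sets avoids a visual metric: the bordification is compact Hausdorff, hence normal,
  and its open sets are countable unions of closed sets, which suffices for Urysohn functions and
  regular measures. That \<mu> gives full mass to the boundary comes from divergence of the Poincare
  series at \<omega>, a consequence of the submultiplicativity of annuli. At the end a set
  \<open>B\<close> of positive mass is kept together with a finite \<open>J\<close> of elements
  carrying \<open>B\<close> into \<open>E\<close>. Each recurrence shrinks \<open>B\<close> and
  adjoins to \<open>J\<close> its right translate by a nontrivial element. A finite nonempty set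
  stable under such a translation would give that element finite order, so torsion-freeness makes
  \<open>J\<close> grow past every bound.\<close>

lemma gromov_product_commute: "gromov_product b x y = gromov_product b y x"
  by (simp add: gromov_product_def dist_commute)

lemma gromov_product_le: "gromov_product b x y \<le> dist b x"
  using dist_triangle[of b y x] by (simp add: gromov_product_def dist_commute)

lemma gromov_product_le': "gromov_product b x y \<le> dist b y"
  using gromov_product_le[of b y x] by (simp add: gromov_product_commute)

lemma gromov_product_self: "gromov_product b x x = dist b x"
  by (simp add: gromov_product_def)

lemma gromov_product_diff_le: "\<bar>gromov_product b x y - gromov_product b x' y\<bar> \<le> dist x x'"
  using dist_triangle[of b x x'] dist_triangle[of b x' x] dist_triangle[of x y x']
    dist_triangle[of x' y x]
  by (simp add: gromov_product_def dist_commute abs_le_iff field_simps)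

lemma gromov_product_base_diff_le: "\<bar>gromov_product b x y - gromov_product b' x y\<bar> \<le> dist b b'"
  using dist_triangle[of b x b'] dist_triangle[of b' x b] dist_triangle[of b y b']
    dist_triangle[of b' y b]
  by (simp add: gromov_product_def dist_commute abs_le_iff field_simps)

text \<open>The products at the two ends of the side from \<open>b\<close> to \<open>x\<close> add
  up to its length, so a large product at one end is a small product at the other. The lower shadow
  bound rests on this exchange.\<close>

lemma gromov_product_complement:
  "gromov_product b x y + gromov_product x b y = dist b x"
  by (simp add: gromov_product_def dist_commute field_simps)

lemma dist_eq_gromov_product: "dist x y = dist b x + dist b y - 2 * gromov_product b x y"
  by (simp add: gromov_product_def field_simps)

section \<open>Four-point hyperbolicity and geodesics\<close>

locale hyperbolic =
  fixes b :: "'a::heine_borel" and \<delta> :: real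
  assumes \<delta>_nonneg: "\<delta> \<ge> 0"
    and hyp: "\<And>o' x y z :: 'a.
      gromov_product o' x z \<ge> min (gromov_product o' x y) (gromov_product o' y z) - \<delta>"
    and geodesic: "geodesic_space TYPE('a)"
begin

abbreviation gp where "gp \<equiv> gromov_product b"
abbreviation ext where "ext \<equiv> extended_product b"
abbreviation T where "T \<equiv> bordification_topology b"
abbreviation sq where "sq \<equiv> sequentially \<times>\<^sub>F sequentially"

text \<open>The symmetric form of hyperbolicity: among the three sums of opposite sides of a
  quadrilateral the two largest differ by at most 2 \<delta>.\<close>

lemma four_point: "dist x z + dist y w \<le> max (dist x y + dist z w) (dist x w + dist y (z::'a)) + 2 * \<delta>"
proof -
  have "min (dist w x + dist w y - dist x y) (dist w y + dist w z - dist y z) - 2 * \<delta>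
      \<le> dist w x + dist w z - dist x z"
    using hyp[where o'=w and x=x and y=y and z=z] unfolding gromov_product_def min_def
    by (auto split: if_splits simp: field_simps)
  thus ?thesis by (auto simp: dist_commute max_def min_def split: if_splits)
qed

text \<open>Differences of distances to \<open>x\<close> and to \<open>b\<close> stand in for
  Busemann functions. When \<open>p\<close> and \<open>q\<close> have product beyond the norm of
  \<open>x\<close>, the alternative d(b, x) + d(p, q) in the four-point inequality is too small to
  be the maximum, so the two values nearly agree.\<close>

lemma busemann_stable:
  assumes "gp p q > dist b x + \<delta>"
  shows "\<bar>(dist x p - dist b p) - (dist x q - dist b q)\<bar> \<le> 2 * \<delta>"
proof -
  have *: "dist x p + dist b q \<le> dist x q + dist b p + 2 * \<delta>" if "gp p q > dist b x + \<delta>" for p q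
  proof -
    have 1: "dist b p \<le> dist b x + dist x p" by (rule dist_triangle)
    have "dist x p + dist b q \<le> max (dist x q + dist b p) (dist b x + dist p q) + 2 * \<delta>"
      using four_point[of x p q b] by (simp add: dist_commute add.commute)
    moreover have "dist b x + dist p q + 2 * \<delta> < dist b p + dist b q - dist b x"
      using that dist_eq_gromov_product[of p q b] by linarith
    ultimately show ?thesis using 1 by linarith
  qed
  show ?thesis using *[of p q] *[of q p] assms by (simp add: gromov_product_commute abs_le_iff)
qed

lemma geodesic_point:
  fixes x y :: 'a
  assumes "0 \<le> t" "t \<le> dist x y"
  obtains z where "dist x z = t" "dist z y = dist x y - t"
proof -
  obtain c where c: "c 0 = x" "c (dist x y) = y"
     "\<forall>s \<in> {0..dist x y}. \<forall>t \<in> {0..dist x y}. dist (c s) (c t) = \<bar>s - t\<bar>"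
    using geodesic unfolding geodesic_space_def by blast
  have "dist (c 0) (c t) = \<bar>0 - t\<bar>" "dist (c t) (c (dist x y)) = \<bar>t - dist x y\<bar>"
    using c(3) assms by auto
  thus thesis using that[of "c t"] c assms by auto
qed

lemma geodesic_point_gp:
  assumes "0 \<le> t" "t \<le> dist b y"
  obtains z where "dist b z = t" "gp z y = t" "dist z y = dist b y - t"
proof -
  obtain z where "dist b z = t" "dist z y = dist b y - t"
    using geodesic_point[OF assms] .
  thus thesis using that[of z] by (simp add: gromov_product_def)
qed

section \<open>Extended Gromov products\<close>

lemma ev_sq: "eventually (\<lambda>(i,j). P i j) sq \<longleftrightarrow> (\<exists>N. \<forall>i\<ge>N. \<forall>j\<ge>N. P i j)"
  by (auto simp: eventually_prod_sequentially)

text \<open>Threshold form of the double limit inferior in \<open>extended_product\<close>, to which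
  hyperbolicity applies term by term.\<close>

definition near :: "real \<Rightarrow> (nat \<Rightarrow> 'a) \<Rightarrow> (nat \<Rightarrow> 'a) \<Rightarrow> bool" where
  "near R u v \<longleftrightarrow> (\<exists>N. \<forall>i\<ge>N. \<forall>j\<ge>N. gp (u i) (v j) > R)"

lemma near_mono: "near R u v \<Longrightarrow> R' \<le> R \<Longrightarrow> near R' u v"
  unfolding near_def by (meson order_le_less_trans)

lemma near_sym: "near R u v \<longleftrightarrow> near R v u"
  unfolding near_def by (metis gromov_product_commute)

lemma near_trans:
  assumes "near R u v" "near R v w"
  shows "near (R - \<delta>) u w"
proof -
  obtain N M where N: "\<forall>i\<ge>N. \<forall>j\<ge>N. gp (u i) (v j) > R" "\<forall>i\<ge>M. \<forall>j\<ge>M. gp (v i) (w j) > R"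
    using assms unfolding near_def by blast
  have "gp (u i) (w j) > R - \<delta>" if "i \<ge> max N M" "j \<ge> max N M" for i j
  proof -
    have "gp (u i) (v (max N M)) > R" "gp (v (max N M)) (w j) > R" using N that by auto
    thus ?thesis using hyp[where o'=b and x="u i" and y="v (max N M)" and z="w j"] by linarith
  qed
  thus ?thesis unfolding near_def by blast
qed

lemma gromov_sequences_iff: "u \<in> gromov_sequences b \<longleftrightarrow> (\<forall>R. near R u u)"
proof -
  have "u \<in> gromov_sequences b \<longleftrightarrow> (\<forall>R. \<exists>N. \<forall>i\<ge>N. \<forall>j\<ge>N. gp (u i) (u j) > R)"
    unfolding gromov_sequences_def filterlim_at_top_dense
    by (simp add: eventually_prod_sequentially) (metis gromov_product_commute)
  thus ?thesis by (simp add: near_def)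
qed

lemma gromov_rel_iff:
  "(u, v) \<in> gromov_rel b \<longleftrightarrow> u \<in> gromov_sequences b \<and> v \<in> gromov_sequences b \<and> (\<forall>R. near R u v)"
proof -
  have "filterlim (\<lambda>(i, j). gp (u i) (v j)) at_top sq \<longleftrightarrow> (\<forall>R. \<exists>N. \<forall>i\<ge>N. \<forall>j\<ge>N. gp (u i) (v j) > R)"
    unfolding filterlim_at_top_dense by (simp add: eventually_prod_sequentially) blast
  thus ?thesis by (auto simp: gromov_rel_def near_def)
qed

lemma equiv_gromov_rel: "equiv (gromov_sequences b) (gromov_rel b)"
proof (rule equivI)
  show "gromov_rel b \<subseteq> gromov_sequences b \<times> gromov_sequences b" by (auto simp: gromov_rel_def)
  show "refl_on (gromov_sequences b) (gromov_rel b)"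
    by (auto simp: refl_on_def gromov_rel_iff gromov_sequences_iff)
  show "sym (gromov_rel b)" by (auto simp: sym_def gromov_rel_iff near_sym)
  show "trans (gromov_rel b)"
  proof (rule transI)
    fix x y z assume a: "(x, y) \<in> gromov_rel b" "(y, z) \<in> gromov_rel b"
    have "near R x z" for R
      using near_trans[of "R + \<delta>" x y z] a by (auto simp: gromov_rel_iff)
    thus "(x, z) \<in> gromov_rel b" using a by (auto simp: gromov_rel_iff)
  qed
qed

lemma boundary_class: "\<xi> \<in> gromov_boundary b \<Longrightarrow> u \<in> \<xi> \<Longrightarrow> v \<in> \<xi> \<Longrightarrow> near R u v"
  using quotient_eq_iff[OF equiv_gromov_rel, of \<xi> \<xi> u v]
  by (simp add: gromov_boundary_def gromov_rel_iff)

lemma boundary_nonempty: "\<xi> \<in> gromov_boundary b \<Longrightarrow> \<exists>u. u \<in> \<xi>"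
  unfolding gromov_boundary_def by (metis equiv_gromov_rel in_quotient_imp_non_empty ex_in_conv)

lemma boundary_mem_sequences: "\<xi> \<in> gromov_boundary b \<Longrightarrow> u \<in> \<xi> \<Longrightarrow> u \<in> gromov_sequences b"
  using boundary_class gromov_sequences_iff by blast

lemma boundary_eqI:
  assumes "\<xi> \<in> gromov_boundary b" "\<eta> \<in> gromov_boundary b" "u \<in> \<xi>" "v \<in> \<eta>" "\<And>R. near R u v"
  shows "\<xi> = \<eta>"
  using quotient_eq_iff[OF equiv_gromov_rel, of \<xi> \<eta> u v] assms boundary_mem_sequences
  by (simp add: gromov_boundary_def gromov_rel_iff)

lemma boundary_memI:
  assumes "\<xi> \<in> gromov_boundary b" "u \<in> \<xi>" "v \<in> gromov_sequences b" "\<And>R. near R u v"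
  shows "v \<in> \<xi>"
  using in_quotient_imp_closed[OF equiv_gromov_rel, of \<xi> u v] assms boundary_mem_sequences
  by (simp add: gromov_boundary_def gromov_rel_iff)

lemma class_in_boundary:
  assumes "u \<in> gromov_sequences b"
  shows "gromov_rel b `` {u} \<in> gromov_boundary b" "u \<in> gromov_rel b `` {u}"
  using assms by (auto simp: gromov_boundary_def quotientI gromov_rel_iff gromov_sequences_iff)

lemma mem_bordification: "p \<in> bordification b \<longleftrightarrow> (case p of Inl x \<Rightarrow> True | Inr \<xi> \<Rightarrow> \<xi> \<in> gromov_boundary b)"
  by (cases p) (auto simp: bordification_def boundary_part_def)

lemma Inl_bord [simp]: "Inl x \<in> bordification b" and
  Inr_bord [simp]: "Inr \<xi> \<in> bordification b \<longleftrightarrow> \<xi> \<in> gromov_boundary b"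
  by (auto simp: mem_bordification)

lemma sequences_to_nonempty: "p \<in> bordification b \<Longrightarrow> \<exists>u. u \<in> sequences_to p"
  using boundary_nonempty by (cases p) (auto intro: exI[of _ "\<lambda>_. _"])

text \<open>Two sequences for a boundary point are equivalent; two sequences for a point of X are
  eventually within distance 1, which is the source of the summand 1.\<close>

lemma near_change_left:
  assumes "p \<in> bordification b" "u \<in> sequences_to p" "u' \<in> sequences_to p" "near R u v"
  shows "near (R - \<delta> - 1) u' v"
proof (cases p)
  case (Inr \<xi>)
  hence "near R u' u" using assms boundary_class by auto
  from near_trans[OF this assms(4)] show ?thesis by (rule near_mono) simp
next
  case (Inl x)
  hence "u \<longlonglongrightarrow> x" "u' \<longlonglongrightarrow> x" using assms by auto
  hence "(\<lambda>i. dist (u i) x + dist (u' i) x) \<longlonglongrightarrow> 0"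
    by (auto intro: tendsto_add_zero simp: tendsto_dist_iff[symmetric])
  hence "\<forall>\<^sub>F i in sequentially. dist (u i) x + dist (u' i) x < 1" by (rule order_tendstoD) simp
  then obtain M where M: "\<And>i. i \<ge> M \<Longrightarrow> dist (u i) x + dist (u' i) x < 1"
    by (auto simp: eventually_sequentially)
  obtain N where N: "\<forall>i\<ge>N. \<forall>j\<ge>N. gp (u i) (v j) > R" using assms unfolding near_def by blast
  have "gp (u' i) (v j) > R - \<delta> - 1" if "i \<ge> max N M" "j \<ge> max N M" for i j
  proof -
    have "dist (u i) (u' i) < 1" using M[of i] that dist_triangle2[of "u i" "u' i" x] by simp
    moreover have "gp (u i) (v j) > R" using N that by auto
    ultimately show ?thesis using gromov_product_diff_le[of b "u i" "v j" "u' i"] \<delta>_nonneg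
      by linarith
  qed
  thus ?thesis unfolding near_def by blast
qed

lemma near_change:
  assumes "p \<in> bordification b" "u \<in> sequences_to p" "u' \<in> sequences_to p"
    "q \<in> bordification b" "v \<in> sequences_to q" "v' \<in> sequences_to q" "near R u v"
  shows "near (R - 2 * \<delta> - 2) u' v'"
  using near_change_left[OF assms(4,5,6), of "R - \<delta> - 1" u'] near_change_left[OF assms(1,2,3,7)]
  by (simp add: near_sym algebra_simps) 

text \<open>The strict inequality is due to the limit inferior: values above \<open>R\<close> may
  have limit inferior \<open>R\<close>.\<close>

lemma extI:
  assumes "u \<in> sequences_to p" "v \<in> sequences_to q" "near R u v" "R' < R"
  shows "ext p q > ereal R'"
proof -
  let ?L = "Liminf sq (\<lambda>(i, j). ereal (gp (u i) (v j)))"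
  have "eventually (\<lambda>(i, j). ereal R \<le> ereal (gp (u i) (v j))) sq"
    using assms(3) unfolding ev_sq near_def by (auto intro: less_imp_le)
  hence "ereal R \<le> ?L" by (intro Liminf_bounded) (simp add: case_prod_unfold)
  also have "?L \<le> ext p q" unfolding extended_product_def
    by (rule SUP_upper2[of "(u,v)"]) (use assms in auto)
  finally show ?thesis using assms(4) by (meson ereal_less(2) less_ereal.simps(1) order_less_le_trans)
qed

text \<open>Recovers the margin that \<open>extI\<close> costs, so that symmetry and the comparison
  at points of X come without loss.\<close>

lemma extE_strict:
  assumes "ext p q > ereal R"
  obtains u v R' where "u \<in> sequences_to p" "v \<in> sequences_to q" "near R' u v" "R' > R"
proof -
  obtain u v where uv: "u \<in> sequences_to p" "v \<in> sequences_to q"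
    "Liminf sq (\<lambda>(i, j). ereal (gp (u i) (v j))) > ereal R"
    using assms unfolding extended_product_def less_SUP_iff by auto
  obtain R' where R': "ereal R < ereal R'" "Liminf sq (\<lambda>(i, j). ereal (gp (u i) (v j))) > ereal R'"
    using ereal_dense2[OF uv(3)] by blast
  have "eventually (\<lambda>x. ereal R' < (\<lambda>(i, j). ereal (gp (u i) (v j))) x) sq"
    by (rule less_LiminfD[OF R'(2)])
  hence "near R' u v" unfolding near_def ev_sq[symmetric] by (simp add: case_prod_unfold)
  thus thesis using that uv R' by simp
qed

lemma extE:
  assumes "ext p q > ereal R"
  obtains u v where "u \<in> sequences_to p" "v \<in> sequences_to q" "near R u v"
proof -
  obtain u v R' where "u \<in> sequences_to p" "v \<in> sequences_to q" "near R' u v" "R' > R"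
    using extE_strict[OF assms] .
  thus thesis using that near_mono[of R' u v R] by simp
qed

lemma ext_near:
  assumes "ext p q > ereal R" "p \<in> bordification b" "q \<in> bordification b"
    "u \<in> sequences_to p" "v \<in> sequences_to q"
  shows "near (R - 2 * \<delta> - 2) u v"
proof -
  obtain u' v' where "u' \<in> sequences_to p" "v' \<in> sequences_to q" "near R u' v'"
    using extE[OF assms(1)] .
  thus ?thesis using near_change[of p u' u q v' v R] assms(2-5) by simp
qed

lemma ext_sym: "ext p q > ereal R \<longleftrightarrow> ext q p > ereal R"
  by (meson extE_strict extI near_sym)

text \<open>Error in the transitivity of large extended products: 2 \<delta> + 2 for changing
  representing sequences (\<open>ext_near\<close>), \<delta> for hyperbolicity, 1 for the strict
  inequality in \<open>extI\<close>.\<close>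

definition cc :: real where "cc = 3 * \<delta> + 3"

lemma ext_trans:
  assumes "ext p q > ereal R" "ext q r > ereal R" "p \<in> bordification b" "q \<in> bordification b" "r \<in> bordification b"
  shows "ext p r > ereal (R - cc)"
proof -
  obtain u v w where s: "u \<in> sequences_to p" "v \<in> sequences_to q" "w \<in> sequences_to r"
    using sequences_to_nonempty assms by metis
  have "near (R - 2 * \<delta> - 2 - \<delta>) u w"
    using ext_near[OF assms(1,3,4) s(1,2)] ext_near[OF assms(2,4,5) s(2,3)] near_trans by blast
  thus ?thesis using extI[OF s(1,3)] by (simp add: cc_def)
qed

lemma const_seq: "(\<lambda>_. x) \<in> sequences_to (Inl x)" by simp

lemma near_const: "near R (\<lambda>_. x) v \<longleftrightarrow> (\<exists>N. \<forall>j\<ge>N. gp x (v j) > R)"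
  unfolding near_def by (metis order_refl)

text \<open>At points of X the product is continuous, so the supremum over approximating sequences
  adds nothing.\<close>

lemma ext_Inl_Inl: assumes "ext (Inl x) (Inl y) > ereal R" shows "gp x y > R"
proof -
  obtain u v R' where s: "u \<in> sequences_to (Inl x)" "v \<in> sequences_to (Inl y)"
    and R': "near R' u v" "R' > R"
    using extE_strict[OF assms] by blast
  obtain N where N: "\<forall>i\<ge>N. \<forall>j\<ge>N. gp (u i) (v j) > R'"
    using R' unfolding near_def by blast
  have "(\<lambda>i. gp (u i) (v i)) \<longlonglongrightarrow> gp x y"
    unfolding gromov_product_def using s by (auto intro!: tendsto_intros)
  hence "gp x y \<ge> R'" by (rule tendsto_lowerbound)
    (use N in \<open>auto simp: eventually_sequentially intro!: exI[of _ N] less_imp_le\<close>)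
  thus ?thesis using R' by simp
qed

lemma ext_Inl_InlI: "R < gp x y \<Longrightarrow> ext (Inl x) (Inl y) > ereal R"
proof -
  assume "R < gp x y"
  hence "near ((R + gp x y) / 2) (\<lambda>_. x) (\<lambda>_. y)" by (auto simp: near_def)
  thus ?thesis by (rule extI[OF const_seq const_seq]) (use \<open>R < gp x y\<close> in simp)
qed

lemma ext_self: "\<xi> \<in> gromov_boundary b \<Longrightarrow> ext (Inr \<xi>) (Inr \<xi>) > ereal R"
  using boundary_nonempty[of \<xi>] boundary_class[of \<xi>] extI[of _ "Inr \<xi>" _ "Inr \<xi>" "R+1" R] by auto

lemma ext_infinite_eq:
  assumes "\<xi> \<in> gromov_boundary b" "\<eta> \<in> gromov_boundary b" "\<And>R::real. ext (Inr \<xi>) (Inr \<eta>) > ereal R"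
  shows "\<xi> = \<eta>"
proof -
  obtain u v where uv: "u \<in> \<xi>" "v \<in> \<eta>" using assms boundary_nonempty by blast
  have "near R u v" for R
    using ext_near[OF assms(3)[of "R + 2 * \<delta> + 2"]] assms uv by simp
  thus ?thesis using boundary_eqI assms uv by blast
qed

section \<open>The bordification\<close>

definition hood :: "real \<Rightarrow> ('a + (nat \<Rightarrow> 'a) set) \<Rightarrow> ('a + (nat \<Rightarrow> 'a) set) set" where
  "hood R q = {p \<in> bordification b. ext p q > ereal R}"

lemma hood_mono: "R \<le> R' \<Longrightarrow> hood R' q \<subseteq> hood R q"
  unfolding hood_def by (auto intro: le_less_trans[of "ereal R" "ereal R'"])

lemma openin_T: "openin T U \<longleftrightarrow> U \<subseteq> bordification b \<and> open (Inl -` U) \<and>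
     (\<forall>\<xi>. Inr \<xi> \<in> U \<longrightarrow> (\<exists>R. hood R (Inr \<xi>) \<subseteq> U))"
  by (simp add: openin_bordification_topology bordification_open_def hood_def)

lemma topspace_T [simp]: "topspace T = bordification b"
  by (rule topspace_bordification_topology)

lemma openin_Inl_image [simp]: "openin T (Inl ` V) \<longleftrightarrow> open V"
  unfolding openin_T by (auto simp: inj_vimage_image_eq)

lemma hood_trans:
  assumes "q \<in> bordification b" "r \<in> bordification b" "q \<in> hood (R + cc) r"
  shows "hood (R + cc) q \<subseteq> hood R r"
  using ext_trans[of "R + cc"] assms by (auto simp: hood_def)

lemma ext_Inl_perturb:
  assumes "ext (Inl x) q > ereal R" "q \<in> bordification b" "dist x y \<le> 1"
  shows "ext (Inl y) q > ereal (R - cc - 1)"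
proof -
  obtain v where v: "v \<in> sequences_to q" using sequences_to_nonempty assms by blast
  have "near (R - 2 * \<delta> - 2) (\<lambda>_. x) v"
    using ext_near[OF assms(1) _ assms(2) const_seq v] by simp
  then obtain N where N: "\<forall>j\<ge>N. gp x (v j) > R - 2 * \<delta> - 2" unfolding near_const by blast
  have "gp y (v j) > R - 2 * \<delta> - 3" if "j \<ge> N" for j
    using gromov_product_diff_le[of b x "v j" y] N assms(3) that by (smt (verit))
  hence "near (R - 2 * \<delta> - 3) (\<lambda>_. y) v" unfolding near_const by blast
  thus ?thesis by (rule extI[OF const_seq v]) (use \<delta>_nonneg in \<open>simp add: cc_def\<close>)
qed

text \<open>A \<open>hood\<close> need not be open, but its interior contains a slightly smaller
  one: \<open>cc\<close> pays for \<open>ext_trans\<close> at boundary points, \<open>cc + 1\<close>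
  for moving a point of X within a unit ball.\<close>

lemma hood_interior:
  assumes "q \<in> bordification b" "hood R q \<subseteq> S"
  shows "hood (R + cc + 1) q \<subseteq> T interior_of S"
proof -
  \<comment> \<open>The expected interior of \<open>S\<close>: metric interior in X, and the
    boundary points with some \<open>hood\<close> inside \<open>S\<close>. Its openness at boundary
    points is the inclusion proved next, which is why that inclusion is stated for every centre and
    threshold.\<close>
  let ?U = "{p \<in> bordification b. case p of Inl x \<Rightarrow> x \<in> interior (Inl -` S) | Inr \<eta> \<Rightarrow> \<exists>R. hood R (Inr \<eta>) \<subseteq> S}"
  have *: "hood (R + cc + 1) q \<subseteq> ?U" if q: "q \<in> bordification b" "hood R q \<subseteq> S" for R q
  proof
    fix p assume p: "p \<in> hood (R + cc + 1) q"
    show "p \<in> ?U"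
    proof (cases p)
      case (Inl x)
      have "ball x 1 \<subseteq> Inl -` S"
      proof
        fix y assume "y \<in> ball x 1"
        hence "ext (Inl y) q > ereal (R + cc + 1 - cc - 1)"
          by (intro ext_Inl_perturb[of _ x]) (use p Inl q in \<open>auto simp: hood_def\<close>)
        thus "y \<in> Inl -` S" using q(2) by (auto simp: hood_def)
      qed
      hence "x \<in> interior (Inl -` S)" by (meson centre_in_ball interiorI open_ball zero_less_one)
      thus ?thesis using Inl by simp
    next
      case (Inr \<eta>)
      have "hood (R + cc) p \<subseteq> hood R q"
        by (rule hood_trans) (use q p hood_mono[of "R + cc" "R + cc + 1" q] in \<open>auto simp: hood_def\<close>)
      thus ?thesis using p q(2) Inr by (auto simp: hood_def)
    qed
  qed
  have "openin T ?U"
    unfolding openin_T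
  proof (intro conjI allI impI)
    have "Inl -` ?U = interior (Inl -` S)" by auto
    thus "open (Inl -` ?U)" by (simp only: open_interior)
    fix \<xi> assume "Inr \<xi> \<in> ?U"
    thus "\<exists>R. hood R (Inr \<xi>) \<subseteq> ?U" using *[of "Inr \<xi>"] by auto
  qed auto
  moreover have "?U \<subseteq> S"
  proof
    fix p assume "p \<in> ?U"
    thus "p \<in> S" using interior_subset[of "Inl -` S"] ext_self
      by (cases p) (auto simp: hood_def)
  qed
  ultimately show ?thesis using *[OF assms] interior_of_maximal by blast
qed

lemma self_hood: "\<xi> \<in> gromov_boundary b \<Longrightarrow> Inr \<xi> \<in> hood R (Inr \<xi>)"
  by (simp add: hood_def ext_self)

lemma boundary_eventually_hood:
  assumes "\<xi> \<in> gromov_boundary b" "u \<in> \<xi>"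
  shows "\<forall>\<^sub>F i in sequentially. Inl (u i) \<in> hood R (Inr \<xi>)"
proof -
  have "near (R + 1) u u" using boundary_class assms by blast
  then obtain N where N: "\<forall>i\<ge>N. \<forall>j\<ge>N. gp (u i) (u j) > R + 1" unfolding near_def by blast
  have "Inl (u i) \<in> hood R (Inr \<xi>)" if "i \<ge> N" for i
  proof -
    have "near (R + 1) (\<lambda>_. u i) u" using N that by (auto simp: near_const)
    from extI[OF const_seq _ this, of "Inr \<xi>" R] show ?thesis using assms by (simp add: hood_def)
  qed
  thus ?thesis by (auto simp: eventually_sequentially)
qed

lemma boundary_eventually_open:
  assumes "openin T U" "Inr \<xi> \<in> U" "u \<in> \<xi>"
  shows "\<forall>\<^sub>F i in sequentially. Inl (u i) \<in> U"
proof -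
  obtain R where R: "hood R (Inr \<xi>) \<subseteq> U" using assms unfolding openin_T by blast
  have "\<xi> \<in> gromov_boundary b" using assms by (auto simp: openin_T)
  from boundary_eventually_hood[OF this assms(3), of R] show ?thesis
    using R by (auto elim: eventually_mono)
qed

lemma ext_le_dist: "ext (Inl x) q > ereal R \<Longrightarrow> R < dist b x + 1"
proof -
  assume "ext (Inl x) q > ereal R"
  then obtain u v where uv: "u \<in> sequences_to (Inl x)" "near R u v" using extE by metis
  have "u \<longlonglongrightarrow> x" using uv by simp
  hence "\<forall>\<^sub>F i in sequentially. dist (u i) x < 1" by (auto dest: tendstoD[of _ _ _ 1])
  then obtain M where M: "\<And>i. i \<ge> M \<Longrightarrow> dist (u i) x < 1" by (auto simp: eventually_sequentially)
  obtain N where N: "\<forall>i\<ge>N. \<forall>j\<ge>N. gp (u i) (v j) > R" using uv unfolding near_def by blast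
  have "gp (u (max M N)) (v (max M N)) > R" "dist (u (max M N)) x < 1" using M N by auto
  thus ?thesis using gromov_product_le[of b "u (max M N)" "v (max M N)"]
     dist_triangle[of b "u (max M N)" x] by (simp add: dist_commute)
qed

text \<open>The mixed case uses \<open>ext_le_dist\<close>: points with large product with a
  boundary point are far from \<open>b\<close>, hence outside a given unit ball.\<close>

lemma Hausdorff_T: "Hausdorff_space T"
  unfolding Hausdorff_space_def
proof (intro allI impI; elim conjE)
  let ?I = "\<lambda>R q. T interior_of hood R q"
  have I: "Inr \<xi> \<in> ?I R (Inr \<xi>)" if "\<xi> \<in> gromov_boundary b" for R \<xi>
    using hood_interior[of "Inr \<xi>" R "hood R (Inr \<xi>)"] self_hood[OF that] that by auto
  have mixed: "\<exists>U V. openin T U \<and> openin T V \<and> Inl x \<in> U \<and> Inr \<xi> \<in> V \<and> disjnt U V"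
    if "\<xi> \<in> gromov_boundary b" for x \<xi>
  proof (intro exI conjI)
    let ?R = "dist b x + 3"
    show "openin T (Inl ` ball x 1)" "openin T (?I ?R (Inr \<xi>))" by simp_all
    show "Inl x \<in> Inl ` ball x 1" "Inr \<xi> \<in> ?I ?R (Inr \<xi>)" using I that by auto
    have False if y: "y \<in> ball x 1" "Inl y \<in> hood ?R (Inr \<xi>)" for y
      using y ext_le_dist[of ?R y "Inr \<xi>"] dist_triangle[of b y x] by (auto simp: hood_def)
    thus "disjnt (Inl ` ball x 1) (?I ?R (Inr \<xi>))"
      using interior_of_subset[of T "hood ?R (Inr \<xi>)"] by (force simp: disjnt_iff)
  qed
  fix p q assume pq: "p \<in> topspace T" "q \<in> topspace T" "p \<noteq> q"
  show "\<exists>U V. openin T U \<and> openin T V \<and> p \<in> U \<and> q \<in> V \<and> disjnt U V"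
  proof (cases p; cases q)
    fix x y assume xy: "p = Inl x" "q = Inl y"
    hence "x \<noteq> y" using pq by simp
    then obtain U V where "open U" "open V" "x \<in> U" "y \<in> V" "U \<inter> V = {}"
      using hausdorff[of x y] by blast
    thus ?thesis using xy
      by (intro exI[of _ "Inl ` U"] exI[of _ "Inl ` V"]) (auto simp: disjnt_iff)
  next
    fix x \<eta> assume "p = Inl x" "q = Inr \<eta>"
    thus ?thesis using mixed[of \<eta> x] pq by simp
  next
    fix \<xi> y assume "p = Inr \<xi>" "q = Inl y"
    thus ?thesis using mixed[of \<xi> y] pq by (simp add: disjnt_sym) (metis disjnt_sym)
  next
    fix \<xi> \<eta> assume e: "p = Inr \<xi>" "q = Inr \<eta>"
    \<comment> \<open>Distinct boundary points have bounded product; a common point of two deeper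
      hoods would push it above that bound by \<open>ext_trans\<close>.\<close>
    then obtain R :: real where R: "\<not> ext (Inr \<xi>) (Inr \<eta>) > ereal R"
      using ext_infinite_eq[of \<xi> \<eta>] pq by auto
    have "False" if "r \<in> hood (R + cc) p" "r \<in> hood (R + cc) q" for r
      using that ext_trans[of "R + cc" p r q] e pq R by (auto simp: hood_def ext_sym)
    hence "disjnt (?I (R + cc) p) (?I (R + cc) q)"
      using interior_of_subset[of T] by (meson disjnt_iff subsetD)
    thus ?thesis using I e pq
      by (intro exI[of _ "?I (R + cc) p"] exI[of _ "?I (R + cc) q"]) auto
  qed
qed

lemma continuous_map_Inl: "continuous_map euclidean T Inl"
  unfolding continuous_map_def
proof (intro conjI allI impI)
  fix U assume "openin T U"
  moreover have "{x \<in> topspace euclidean. Inl x \<in> U} = Inl -` U" by auto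
  ultimately show "openin euclidean {x \<in> topspace euclidean. Inl x \<in> U}" by (simp add: openin_T)
qed simp

lemma compactin_Inl: "compact K \<Longrightarrow> compactin T (Inl ` K)"
  by (rule image_compactin[OF _ continuous_map_Inl]) simp

lemma closedin_Inl: "compact K \<Longrightarrow> closedin T (Inl ` K)"
  by (rule compactin_imp_closedin[OF Hausdorff_T compactin_Inl])

text \<open>Geodesics to points outside the ball cross its sphere, and a finite 1-net replaces the
  crossing points. The loss is 1 for the net and \<delta> for passing to the tail of a sequence; the
  rest is slack.\<close>

lemma shadow_net:
  assumes "n \<ge> 0"
  obtains Z where "finite Z" "\<And>p. p \<in> bordification b \<Longrightarrow> p \<notin> Inl ` cball b n \<Longrightarrow>
    \<exists>z\<in>Z. ext p (Inl z) > ereal (n - \<delta> - 3)"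
proof -
  have "compact (cball b n)" by simp
  then obtain Z where Z: "Z \<subseteq> cball b n" "finite Z" "cball b n \<subseteq> (\<Union>z\<in>Z. ball z 1)"
    by (rule compactE_image[of _ "cball b n" "\<lambda>z. ball z 1"]) auto
  have Zy: "\<exists>z\<in>Z. gp z y > n - 1" if y: "dist b y > n" for y
  proof -
    obtain y' where y': "dist b y' = n" "gp y' y = n"
      using geodesic_point_gp[of n y] y assms by (metis less_imp_le)
    then obtain z where "z \<in> Z" "dist y' z < 1" using Z(3) by (force simp: dist_commute)
    thus ?thesis using gromov_product_diff_le[of b y' y z] y' by (intro bexI[of _ z]) auto
  qed
  have "\<exists>z\<in>Z. ext p (Inl z) > ereal (n - \<delta> - 3)"
    if p: "p \<in> bordification b" "p \<notin> Inl ` cball b n" for p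
  proof (cases p)
    case (Inl y)
    hence "dist b y > n" using p by auto
    from Zy[OF this] obtain z where "z \<in> Z" "gp z y > n - 1" by blast
    thus ?thesis using Inl ext_Inl_InlI[of "n - \<delta> - 3" y z] \<delta>_nonneg
      by (auto simp: gromov_product_commute)
  next
    case (Inr \<xi>)
    then obtain u where u: "u \<in> \<xi>" "near n u u" using p boundary_nonempty boundary_class by force
    then obtain N where N: "\<forall>i\<ge>N. \<forall>j\<ge>N. gp (u i) (u j) > n" unfolding near_def by blast
    hence "dist b (u N) > n" using gromov_product_self[of b "u N"] by force
    from Zy[OF this] obtain z where z: "z \<in> Z" "gp z (u N) > n - 1" by blast
    have "gp z (u j) > n - \<delta> - 2" if "j \<ge> N" for j
    proof -
      have "gp (u N) (u j) > n" using N that by blast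
      thus ?thesis using hyp[where o'=b and x=z and y="u N" and z="u j"] z by linarith
    qed
    hence "near (n - \<delta> - 2) (\<lambda>_. z) u" unfolding near_const by blast
    from extI[OF const_seq _ this, of "Inr \<xi>"] have "ext (Inl z) p > ereal (n - \<delta> - 3)"
      using u Inr by simp
    thus ?thesis using z(1) ext_sym by blast
  qed
  with Z(2) show thesis using that by blast
qed

text \<open>A Koenig-type argument: a part of the bordification that is not finitely covered is split by
  the finitely many shadows of points at distance about \<open>n\<close>; choosing a bad piece for every \<open>n\<close>
  produces a boundary point all of whose neighbourhoods are bad.\<close>

lemma compact_T: "compact_space T"
  unfolding compact_space_def compactin_def topspace_T
proof (intro conjI allI impI; (elim conjE)?)
  fix \<U> assume op: "\<forall>U\<in>\<U>. openin T U" and cov: "bordification b \<subseteq> \<Union> \<U>"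
  define bad where "bad S \<longleftrightarrow> \<not> (\<exists>\<F>. finite \<F> \<and> \<F> \<subseteq> \<U> \<and> S \<subseteq> \<Union> \<F>)" for S
  have bad_Un: "bad S \<or> bad S'" if "bad (S \<union> S')" for S S'
  proof (rule ccontr)
    assume "\<not> (bad S \<or> bad S')"
    then obtain F F' where "finite F \<and> F \<subseteq> \<U> \<and> S \<subseteq> \<Union> F" "finite F' \<and> F' \<subseteq> \<U> \<and> S' \<subseteq> \<Union> F'"
      unfolding bad_def by blast
    hence "finite (F \<union> F') \<and> F \<union> F' \<subseteq> \<U> \<and> S \<union> S' \<subseteq> \<Union> (F \<union> F')" by auto
    thus False using that unfolding bad_def by blast
  qed
  have bad_mono: "bad S'" if "bad S" "S \<subseteq> S'" for S S' using that unfolding bad_def by blast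
  have bad_empty: "\<not> bad {}" unfolding bad_def by blast
  have bad_UN: "\<exists>z\<in>Z. bad (A z)" if "finite Z" "bad (\<Union>z\<in>Z. A z)" for Z :: "'a set" and A
    using that
  proof (induction Z rule: finite_induct)
    case empty thus ?case using bad_empty by simp
  next
    case (insert z Z) thus ?case using bad_Un[of "A z" "\<Union> (A ` Z)"] by auto
  qed
  have bad_cball: "\<not> bad (Inl ` cball b r)" for r
  proof -
    have "Inl ` cball b r \<subseteq> \<Union> \<U>" using cov by auto
    thus ?thesis using compactin_Inl[of "cball b r"] op unfolding bad_def compactin_def by simp
  qed
  show "\<exists>\<F>. finite \<F> \<and> \<F> \<subseteq> \<U> \<and> bordification b \<subseteq> \<Union> \<F>"
  proof (rule ccontr)
    assume "\<not> ?thesis"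
    hence bad0: "bad (bordification b)" unfolding bad_def by blast
    let ?step = "\<lambda>n A A'. \<exists>z. A' = A \<inter> {p. ext p (Inl z) > ereal (real n - \<delta> - 3)}"
    have "\<exists>A. \<forall>n. (bad (A n) \<and> A n \<subseteq> bordification b) \<and> ?step n (A n) (A (Suc n))"
    proof (rule dependent_nat_choice)
      show "\<exists>A. bad A \<and> A \<subseteq> bordification b" using bad0 by blast
    next
      fix A :: "('a + (nat \<Rightarrow> 'a) set) set" and n assume A: "bad A \<and> A \<subseteq> bordification b"
      obtain Z where Z: "finite Z" "\<And>p. p \<in> bordification b \<Longrightarrow> p \<notin> Inl ` cball b (real n) \<Longrightarrow>
         \<exists>z\<in>Z. ext p (Inl z) > ereal (real n - \<delta> - 3)" using shadow_net[of "real n"] by auto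
      have "A \<subseteq> Inl ` cball b (real n) \<union> (\<Union>z\<in>Z. A \<inter> {p. ext p (Inl z) > ereal (real n - \<delta> - 3)})"
        using Z(2) A by blast
      hence "bad (Inl ` cball b (real n) \<union> (\<Union>z\<in>Z. A \<inter> {p. ext p (Inl z) > ereal (real n - \<delta> - 3)}))"
        using A bad_mono by blast
      hence "bad (\<Union>z\<in>Z. A \<inter> {p. ext p (Inl z) > ereal (real n - \<delta> - 3)})"
        using bad_Un bad_cball by blast
      then obtain z where "bad (A \<inter> {p. ext p (Inl z) > ereal (real n - \<delta> - 3)})"
        using bad_UN[OF Z(1)] by blast
      thus "\<exists>A'. (bad A' \<and> A' \<subseteq> bordification b) \<and> ?step n A A'" using A by blast
    qed
    then obtain A where A: "\<And>n. bad (A n)" "\<And>n. A n \<subseteq> bordification b" "\<And>n. ?step n (A n) (A (Suc n))"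
      by blast
    then obtain z where z: "\<And>n. A (Suc n) = A n \<inter> {p. ext p (Inl (z n)) > ereal (real n - \<delta> - 3)}"
      by metis
    have anti: "A n \<subseteq> A m" if "m \<le> n" for m n
      using lift_Suc_antimono_le[of A m n] z that by blast
    have Az: "ext p (Inl (z m)) > ereal (real m - \<delta> - 3)" if "p \<in> A n" "m < n" for p m n
      using anti[of "Suc m" n] that z[of m] by auto
    \<comment> \<open>The pieces are nested and nonempty, so the net points chosen at levels
      \<open>m\<close> and \<open>n\<close> are both close to a point of a later piece. Hence their
      products tend to infinity and they define a boundary point.\<close>
    have zz: "gp (z m) (z n) > min (real m) (real n) - \<delta> - 3 - cc" for m n
    proof -
      obtain p where p: "p \<in> A (Suc (max m n))" using A(1) bad_empty by (metis all_not_in_conv)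
      let ?R = "min (real m) (real n) - \<delta> - 3"
      have "ext p (Inl (z m)) > ereal ?R" "ext p (Inl (z n)) > ereal ?R"
        by (rule le_less_trans[OF _ Az[OF p]]; simp)+
      hence "ext (Inl (z m)) (Inl (z n)) > ereal (?R - cc)"
        by (intro ext_trans[of _ _ p]) (use A(2) p in \<open>auto simp: ext_sym\<close>)
      thus ?thesis by (rule ext_Inl_Inl)
    qed
    have "near R z z" for R
    proof -
      have "gp (z m) (z n) > R" if "m \<ge> nat \<lceil>R + \<delta> + 3 + cc\<rceil>" "n \<ge> nat \<lceil>R + \<delta> + 3 + cc\<rceil>" for m n
        using zz[of m n] that by linarith
      thus ?thesis unfolding near_def by blast
    qed
    hence gz: "z \<in> gromov_sequences b" by (simp add: gromov_sequences_iff)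
    define \<xi> where "\<xi> = gromov_rel b `` {z}"
    have \<xi>: "\<xi> \<in> gromov_boundary b" "z \<in> \<xi>" using class_in_boundary[OF gz] by (auto simp: \<xi>_def)
    then obtain U where U: "U \<in> \<U>" "Inr \<xi> \<in> U" using cov by (metis Inr_bord UnionE subsetD)
    then obtain R where R: "hood R (Inr \<xi>) \<subseteq> U" using op unfolding openin_T by blast
    from boundary_eventually_hood[OF \<xi>, of "R + cc"] obtain N where
      N: "\<And>n. n \<ge> N \<Longrightarrow> Inl (z n) \<in> hood (R + cc) (Inr \<xi>)" by (auto simp: eventually_sequentially)
    define n where "n = max N (nat \<lceil>R + \<delta> + 3 + cc\<rceil>)"
    have "A (Suc n) \<subseteq> hood R (Inr \<xi>)"
    proof
      fix p assume p: "p \<in> A (Suc n)"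
      have "ext p (Inl (z n)) > ereal (R + cc)"
        by (rule le_less_trans[OF _ Az[OF p]]) (auto simp: n_def, linarith)
      hence "ext p (Inr \<xi>) > ereal (R + cc - cc)"
        by (rule ext_trans) (use N[of n] A(2) p \<xi> in \<open>auto simp: hood_def n_def\<close>)
      thus "p \<in> hood R (Inr \<xi>)" using p A(2) by (auto simp: hood_def)
    qed
    hence "A (Suc n) \<subseteq> \<Union> {U}" using R by simp
    thus False using A(1)[of "Suc n"] U(1) unfolding bad_def by (metis empty_subsetI finite.emptyI finite.insertI insert_subset)
  qed
qed simp

section \<open>Normality, cluster points and F-sigma sets\<close>

lemma normal_T: "normal_space T"
  using compact_T Hausdorff_T compact_Hausdorff_or_regular_imp_normal_space by blast

lemma urysohn_function:
  assumes "closedin T F" "openin T U" "F \<subseteq> U"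
  obtains f :: "_ \<Rightarrow> real" where "continuous_map T euclideanreal f"
    "\<And>p. p \<in> bordification b \<Longrightarrow> f p \<in> {0..1}" "\<And>p. p \<in> F \<Longrightarrow> f p = 1"
    "\<And>p. p \<in> bordification b \<Longrightarrow> p \<notin> U \<Longrightarrow> f p = 0"
proof -
  have "closedin T (topspace T - U)" using assms(2) by (rule openin_closedin_eq[THEN iffD1, THEN conjunct2])
  moreover have "disjnt (topspace T - U) F" using assms by (auto simp: disjnt_iff)
  ultimately
  obtain f where f: "continuous_map T (top_of_set {0..1}) f" "f ` (topspace T - U) \<subseteq> {0::real}" "f ` F \<subseteq> {1}"
    using Urysohn_lemma[OF normal_T _ assms(1), of "topspace T - U" 0 1] by auto
  thus thesis using that[of f] by (auto simp: continuous_map_in_subtopology image_subset_iff Pi_iff)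
qed

text \<open>If every point had a neighbourhood that the sequence eventually avoids, finitely many of
  these would cover everything and be avoided at once.\<close>

lemma cluster_point:
  fixes y :: "nat \<Rightarrow> _"
  assumes "\<And>k. y k \<in> bordification b"
  obtains p where "p \<in> bordification b" "\<And>U. openin T U \<Longrightarrow> p \<in> U \<Longrightarrow> \<exists>\<^sub>F k in sequentially. y k \<in> U"
proof (rule ccontr)
  assume "\<not> thesis"
  hence "\<forall>p\<in>bordification b. \<exists>U. openin T U \<and> p \<in> U \<and> \<not> (\<exists>\<^sub>F k in sequentially. y k \<in> U)"
    using that by blast
  then obtain U where U: "\<And>p. p \<in> bordification b \<Longrightarrow> openin T (U p) \<and> p \<in> U p \<and> (\<forall>\<^sub>F k in sequentially. y k \<notin> U p)"
    unfolding not_frequently by metis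
  have "\<exists>\<F>. finite \<F> \<and> \<F> \<subseteq> U ` bordification b \<and> bordification b \<subseteq> \<Union> \<F>"
  proof -
    have "\<forall>V\<in>U ` bordification b. openin T V" "bordification b \<subseteq> \<Union> (U ` bordification b)"
      using U by auto
    thus ?thesis using compact_T unfolding compact_space_def compactin_def topspace_T by blast
  qed
  then obtain \<F> where F: "finite \<F>" "\<F> \<subseteq> U ` bordification b" "bordification b \<subseteq> \<Union> \<F>" by blast
  have "\<forall>\<^sub>F k in sequentially. \<forall>V\<in>\<F>. y k \<notin> V"
    using F U by (intro eventually_ball_finite) auto
  then obtain k where "\<forall>V\<in>\<F>. y k \<notin> V" by (auto simp: eventually_sequentially)
  thus False using F(3) assms[of k] by blast
qed

lemma open_sigma_compact:
  assumes "open (V :: 'a set)"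
  obtains K where "\<And>n::nat. compact (K n)" "incseq K" "(\<Union>n. K n) = V"
proof (cases "V = UNIV")
  case True
  show thesis
  proof (rule that[of "\<lambda>n. cball b (real n)"])
    show "incseq (\<lambda>n. cball b (real n))" by (auto simp: incseq_def)
    show "(\<Union>n. cball b (real n)) = V" using True real_arch_simple by auto
  qed simp
next
  case False
  hence ne: "- V \<noteq> {}" by auto
  define K where "K n = cball b (real n) \<inter> {x. infdist x (- V) \<ge> 1 / real (Suc n)}" for n
  have cl: "closed {x. infdist x (- V) \<ge> c}" for c
    by (intro closed_Collect_le continuous_intros)
  show thesis
  proof (rule that[of K])
    show "compact (K n)" for n unfolding K_def by (intro compact_Int_closed cl) simp
    show "incseq K"
    proof (rule incseq_SucI)
      fix n
      have "1 / real (Suc (Suc n)) \<le> 1 / real (Suc n)" by (simp add: field_simps)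
      thus "K n \<subseteq> K (Suc n)" unfolding K_def by (fastforce intro: order_trans)
    qed
    show "(\<Union>n. K n) = V"
    proof (intro equalityI subsetI)
      fix x assume "x \<in> (\<Union>n. K n)"
      then obtain n where "infdist x (- V) \<ge> 1 / real (Suc n)" by (auto simp: K_def)
      hence "infdist x (- V) > 0" by (rule less_le_trans[rotated]) simp
      thus "x \<in> V" using infdist_zero[of x "- V"] by (cases "x \<in> V") auto
    next
      fix x assume "x \<in> V"
      hence "infdist x (- V) > 0" using in_closed_iff_infdist_zero[of "- V" x] assms ne infdist_nonneg[of x "- V"]
        by (metis ComplD closed_Compl less_eq_real_def)
      then obtain n where n: "1 / real (Suc n) < infdist x (- V)" using nat_approx_posE by metis
      obtain m where m: "dist b x \<le> real m" using real_arch_simple by blast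
      have "1 / real (Suc (max m n)) \<le> 1 / real (Suc n)" by (simp add: field_simps)
      hence "x \<in> K (max m n)" using n m unfolding K_def by auto
      thus "x \<in> (\<Union>n. K n)" by blast
    qed
  qed
qed

text \<open>Substitute for metrizability. Points of X are exhausted by compact sets; boundary points
  of \<open>U\<close> are sorted by a threshold whose \<open>hood\<close> fits into
  \<open>U\<close>, and closing up one such layer does not leave \<open>U\<close>.\<close>

lemma open_Fsigma:
  assumes "openin T U"
  obtains F where "\<And>n::nat. closedin T (F n)" "incseq F" "(\<Union>n. F n) = U"
proof -
  have "open (Inl -` U)" using assms by (simp add: openin_T)
  then obtain K where K: "\<And>n::nat. compact (K n)" "incseq K" "(\<Union>n. K n) = Inl -` U"
    using open_sigma_compact by blast
  define B where "B n = {p. \<exists>\<xi>. p = Inr \<xi> \<and> p \<in> U \<and> hood (real n) p \<subseteq> U}" for n :: nat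
  have clB: "T closure_of B n \<subseteq> U" for n
  proof
    fix p assume p: "p \<in> T closure_of B n"
    have "openin T (range Inl)" by simp
    moreover have "q \<notin> range Inl" if "q \<in> B n" for q using that by (auto simp: B_def)
    ultimately have "p \<notin> range Inl" using p unfolding in_closure_of by blast
    then obtain \<eta> where \<eta>: "p = Inr \<eta>" by (cases p) blast+
    have "p \<in> bordification b" using p closure_of_subset_topspace[of T "B n"] by auto
    hence e: "\<eta> \<in> gromov_boundary b" using \<eta> by simp
    have "p \<in> T interior_of hood (real n) p"
      using hood_interior[of p "real n" "hood (real n) p"] self_hood[OF e] \<eta> e by auto
    moreover have "\<forall>V. p \<in> V \<and> openin T V \<longrightarrow> (\<exists>q. q \<in> B n \<and> q \<in> V)"
      using p unfolding in_closure_of by (rule conjunct2)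
    ultimately obtain q where q: "q \<in> B n" "q \<in> T interior_of hood (real n) p"
      using openin_interior_of[of T "hood (real n) p"] by blast
    from q(2) have "q \<in> hood (real n) p" by (rule subsetD[OF interior_of_subset])
    \<comment> \<open>Symmetry of the product with the same threshold: \<open>q\<close> near
      \<open>p\<close> becomes \<open>p\<close> near \<open>q\<close>, and the \<open>hood\<close>
      of \<open>q\<close> lies in \<open>U\<close> because \<open>q\<close> is in
      \<open>B n\<close>.\<close>
    hence "p \<in> hood (real n) q" using \<open>p \<in> bordification b\<close> by (simp add: hood_def ext_sym)
    thus "p \<in> U" using q(1) unfolding B_def by blast
  qed
  have Bsub: "B n \<subseteq> T closure_of B n" for n
    by (rule closure_of_subset) (use assms in \<open>auto simp: B_def openin_T\<close>)
  show thesis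
  proof (rule that[of "\<lambda>n. Inl ` K n \<union> T closure_of B n"])
    show "closedin T (Inl ` K n \<union> T closure_of B n)" for n
      by (intro closedin_Un closedin_Inl K closedin_closure_of)
    have "B n \<subseteq> B (Suc n)" for n using hood_mono[of "real n" "real (Suc n)"] by (fastforce simp: B_def)
    thus "incseq (\<lambda>n. Inl ` K n \<union> T closure_of B n)"
      using K(2) by (intro incseq_SucI Un_mono image_mono closure_of_mono) (auto dest: incseq_SucD)
    show "(\<Union>n. Inl ` K n \<union> T closure_of B n) = U"
    proof (intro equalityI subsetI)
      fix p assume "p \<in> (\<Union>n. Inl ` K n \<union> T closure_of B n)"
      thus "p \<in> U" using K(3) subsetD[OF clB, of p] by auto
    next
      fix p assume p: "p \<in> U"
      show "p \<in> (\<Union>n. Inl ` K n \<union> T closure_of B n)"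
      proof (cases p)
        case (Inl x)
        hence "x \<in> (\<Union>n. K n)" using p K(3) by simp
        thus ?thesis using Inl by blast
      next
        case (Inr \<xi>)
        then obtain R where "hood R p \<subseteq> U" using p assms by (auto simp: openin_T)
        moreover obtain n where "R \<le> real n" using real_arch_simple by blast
        ultimately have "hood (real n) p \<subseteq> U" using hood_mono by blast
        hence "p \<in> B n" using p Inr by (simp add: B_def)
        thus ?thesis using Bsub by blast
      qed
    qed
  qed
qed

end

section \<open>The group action\<close>

locale hyperbolic_action = hyperbolic b \<delta>
  for b :: "'a::heine_borel" and \<delta> +
  fixes \<Gamma> :: "('g, 'c) monoid_scheme" (structure) and \<phi> :: "'g \<Rightarrow> 'a \<Rightarrow> 'a"
  assumes isometric: "isometric_action \<Gamma> \<phi>"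
    and proper: "proper_action \<Gamma> \<phi>"
    and cocompact: "cocompact_action \<Gamma> \<phi>"
begin

lemma group_action_X: "group_action \<Gamma> UNIV \<phi>"
  using isometric by (simp add: isometric_action_def)

sublocale \<Gamma>: group \<Gamma>
  using group_action_X unfolding group_action_def group_hom_def by simp

lemma act_dist [simp]: "g \<in> carrier \<Gamma> \<Longrightarrow> dist (\<phi> g x) (\<phi> g y) = dist x y"
  using isometric by (simp add: isometric_action_def)

lemma act_mult: "g \<in> carrier \<Gamma> \<Longrightarrow> h \<in> carrier \<Gamma> \<Longrightarrow> \<phi> (g \<otimes> h) x = \<phi> g (\<phi> h x)"
  using group_action.composition_rule[OF group_action_X] by simp

lemma act_one [simp]: "\<phi> \<one> x = x"
  using group_action.id_eq_one[OF group_action_X] by (metis UNIV_I restrict_apply')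

lemma act_inv [simp]: "g \<in> carrier \<Gamma> \<Longrightarrow> \<phi> (inv g) (\<phi> g x) = x"
  using act_mult[of "inv g" g x] by simp

lemma act_inv' [simp]: "g \<in> carrier \<Gamma> \<Longrightarrow> \<phi> g (\<phi> (inv g) x) = x"
  using act_mult[of g "inv g" x] by simp

lemma act_dist_shift: "g \<in> carrier \<Gamma> \<Longrightarrow> dist (\<phi> g x) y = dist x (\<phi> (inv g) y)"
  using act_dist[of "inv g" "\<phi> g x" y] by simp

definition len :: "'g \<Rightarrow> real" where "len g = dist b (\<phi> g b)"

lemma len_nonneg [simp]: "len g \<ge> 0" by (simp add: len_def)

lemma len_one [simp]: "len \<one> = 0" by (simp add: len_def)

lemma len_inv [simp]: "g \<in> carrier \<Gamma> \<Longrightarrow> len (inv g) = len g"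
  using act_dist_shift[of g b b] by (simp add: len_def dist_commute)

definition gball :: "real \<Rightarrow> 'g set" where "gball r = {g \<in> carrier \<Gamma>. len g \<le> r}"

lemma finite_gball [simp]: "finite (gball r)"
proof (cases "r \<ge> 0")
  case True
  have "gball r \<subseteq> {g \<in> carrier \<Gamma>. \<phi> g ` cball b r \<inter> cball b r \<noteq> {}}"
  proof
    fix g assume "g \<in> gball r"
    moreover from this have "\<phi> g b \<in> \<phi> g ` cball b r \<inter> cball b r"
      using True by (auto simp: gball_def len_def)
    ultimately show "g \<in> {g \<in> carrier \<Gamma>. \<phi> g ` cball b r \<inter> cball b r \<noteq> {}}"
      unfolding gball_def by blast
  qed
  thus ?thesis using proper compact_cball[of b r] unfolding proper_action_def by (meson finite_subset)
next
  case False
  have "\<not> len g \<le> r" for g using False len_nonneg[of g] by linarith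
  hence "gball r = {}" by (simp add: gball_def)
  thus ?thesis by simp
qed

lemma finite_orbit_near:
  assumes "H \<subseteq> carrier \<Gamma>"
  shows "finite {h \<in> H. dist (\<phi> h b) x \<le> r}"
proof (rule finite_subset)
  show "{h \<in> H. dist (\<phi> h b) x \<le> r} \<subseteq> gball (r + dist b x)"
  proof
    fix h assume "h \<in> {h \<in> H. dist (\<phi> h b) x \<le> r}"
    thus "h \<in> gball (r + dist b x)"
      using assms dist_triangle[of b "\<phi> h b" x] by (auto simp: gball_def len_def dist_commute)
  qed
qed simp

lemma countable_carrier: "countable (carrier \<Gamma>)"
proof -
  have "carrier \<Gamma> \<subseteq> (\<Union>n::nat. gball (real n))"
    using real_arch_simple by (auto simp: gball_def)
  moreover have "countable (\<Union>n::nat. gball (real n))"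
    by (intro countable_UN) (auto intro: countable_finite)
  ultimately show ?thesis by (rule countable_subset)
qed

text \<open>Cocompactness constant: the orbit of \<open>b\<close> is D-dense. Being at least 1, it
  lets annuli of half-width 2 D absorb the rounding of lengths to integers.\<close>

definition D :: real where
  "D = (SOME D. D \<ge> 1 \<and> (\<forall>x. \<exists>g\<in>carrier \<Gamma>. dist x (\<phi> g b) \<le> D))"

lemma D: "D \<ge> 1" "\<exists>g\<in>carrier \<Gamma>. dist x (\<phi> g b) \<le> D"
proof -
  obtain K where K: "compact K" "(\<Union>g \<in> carrier \<Gamma>. \<phi> g ` K) = UNIV"
    using cocompact unfolding cocompact_action_def by blast
  obtain r where r: "\<And>k. k \<in> K \<Longrightarrow> dist b k \<le> r"
    using compact_imp_bounded[OF K(1)] unfolding bounded_any_center[where a=b] by blast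
  have "\<exists>g\<in>carrier \<Gamma>. dist x (\<phi> g b) \<le> max r 1" for x
  proof -
    obtain g k where gk: "g \<in> carrier \<Gamma>" "k \<in> K" "x = \<phi> g k" using K(2) by blast
    hence "dist x (\<phi> g b) \<le> max r 1" using r[of k] by (simp add: dist_commute)
    thus ?thesis using gk by blast
  qed
  hence "\<exists>D\<ge>1. \<forall>x. \<exists>g\<in>carrier \<Gamma>. dist x (\<phi> g b) \<le> D" by (intro exI[of _ "max r 1"]) auto
  hence "D \<ge> 1 \<and> (\<forall>x. \<exists>g\<in>carrier \<Gamma>. dist x (\<phi> g b) \<le> D)" unfolding D_def by (rule someI_ex)
  thus "D \<ge> 1" "\<exists>g\<in>carrier \<Gamma>. dist x (\<phi> g b) \<le> D" by auto
qed

text \<open>Conjugating by an element that carries \<open>b\<close> within \<open>D\<close> of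
  \<open>x\<close> turns displacement of \<open>x\<close> into length. What matters later is that
  the bound does not depend on \<open>x\<close>.\<close>

lemma finite_displacement: "finite {g \<in> carrier \<Gamma>. dist x (\<phi> g x) \<le> r}"
  and card_displacement: "card {g \<in> carrier \<Gamma>. dist x (\<phi> g x) \<le> r} \<le> card (gball (r + 2 * D))"
proof -
  obtain k where k: "k \<in> carrier \<Gamma>" "dist x (\<phi> k b) \<le> D" using D(2) by blast
  let ?S = "{g \<in> carrier \<Gamma>. dist x (\<phi> g x) \<le> r}"
  let ?f = "\<lambda>g. inv k \<otimes> g \<otimes> k"
  have inj: "inj_on ?f ?S" 
  proof (rule inj_onI)
    fix g h assume gh: "g \<in> ?S" "h \<in> ?S" "?f g = ?f h"
    hence "inv k \<otimes> g = inv k \<otimes> h" using k \<Gamma>.right_cancel[of k "inv k \<otimes> g" "inv k \<otimes> h"] by simp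
    thus "g = h" using gh k by simp
  qed
  have im: "?f ` ?S \<subseteq> gball (r + 2 * D)"
  proof (rule image_subsetI)
    fix g assume "g \<in> ?S"
    hence g: "g \<in> carrier \<Gamma>" "dist x (\<phi> g x) \<le> r" by auto
    have "len (?f g) = dist (\<phi> k b) (\<phi> g (\<phi> k b))"
    proof -
      have "\<phi> (?f g) b = \<phi> (inv k) (\<phi> g (\<phi> k b))" using k g by (simp add: act_mult)
      thus ?thesis using act_dist_shift[OF k(1)] by (simp add: len_def)
    qed
    also have "\<dots> \<le> dist (\<phi> k b) x + dist x (\<phi> g x) + dist (\<phi> g x) (\<phi> g (\<phi> k b))"
      using dist_triangle[of "\<phi> k b" "\<phi> g (\<phi> k b)" x] dist_triangle[of x "\<phi> g (\<phi> k b)" "\<phi> g x"] by linarith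
    also have "\<dots> \<le> r + 2 * D" using k g by (simp add: dist_commute)
    finally show "?f g \<in> gball (r + 2 * D)" using g k by (simp add: gball_def)
  qed
  show "finite ?S" by (rule inj_on_finite[OF inj im]) simp
  show "card ?S \<le> card (gball (r + 2 * D))" by (rule card_inj_on_le[OF inj im]) simp
qed

lemma gp_act: "g \<in> carrier \<Gamma> \<Longrightarrow> gp (\<phi> g x) (\<phi> g y) = gromov_product (\<phi> (inv g) b) x y"
  using act_dist_shift[of g _ b] by (simp add: gromov_product_def dist_commute)

lemma gp_act_ge: "g \<in> carrier \<Gamma> \<Longrightarrow> gp (\<phi> g x) (\<phi> g y) \<ge> gp x y - len g"
  using gromov_product_base_diff_le[of b x y "\<phi> (inv g) b"] len_inv[of g]
  by (simp add: gp_act len_def)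

lemma near_act:
  assumes "g \<in> carrier \<Gamma>" "near R u v"
  shows "near (R - len g) (\<phi> g \<circ> u) (\<phi> g \<circ> v)"
proof -
  obtain N where N: "\<forall>i\<ge>N. \<forall>j\<ge>N. gp (u i) (v j) > R" using assms(2) unfolding near_def by blast
  have "gp ((\<phi> g \<circ> u) i) ((\<phi> g \<circ> v) j) > R - len g" if "i \<ge> N" "j \<ge> N" for i j
    using gp_act_ge[OF assms(1), of "u i" "v j"] N that by fastforce
  thus ?thesis unfolding near_def by blast
qed

lemma near_act_all:
  assumes "g \<in> carrier \<Gamma>" "\<And>R. near R u v"
  shows "near R (\<phi> g \<circ> u) (\<phi> g \<circ> v)"
  using near_act[OF assms(1) assms(2)[of "R + len g"]] by simp

section \<open>The action on the boundary and on the bordification\<close>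

definition gbd :: "'g \<Rightarrow> (nat \<Rightarrow> 'a) set \<Rightarrow> (nat \<Rightarrow> 'a) set" where
  "gbd g \<xi> = (\<lambda>u. \<phi> g \<circ> u) ` \<xi>"

text \<open>Termwise translation sends a class into one class; translating back by
  \<open>inv g\<close> shows that it fills that class.\<close>

lemma gbd_boundary:
  assumes "g \<in> carrier \<Gamma>" "\<xi> \<in> gromov_boundary b"
  shows "gbd g \<xi> \<in> gromov_boundary b"
proof -
  obtain u where u: "u \<in> \<xi>" using assms boundary_nonempty by blast
  have gu: "\<phi> g \<circ> u \<in> gromov_sequences b"
    using near_act_all[OF assms(1)] boundary_class[OF assms(2) u u] by (simp add: gromov_sequences_iff)
  let ?\<eta> = "gromov_rel b `` {\<phi> g \<circ> u}"
  have \<eta>: "?\<eta> \<in> gromov_boundary b" "\<phi> g \<circ> u \<in> ?\<eta>" using class_in_boundary[OF gu] by auto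
  have "gbd g \<xi> = ?\<eta>"
  proof (intro equalityI subsetI)
    fix w assume "w \<in> gbd g \<xi>"
    then obtain v where v: "v \<in> \<xi>" "w = \<phi> g \<circ> v" by (auto simp: gbd_def)
    have "near R (\<phi> g \<circ> u) w" "near R w w" for R
      using near_act_all[OF assms(1)] boundary_class[OF assms(2)] u v by blast+
    thus "w \<in> ?\<eta>" using gu by (simp add: gromov_rel_iff gromov_sequences_iff)
  next
    fix w assume w: "w \<in> ?\<eta>"
    let ?v = "\<phi> (inv g) \<circ> w"
    have e: "\<phi> (inv g) \<circ> (\<phi> g \<circ> u) = u" using assms by auto
    have "near R u ?v" "near R ?v ?v" for R
      using near_act_all[of "inv g" "\<phi> g \<circ> u" w] near_act_all[of "inv g" w w] boundary_class[OF \<eta>(1)] \<eta>(2) w assms(1) e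
      by auto
    hence "?v \<in> \<xi>" using boundary_memI[OF assms(2) u] by (simp add: gromov_sequences_iff)
    moreover have "w = \<phi> g \<circ> ?v" using assms by auto
    ultimately show "w \<in> gbd g \<xi>" unfolding gbd_def by blast
  qed
  thus ?thesis using \<eta> by simp
qed

lemma gbd_mult: "g \<in> carrier \<Gamma> \<Longrightarrow> h \<in> carrier \<Gamma> \<Longrightarrow> gbd (g \<otimes> h) \<xi> = gbd g (gbd h \<xi>)"
  by (auto simp: gbd_def image_image act_mult fun_eq_iff intro!: image_cong)

lemma gbd_one: "gbd \<one> \<xi> = \<xi>"
  by (auto simp: gbd_def comp_def)

text \<open>\<open>boundary_action\<close> is restricted to the boundary, whereas the orbital
  measures live on X; comparing them with their limit takes one map on both pieces.\<close>

definition gact :: "'g \<Rightarrow> 'a + (nat \<Rightarrow> 'a) set \<Rightarrow> 'a + (nat \<Rightarrow> 'a) set" where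
  "gact g = map_sum (\<phi> g) (gbd g)"

lemma gact_simps [simp]: "gact g (Inl x) = Inl (\<phi> g x)" "gact g (Inr \<xi>) = Inr (gbd g \<xi>)"
  by (simp_all add: gact_def)

lemma gact_bord [simp]: "g \<in> carrier \<Gamma> \<Longrightarrow> p \<in> bordification b \<Longrightarrow> gact g p \<in> bordification b"
  using gbd_boundary by (cases p) auto

lemma gact_mult: "g \<in> carrier \<Gamma> \<Longrightarrow> h \<in> carrier \<Gamma> \<Longrightarrow> gact (g \<otimes> h) p = gact g (gact h p)"
  by (cases p) (auto simp: act_mult gbd_mult)

lemma gact_one [simp]: "gact \<one> p = p"
  by (cases p) (auto simp: gbd_one)

lemma gact_inv [simp]: "g \<in> carrier \<Gamma> \<Longrightarrow> gact (inv g) (gact g p) = p"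
  using gact_mult[of "inv g" g p] by simp

lemma gact_inv' [simp]: "g \<in> carrier \<Gamma> \<Longrightarrow> gact g (gact (inv g) p) = p"
  using gact_mult[of g "inv g" p] by simp

lemma gact_image_eq_vimage:
  assumes "g \<in> carrier \<Gamma>" "A \<subseteq> bordification b"
  shows "gact g ` A = gact (inv g) -` A \<inter> bordification b"
proof (intro equalityI subsetI)
  fix p assume "p \<in> gact g ` A"
  thus "p \<in> gact (inv g) -` A \<inter> bordification b" using assms by auto
next
  fix p assume "p \<in> gact (inv g) -` A \<inter> bordification b"
  thus "p \<in> gact g ` A" using assms by (intro image_eqI[of _ _ "gact (inv g) p"]) auto
qed

lemma sequences_to_gact:
  assumes "g \<in> carrier \<Gamma>" "u \<in> sequences_to p"
  shows "\<phi> g \<circ> u \<in> sequences_to (gact g p)"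
  using assms by (cases p) (auto simp: gbd_def tendsto_iff)

lemma ext_gact:
  assumes "g \<in> carrier \<Gamma>" "ext p q > ereal R"
  shows "ext (gact g p) (gact g q) > ereal (R - len g - 1)"
proof -
  obtain u v where uv: "u \<in> sequences_to p" "v \<in> sequences_to q" "near R u v" using extE[OF assms(2)] .
  show ?thesis
    by (rule extI[OF sequences_to_gact sequences_to_gact near_act[OF assms(1) uv(3)]])
      (use assms uv in auto)
qed

lemma continuous_gact:
  assumes "g \<in> carrier \<Gamma>"
  shows "continuous_map T T (gact g)"
  unfolding continuous_map_def
proof (intro conjI allI impI)
  show "gact g \<in> topspace T \<rightarrow> topspace T" using assms by auto
  fix U assume U: "openin T U"
  let ?V = "{p \<in> topspace T. gact g p \<in> U}"
  show "openin T ?V"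
    unfolding openin_T
  proof (intro conjI allI impI)
    have "continuous_on UNIV (\<phi> g)"
      using assms by (auto simp: continuous_on_iff intro!: exI)
    moreover have "Inl -` ?V = \<phi> g -` (Inl -` U)" by auto
    ultimately show "open (Inl -` ?V)" using U unfolding openin_T by (simp add: open_vimage)
    fix \<xi> assume x: "Inr \<xi> \<in> ?V"
    then obtain R where R: "hood R (Inr (gbd g \<xi>)) \<subseteq> U" using U unfolding openin_T by auto
    have "hood (R + len g + 1) (Inr \<xi>) \<subseteq> ?V"
    proof
      fix p assume p: "p \<in> hood (R + len g + 1) (Inr \<xi>)"
      hence "gact g p \<in> hood R (Inr (gbd g \<xi>))"
        using ext_gact[OF assms, of "R + len g + 1" p "Inr \<xi>"] assms by (simp add: hood_def)
      thus "p \<in> ?V" using R p by (auto simp: hood_def)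
    qed
    thus "\<exists>R. hood R (Inr \<xi>) \<subseteq> ?V" by blast
  qed auto
qed

lemma openin_gact_image:
  assumes "g \<in> carrier \<Gamma>" "openin T U"
  shows "openin T (gact g ` U)"
proof -
  have "gact g ` U = {p \<in> topspace T. gact (inv g) p \<in> U}"
    using gact_image_eq_vimage[OF assms(1), of U] openin_subset[OF assms(2)] by auto
  thus ?thesis
    using openin_continuous_map_preimage[OF continuous_gact[of "inv g"] assms(2)] assms(1) by simp
qed

lemma boundary_part_iff: "p \<in> boundary_part b \<longleftrightarrow> (\<exists>\<xi>. p = Inr \<xi> \<and> \<xi> \<in> gromov_boundary b)"
  by (auto simp: boundary_part_def)

lemma boundary_part_subset: "boundary_part b \<subseteq> bordification b"
  by (auto simp: bordification_def)

lemma gact_boundary_part: "g \<in> carrier \<Gamma> \<Longrightarrow> p \<in> boundary_part b \<Longrightarrow> gact g p \<in> boundary_part b"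
  by (auto simp: boundary_part_iff gbd_boundary)

lemma boundary_action_eq: "p \<in> boundary_part b \<Longrightarrow> boundary_action b \<phi> g p = gact g p"
  by (cases p) (auto simp: boundary_action_def gact_def gbd_def)

lemma boundary_action_image: "A \<subseteq> boundary_part b \<Longrightarrow> boundary_action b \<phi> g ` A = gact g ` A"
  by (rule image_cong) (auto simp: boundary_action_eq)

lemma closedin_boundary_part: "closedin T (boundary_part b)"
proof -
  have "bordification b - boundary_part b = range Inl" by (auto simp: bordification_def boundary_part_def)
  moreover have "openin T (range Inl)" by simp
  ultimately show ?thesis unfolding closedin_def using boundary_part_subset by simp
qed

lemma group_action_boundary:
  assumes "subgroup H \<Gamma>"
  shows "group_action (\<Gamma>\<lparr>carrier := H\<rparr>) (boundary_part b) (boundary_action b \<phi>)"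
proof -
  let ?B = "boundary_part b" and ?\<psi> = "boundary_action b \<phi>"
  have H: "h \<in> carrier \<Gamma>" if "h \<in> H" for h using subgroup.subset[OF assms] that by blast
  have bij: "?\<psi> h \<in> Bij ?B" if "h \<in> H" for h
  proof -
    have h: "h \<in> carrier \<Gamma>" by (rule H[OF that])
    have "bij_betw (?\<psi> h) ?B ?B"
      by (rule bij_betw_byWitness[where f'="gact (inv h)"])
        (use h gact_boundary_part[of h] gact_boundary_part[of "inv h"] in \<open>auto simp: boundary_action_eq\<close>)
    thus ?thesis by (simp add: Bij_def boundary_action_def)
  qed
  have "group_hom (\<Gamma>\<lparr>carrier := H\<rparr>) (BijGroup ?B) ?\<psi>"
  proof (intro group_hom.intro group_hom_axioms.intro group_BijGroup)
    show "group (\<Gamma>\<lparr>carrier := H\<rparr>)" by (rule \<Gamma>.subgroup_imp_group[OF assms])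
    show "?\<psi> \<in> hom (\<Gamma>\<lparr>carrier := H\<rparr>) (BijGroup ?B)"
    proof (rule homI)
      fix x assume "x \<in> carrier (\<Gamma>\<lparr>carrier := H\<rparr>)"
      thus "?\<psi> x \<in> carrier (BijGroup ?B)" using bij by (simp add: BijGroup_def)
    next
      fix x y assume "x \<in> carrier (\<Gamma>\<lparr>carrier := H\<rparr>)" "y \<in> carrier (\<Gamma>\<lparr>carrier := H\<rparr>)"
      hence xy: "x \<in> H" "y \<in> H" by auto
      have "?\<psi> (x \<otimes> y) = compose ?B (?\<psi> x) (?\<psi> y)"
      proof (rule extensionalityI[of _ ?B])
        fix p assume p: "p \<in> ?B"
        thus "?\<psi> (x \<otimes> y) p = compose ?B (?\<psi> x) (?\<psi> y) p"
          using xy H by (simp add: compose_eq boundary_action_eq gact_boundary_part gact_mult)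
      qed (auto simp: boundary_action_def)
      thus "?\<psi> (x \<otimes>\<^bsub>\<Gamma>\<lparr>carrier := H\<rparr>\<^esub> y) = ?\<psi> x \<otimes>\<^bsub>BijGroup ?B\<^esub> ?\<psi> y"
        using xy bij by (simp add: BijGroup_def)
    qed
  qed
  thus ?thesis by (simp add: group_action_def)
qed

end

section \<open>Regularity and quasi-conformality\<close>

text \<open>Sets squeezed between a closed and an open set with small difference form a
  sigma-algebra; the F-sigma property puts the open sets into it.\<close>

lemma regular_approx:
  fixes X :: "'p topology" and M :: "'p measure"
  assumes M: "finite_measure M" "space M = topspace X" "sets M = sigma_sets (topspace X) {U. openin X U}"
    and Fsigma: "\<And>U. openin X U \<Longrightarrow> \<exists>F::nat \<Rightarrow> _. (\<forall>n. closedin X (F n)) \<and> incseq F \<and> (\<Union>n. F n) = U"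
    and A: "A \<in> sets M" and e: "e > 0"
  obtains F U where "closedin X F" "openin X U" "F \<subseteq> A" "A \<subseteq> U" "measure M (U - F) < e"
proof -
  interpret finite_measure M by fact
  have op: "U \<in> sets M" if "openin X U" for U using that M(3) by (auto intro: sigma_sets.Basic)
  have cl: "F \<in> sets M" if "closedin X F" for F
  proof -
    have "topspace X - F \<in> sets M" using that op by (simp add: closedin_def)
    hence "space M - (topspace X - F) \<in> sets M" by (rule sets.compl_sets)
    moreover have "space M - (topspace X - F) = F" using that M(2) by (auto dest: closedin_subset)
    ultimately show ?thesis by simp
  qed
  have "\<forall>e>0. \<exists>F U. closedin X F \<and> openin X U \<and> F \<subseteq> A \<and> A \<subseteq> U \<and> measure M (U - F) < e"
    using A[unfolded M(3)]
  proof (induction A rule: sigma_sets.induct)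
    case (Basic U)
    hence U: "openin X U" by simp
    obtain F where F: "\<And>n::nat. closedin X (F n)" "incseq F" "(\<Union>n. F n) = U" using Fsigma[OF U] by auto
    show ?case
    proof (intro allI impI)
      fix e :: real assume "e > 0"
      have "(\<lambda>n. measure M (F n)) \<longlonglongrightarrow> measure M (\<Union>n. F n)"
        by (rule finite_Lim_measure_incseq) (use F cl in auto)
      hence "\<forall>\<^sub>F n in sequentially. measure M (F n) > measure M U - e"
        using F(3) \<open>e > 0\<close> by (intro order_tendstoD(1)) auto
      then obtain n where n: "measure M (F n) > measure M U - e" by (auto simp: eventually_sequentially)
      have "F n \<subseteq> U" using F(3) by blast
      hence "measure M (U - F n) < e"
        using n finite_measure_Diff[OF op[OF U] cl[OF F(1)[of n]]] by simp
      thus "\<exists>F U'. closedin X F \<and> openin X U' \<and> F \<subseteq> U \<and> U \<subseteq> U' \<and> measure M (U' - F) < e"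
        using U F(1)[of n] \<open>F n \<subseteq> U\<close> by (intro exI[of _ "F n"] exI[of _ U]) simp
    qed
  next
    case Empty
    show ?case
    proof (intro allI impI)
      fix e :: real assume "e > 0"
      show "\<exists>F U. closedin X F \<and> openin X U \<and> F \<subseteq> {} \<and> {} \<subseteq> U \<and> measure M (U - F) < e"
        by (rule exI[of _ "{}"], rule exI[of _ "{}"]) (simp add: \<open>e > 0\<close>)
    qed
  next
    case (Compl A)
    show ?case
    proof (intro allI impI)
      fix e :: real assume "e > 0"
      obtain F U where FU: "closedin X F" "openin X U" "F \<subseteq> A" "A \<subseteq> U" "measure M (U - F) < e"
        using Compl.IH[rule_format, OF \<open>e > 0\<close>] by (elim exE conjE)
      have "topspace X - F - (topspace X - U) = U - F" using FU openin_subset[OF FU(2)] by auto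
      thus "\<exists>F U'. closedin X F \<and> openin X U' \<and> F \<subseteq> topspace X - A \<and> topspace X - A \<subseteq> U' \<and> measure M (U' - F) < e"
        using FU by (intro exI[of _ "topspace X - U"] exI[of _ "topspace X - F"] conjI) auto
    qed
  next
    case (Union A)
    show ?case
    proof (intro allI impI)
      fix e :: real assume e: "e > 0"
      \<comment> \<open>Half of \<open>e\<close> goes to the open sets through a geometric series,
        the other half to cutting the union of the closed sets down to finitely many, as a countable
        union need not be closed.\<close>
      have "\<exists>F U. closedin X F \<and> openin X U \<and> F \<subseteq> A i \<and> A i \<subseteq> U \<and> measure M (U - F) < e / 2 * (1/2) ^ Suc i" for i
        by (rule Union.IH[rule_format]) (use e in simp)
      then obtain F U where FU: "\<And>i. closedin X (F i)" "\<And>i. openin X (U i)" "\<And>i. F i \<subseteq> A i" "\<And>i. A i \<subseteq> U i"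
        "\<And>i. measure M (U i - F i) < e / 2 * (1/2) ^ Suc i" by metis
      let ?G = "\<lambda>n. \<Union>i<n. F i"
      have G: "closedin X (?G n)" for n by (intro closedin_Union) (use FU in auto)
      have oU: "openin X (\<Union>i. U i)" using FU by auto
      have "(\<lambda>n. measure M (?G n)) \<longlonglongrightarrow> measure M (\<Union>n. ?G n)"
        by (rule finite_Lim_measure_incseq) (use G cl in \<open>auto simp: incseq_def\<close>, force)
      moreover have UG: "(\<Union>n. ?G n) = (\<Union>i. F i)" by auto
      ultimately have "\<forall>\<^sub>F n in sequentially. measure M (?G n) > measure M (\<Union>i. F i) - e / 2"
        using e by (intro order_tendstoD(1)) auto
      then obtain n where n: "measure M (?G n) > measure M (\<Union>i. F i) - e / 2" by (auto simp: eventually_sequentially)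
      have mF: "(\<Union>i. F i) \<in> sets M" using cl FU by auto
      have "?G n \<subseteq> (\<Union>i. F i)" by auto
      hence 1: "measure M ((\<Union>i. F i) - ?G n) < e / 2"
        using n finite_measure_Diff[OF mF cl[OF G[of n]]] by simp
      have sm: "summable (\<lambda>i. e / 2 * (1/2) ^ Suc i)" by (intro summable_mult) (simp add: summable_Suc_iff)
      have mm: "measure M (U i - F i) \<le> e / 2 * (1/2) ^ Suc i" for i using FU(5)[of i] by simp
      have sm2: "summable (\<lambda>i. measure M (U i - F i))"
        by (rule summable_comparison_test'[OF sm]) (use mm in auto)
      have "measure M (\<Union>i. U i - F i) \<le> (\<Sum>i. measure M (U i - F i))"
        by (rule finite_measure_subadditive_countably) (use op cl FU sm2 in auto)
      also have "\<dots> \<le> (\<Sum>i. e / 2 * (1/2) ^ Suc i)" by (rule suminf_le[OF mm sm2 sm])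
      also have "\<dots> = e / 2" using sums_mult[OF power_half_series, of "e / 2"] by (simp add: sums_iff)
      finally have 2: "measure M (\<Union>i. U i - F i) \<le> e / 2" .
      have "measure M ((\<Union>i. U i) - ?G n) \<le> measure M ((\<Union>i. U i - F i) \<union> ((\<Union>i. F i) - ?G n))"
        by (rule finite_measure_mono) (use op cl FU G mF in auto)
      also have "\<dots> \<le> measure M (\<Union>i. U i - F i) + measure M ((\<Union>i. F i) - ?G n)"
        by (rule measure_Un_le) (use op cl FU G mF in auto)
      also have "\<dots> < e" using 1 2 by simp
      finally show "\<exists>F U. closedin X F \<and> openin X U \<and> F \<subseteq> \<Union> (range A) \<and> \<Union> (range A) \<subseteq> U \<and> measure M (U - F) < e"
        using G oU FU(3,4) by (intro exI[of _ "?G n"] exI[of _ "\<Union>i. U i"]) blast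
    qed
  qed
  thus thesis using that e by blast
qed

locale patterson = hyperbolic_action b \<delta> \<Gamma> \<phi>
  for b :: "'a::heine_borel" and \<delta> and \<Gamma> :: "('g, 'c) monoid_scheme" (structure) and \<phi> +
  fixes \<mu> :: "('a + (nat \<Rightarrow> 'a) set) measure"
  assumes ps: "patterson_sullivan \<Gamma> \<phi> b \<mu>"
begin

sublocale prob_space \<mu> using ps by (simp add: patterson_sullivan_def)

lemma openin_T_subset: "openin T U \<Longrightarrow> U \<subseteq> bordification b"
  using openin_subset[of T U] by simp

lemma sets_borel: "sets (bordification_borel b) = sigma_sets (bordification b) {U. openin T U}"
  unfolding bordification_borel_def
  by (rule sets_measure_of) (auto dest: openin_T_subset)

lemma space_borel [simp]: "space (bordification_borel b) = bordification b"
  unfolding bordification_borel_def by (rule space_measure_of) (auto dest: openin_T_subset)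

lemma sets_\<mu>: "sets \<mu> = sigma_sets (bordification b) {U. openin T U}"
  using ps by (simp add: patterson_sullivan_def sets_borel)

lemma sets_\<mu>_borel: "sets \<mu> = sets (bordification_borel b)"
  using ps by (simp add: patterson_sullivan_def)

lemma space_\<mu> [simp]: "space \<mu> = bordification b"
  using sets_eq_imp_space_eq[OF sets_\<mu>_borel] by simp

lemma open_sets: "openin T U \<Longrightarrow> U \<in> sets \<mu>"
  by (auto simp: sets_\<mu> intro: sigma_sets.Basic)

lemma closed_sets: "closedin T F \<Longrightarrow> F \<in> sets \<mu>"
proof -
  assume F: "closedin T F"
  hence "space \<mu> - (bordification b - F) \<in> sets \<mu>"
    by (intro sets.compl_sets open_sets) (auto simp: closedin_def)
  moreover have "space \<mu> - (bordification b - F) = F" using closedin_subset[OF F] by auto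
  ultimately show ?thesis by simp
qed

lemma continuous_measurable:
  fixes f :: "_ \<Rightarrow> real"
  assumes "continuous_map T euclideanreal f"
  shows "f \<in> borel_measurable \<mu>"
proof (rule borel_measurableI)
  fix S :: "real set" assume "open S"
  hence "openin T {p \<in> topspace T. f p \<in> S}" by (intro openin_continuous_map_preimage[OF assms]) simp
  moreover have "{p \<in> topspace T. f p \<in> S} = f -` S \<inter> space \<mu>" by auto
  ultimately show "f -` S \<inter> space \<mu> \<in> sets \<mu>" using open_sets by simp
qed

lemma continuous_T_measurable:
  assumes "continuous_map T T f"
  shows "f \<in> measurable \<mu> \<mu>"
proof (rule measurable_sigma_sets[OF sets_\<mu>])
  show "{U. openin T U} \<subseteq> Pow (bordification b)" by (auto dest: openin_T_subset)
  show "f \<in> space \<mu> \<rightarrow> bordification b" using assms by (auto simp: continuous_map_def)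
  fix U assume "U \<in> {U. openin T U}"
  hence "openin T {p \<in> topspace T. f p \<in> U}" by (intro openin_continuous_map_preimage[OF assms]) simp
  moreover have "{p \<in> topspace T. f p \<in> U} = f -` U \<inter> space \<mu>" by auto
  ultimately show "f -` U \<inter> space \<mu> \<in> sets \<mu>" using open_sets by simp
qed

lemma gact_measurable [measurable]: "g \<in> carrier \<Gamma> \<Longrightarrow> gact g \<in> measurable \<mu> \<mu>"
  by (rule continuous_T_measurable[OF continuous_gact])

lemma gact_sets: 
  assumes "g \<in> carrier \<Gamma>" "A \<in> sets \<mu>"
  shows "gact g ` A \<in> sets \<mu>"
proof -
  have "gact g ` A = gact (inv g) -` A \<inter> space \<mu>"
    using gact_image_eq_vimage[OF assms(1)] sets.sets_into_space[OF assms(2)] by simp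
  thus ?thesis using measurable_sets[OF gact_measurable[of "inv g"] assms(2)] assms(1) by simp
qed

lemma boundary_sets: "boundary_part b \<in> sets \<mu>"
  by (rule closed_sets[OF closedin_boundary_part])

lemma regular_T:
  assumes "finite_measure M" "sets M = sets \<mu>" "A \<in> sets M" "e > 0"
  obtains F U where "closedin T F" "openin T U" "F \<subseteq> A" "A \<subseteq> U" "measure M (U - F) < e"
proof (rule regular_approx[where X=T and M=M and A=A and e=e])
  show "space M = topspace T" using sets_eq_imp_space_eq[OF assms(2)] by simp
  show "sets M = sigma_sets (topspace T) {U. openin T U}" using assms sets_\<mu> by simp
  show "\<exists>F::nat \<Rightarrow> _. (\<forall>n. closedin T (F n)) \<and> incseq F \<and> (\<Union>n. F n) = U" if U: "openin T U" for U
  proof -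
    obtain F where "\<And>n::nat. closedin T (F n)" "incseq F" "(\<Union>n. F n) = U" using open_Fsigma[OF U] by blast
    thus ?thesis by blast
  qed
qed (use assms that in auto)

definition \<omega> :: real where "\<omega> = real_of_ereal (growth_rate \<Gamma> \<phi> b)"

lemma orbit_ball_eq: "orbit_ball \<Gamma> \<phi> b n = (\<lambda>g. \<phi> g b) ` gball (real n)"
  by (auto simp: orbit_ball_def gball_def len_def)

lemma finite_orbit_ball [simp]: "finite (orbit_ball \<Gamma> \<phi> b n)"
  by (simp add: orbit_ball_eq)

lemma orbit_ball_pos: "card (orbit_ball \<Gamma> \<phi> b n) \<ge> 1"
proof -
  have "\<one> \<in> gball (real n)" by (simp add: gball_def)
  hence "orbit_ball \<Gamma> \<phi> b n \<noteq> {}" unfolding orbit_ball_eq by blast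
  thus ?thesis by (simp add: Suc_leI card_gt_0_iff)
qed

lemma growth_nonneg: "growth_rate \<Gamma> \<phi> b \<ge> 0"
proof -
  have "0 \<le> ereal (1 / real n * ln (real (card (orbit_ball \<Gamma> \<phi> b n))))" for n
    using orbit_ball_pos[of n] by (simp add: ln_ge_zero)
  thus ?thesis unfolding growth_rate_def by (intro le_Limsup) auto
qed

text \<open>Real exponents strictly above the growth rate, together with
  \<open>growth_nonneg\<close>, force this extended real to be finite.\<close>

lemma ps_sequence: "\<exists>s :: nat \<Rightarrow> real. (\<forall>i. s i > \<omega>) \<and> s \<longlonglongrightarrow> \<omega> \<and>
   weak_limit T (\<lambda>i. orbital_measure \<Gamma> \<phi> b (s i)) \<mu>"
  and growth_eq: "growth_rate \<Gamma> \<phi> b = ereal \<omega>"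
proof -
  obtain s :: "nat \<Rightarrow> real" where s: "\<forall>i. ereal (s i) > growth_rate \<Gamma> \<phi> b" 
        "(\<lambda>i. ereal (s i)) \<longlonglongrightarrow> growth_rate \<Gamma> \<phi> b"
        "weak_limit T (\<lambda>i. orbital_measure \<Gamma> \<phi> b (s i)) \<mu>"
    using ps unfolding patterson_sullivan_def by blast
  have "growth_rate \<Gamma> \<phi> b \<noteq> \<infinity>" "growth_rate \<Gamma> \<phi> b \<noteq> -\<infinity>" using s(1) growth_nonneg by auto
  thus e: "growth_rate \<Gamma> \<phi> b = ereal \<omega>" unfolding \<omega>_def by (cases "growth_rate \<Gamma> \<phi> b") auto
  show "\<exists>s :: nat \<Rightarrow> real. (\<forall>i. s i > \<omega>) \<and> s \<longlonglongrightarrow> \<omega> \<and>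
   weak_limit T (\<lambda>i. orbital_measure \<Gamma> \<phi> b (s i)) \<mu>"
    using s unfolding e by auto
qed

lemma \<omega>_nonneg: "\<omega> \<ge> 0" using growth_nonneg growth_eq by simp

definition sexp :: "nat \<Rightarrow> real" where
  "sexp = (SOME s. (\<forall>i. s i > \<omega>) \<and> s \<longlonglongrightarrow> \<omega> \<and>
     weak_limit T (\<lambda>i. orbital_measure \<Gamma> \<phi> b (s i)) \<mu>)"

lemma sexp: "sexp i > \<omega>" "sexp \<longlonglongrightarrow> \<omega>" "weak_limit T (\<lambda>i. orbital_measure \<Gamma> \<phi> b (sexp i)) \<mu>"
  using someI_ex[OF ps_sequence] unfolding sexp_def[symmetric] by auto

definition wt :: "real \<Rightarrow> 'g \<Rightarrow> real" where
  "wt s g = exp (- s * len g) / poincare_series \<Gamma> \<phi> b s"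

lemma poincare_nonneg: "poincare_series \<Gamma> \<phi> b s \<ge> 0"
  unfolding poincare_series_def by (rule infsum_nonneg) simp

lemma wt_nonneg [simp]: "wt s g \<ge> 0"
  by (simp add: wt_def poincare_nonneg)

text \<open>If the Poincare series diverges, its value and hence all the weights are \<open>0\<close>.\<close>

lemma wt_integrable: "integrable (count_space (carrier \<Gamma>)) (wt s)"
proof (cases "(\<lambda>g. exp (- s * dist b (\<phi> g b))) summable_on carrier \<Gamma>")
  case True
  hence "Infinite_Sum.abs_summable_on (\<lambda>g. exp (- s * dist b (\<phi> g b))) (carrier \<Gamma>)" by simp
  hence "integrable (count_space (carrier \<Gamma>)) (\<lambda>g. exp (- s * dist b (\<phi> g b)))"
    by (simp add: abs_summable_equivalent[symmetric] abs_summable_on_def[symmetric] del: real_norm_def)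
  thus ?thesis unfolding wt_def len_def by simp
next
  case False
  hence "poincare_series \<Gamma> \<phi> b s = 0" unfolding poincare_series_def by (rule infsum_not_exists)
  hence "wt s = (\<lambda>_. 0)" by (simp add: wt_def fun_eq_iff)
  thus ?thesis by simp
qed

lemma integral_orbital:
  fixes f :: "_ \<Rightarrow> real"
  assumes "continuous_map T euclideanreal f"
  shows "(\<integral>x. f x \<partial>orbital_measure \<Gamma> \<phi> b s) = (\<integral>g. wt s g * f (Inl (\<phi> g b)) \<partial>count_space (carrier \<Gamma>))"
proof -
  have fm: "f \<in> borel_measurable (bordification_borel b)"
    using continuous_measurable[OF assms] sets_\<mu>_borel by (metis measurable_cong_sets)
  have "(\<integral>x. f x \<partial>orbital_measure \<Gamma> \<phi> b s) =
     (\<integral>g. f (Inl (\<phi> g b)) \<partial>density (count_space (carrier \<Gamma>)) (\<lambda>g. ennreal (wt s g)))"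
    unfolding orbital_measure_def wt_def len_def
    by (rule integral_distr[OF _ fm]) auto
  also have "\<dots> = (\<integral>g. wt s g * f (Inl (\<phi> g b)) \<partial>count_space (carrier \<Gamma>))"
    by (subst integral_density) auto
  finally show ?thesis .
qed

lemma wt_bounded_integrable:
  fixes f :: "_ \<Rightarrow> real"
  assumes "\<And>g. g \<in> carrier \<Gamma> \<Longrightarrow> \<bar>f g\<bar> \<le> C"
  shows "integrable (count_space (carrier \<Gamma>)) (\<lambda>g. wt s g * f g)"
proof (rule Bochner_Integration.integrable_bound)
  show "integrable (count_space (carrier \<Gamma>)) (\<lambda>g. C * wt s g)" using wt_integrable by simp
  show "AE g in count_space (carrier \<Gamma>). norm (wt s g * f g) \<le> norm (C * wt s g)"
  proof (rule AE_I2)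
    fix g assume "g \<in> space (count_space (carrier \<Gamma>))"
    hence "\<bar>f g\<bar> \<le> \<bar>C\<bar>" using assms[of g] by auto
    thus "norm (wt s g * f g) \<le> norm (C * wt s g)"
      by (simp add: abs_mult mult.commute mult_right_mono)
  qed
qed simp

lemma weak_limitD:
  fixes f :: "_ \<Rightarrow> real"
  assumes "continuous_map T euclideanreal f" "\<And>p. p \<in> bordification b \<Longrightarrow> f p \<in> {0..1}"
  shows "(\<lambda>i. \<integral>g. wt (sexp i) g * f (Inl (\<phi> g b)) \<partial>count_space (carrier \<Gamma>)) \<longlonglongrightarrow> (\<integral>x. f x \<partial>\<mu>)"
proof -
  have "bounded (f ` topspace T)"
    by (rule bounded_subset[of "{0..1}"]) (use assms in auto)
  thus ?thesis using sexp(3) assms(1) unfolding weak_limit_def integral_orbital[OF assms(1), symmetric] by blast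
qed

lemma quasiconformal_function:
  fixes f :: "_ \<Rightarrow> real"
  assumes g: "g \<in> carrier \<Gamma>"
    and W: "\<And>x. Inl x \<in> W \<Longrightarrow> a \<le> dist (\<phi> g b) x - dist b x"
    and f: "continuous_map T euclideanreal f" "\<And>p. p \<in> bordification b \<Longrightarrow> f p \<in> {0..1}"
      "\<And>p. p \<in> bordification b \<Longrightarrow> p \<notin> W \<Longrightarrow> f p = 0"
  shows "(\<integral>x. f (gact g x) \<partial>\<mu>) \<le> exp (- \<omega> * a) * (\<integral>x. f x \<partial>\<mu>)"
proof -
  let ?C = "count_space (carrier \<Gamma>)"
  have fg: "continuous_map T euclideanreal (\<lambda>x. f (gact g x))"
    using continuous_map_compose[OF continuous_gact[OF g] f(1)] by (simp add: comp_def)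
  have fb: "\<bar>f (Inl x)\<bar> \<le> 1" for x using f(2)[of "Inl x"] by auto
  have *: "(\<integral>h. wt s h * f (gact g (Inl (\<phi> h b))) \<partial>?C) \<le> exp (- s * a) * (\<integral>h. wt s h * f (Inl (\<phi> h b)) \<partial>?C)"
    if s: "s \<ge> 0" for s
  proof -
    \<comment> \<open>Summing over \<open>inv g \<otimes> h\<close> cancels the \<open>g\<close>
      inside \<open>f\<close>, so that only the weight changes, from d(b, h b) to d(g b, h b) in the
      exponent.\<close>
    have bij: "bij_betw (\<lambda>h. inv g \<otimes> h) (carrier \<Gamma>) (carrier \<Gamma>)"
      by (rule bij_betw_byWitness[where f'="\<lambda>h. g \<otimes> h"]) (use g in \<open>auto simp: \<Gamma>.m_assoc[symmetric]\<close>)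
    have "(\<integral>h. wt s h * f (gact g (Inl (\<phi> h b))) \<partial>?C)
        = (\<integral>h. wt s (inv g \<otimes> h) * f (gact g (Inl (\<phi> (inv g \<otimes> h) b))) \<partial>?C)"
      using integral_bij_count_space[OF bij, of "\<lambda>h. wt s h * f (gact g (Inl (\<phi> h b)))"] by simp
    also have "\<dots> = (\<integral>h. wt s (inv g \<otimes> h) * f (Inl (\<phi> h b)) \<partial>?C)"
      using g by (intro Bochner_Integration.integral_cong) (auto simp: act_mult)
    also have "\<dots> \<le> (\<integral>h. exp (- s * a) * (wt s h * f (Inl (\<phi> h b))) \<partial>?C)"
    proof (rule integral_mono_AE)
      have "integrable ?C (\<lambda>h. wt s h * f (gact g (Inl (\<phi> h b))))"
        by (rule wt_bounded_integrable[of _ 1]) (use fb in simp)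
      hence "integrable ?C (\<lambda>h. wt s (inv g \<otimes> h) * f (gact g (Inl (\<phi> (inv g \<otimes> h) b))))"
        using integrable_bij_count_space[OF bij, of "\<lambda>h. wt s h * f (gact g (Inl (\<phi> h b)))"] by simp
      moreover have "integrable ?C (\<lambda>h. wt s (inv g \<otimes> h) * f (gact g (Inl (\<phi> (inv g \<otimes> h) b))))
         = integrable ?C (\<lambda>h. wt s (inv g \<otimes> h) * f (Inl (\<phi> h b)))"
        using g by (intro Bochner_Integration.integrable_cong) (auto simp: act_mult)
      ultimately show "integrable ?C (\<lambda>h. wt s (inv g \<otimes> h) * f (Inl (\<phi> h b)))" by simp
      show "integrable ?C (\<lambda>h. exp (- s * a) * (wt s h * f (Inl (\<phi> h b))))"
        by (intro integrable_mult_right wt_bounded_integrable[of _ 1]) (use fb in simp)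
      show "AE h in ?C. wt s (inv g \<otimes> h) * f (Inl (\<phi> h b)) \<le> exp (- s * a) * (wt s h * f (Inl (\<phi> h b)))"
      proof (rule AE_I2)
        fix h assume "h \<in> space ?C"
        hence h: "h \<in> carrier \<Gamma>" by simp
        show "wt s (inv g \<otimes> h) * f (Inl (\<phi> h b)) \<le> exp (- s * a) * (wt s h * f (Inl (\<phi> h b)))"
        proof (cases "Inl (\<phi> h b) \<in> W")
          case True
          have "len (inv g \<otimes> h) = dist (\<phi> g b) (\<phi> h b)"
            using g h act_dist_shift[of g b "\<phi> h b"] by (simp add: len_def act_mult)
          hence "a + len h \<le> len (inv g \<otimes> h)" using W[OF True] by (simp add: len_def)
          hence "exp (- s * len (inv g \<otimes> h)) \<le> exp (- s * a) * exp (- s * len h)"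
            using s mult_left_mono[of "a + len h" "len (inv g \<otimes> h)" s] by (simp add: exp_add[symmetric] algebra_simps)
          hence "wt s (inv g \<otimes> h) \<le> exp (- s * a) * wt s h"
            unfolding wt_def using poincare_nonneg divide_right_mono by fastforce
          thus ?thesis using f(2)[of "Inl (\<phi> h b)"] mult_right_mono[of _ _ "f (Inl (\<phi> h b))"]
            by (simp add: mult.assoc[symmetric])
        next
          case False
          thus ?thesis using f(3)[of "Inl (\<phi> h b)"] by simp
        qed
      qed
    qed
    also have "\<dots> = exp (- s * a) * (\<integral>h. wt s h * f (Inl (\<phi> h b)) \<partial>?C)" by simp
    finally show ?thesis .
  qed
  have l1: "(\<lambda>i. \<integral>h. wt (sexp i) h * f (gact g (Inl (\<phi> h b))) \<partial>?C) \<longlonglongrightarrow> (\<integral>x. f (gact g x) \<partial>\<mu>)"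
    by (rule weak_limitD[OF fg]) (use f(2) g in auto)
  have l2: "(\<lambda>i. exp (- sexp i * a) * (\<integral>h. wt (sexp i) h * f (Inl (\<phi> h b)) \<partial>?C)) \<longlonglongrightarrow> exp (- \<omega> * a) * (\<integral>x. f x \<partial>\<mu>)"
    by (intro tendsto_intros sexp(2) weak_limitD[OF f(1,2)])
  \<comment> \<open>Nonnegative exponents turn a lower bound on the difference of distances into an
    upper bound on the weights.\<close>
  have sp: "sexp i \<ge> 0" for i using sexp(1)[of i] \<omega>_nonneg by linarith
  show ?thesis
    by (rule LIMSEQ_le[OF l1 l2]) (use *[OF sp] in blast)
qed

text \<open>The bound is assumed at points of X alone, because the approximating measures are
  carried by the orbit; a Urysohn function between \<open>F\<close> and \<open>V\<close> transfers
  it to the limit.\<close>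

lemma quasiconformal_closed_open:
  assumes g: "g \<in> carrier \<Gamma>"
    and W: "\<And>x. Inl x \<in> V \<Longrightarrow> a \<le> dist (\<phi> g b) x - dist b x"
    and FV: "closedin T F" "openin T V" "F \<subseteq> V"
  shows "measure \<mu> (gact (inv g) ` F) \<le> exp (- \<omega> * a) * measure \<mu> V"
proof -
  obtain f :: "_ \<Rightarrow> real" where f: "continuous_map T euclideanreal f"
    "\<And>p. p \<in> bordification b \<Longrightarrow> f p \<in> {0..1}" "\<And>p. p \<in> F \<Longrightarrow> f p = 1"
    "\<And>p. p \<in> bordification b \<Longrightarrow> p \<notin> V \<Longrightarrow> f p = 0" using urysohn_function[OF FV] by blast
  have fm: "f \<in> borel_measurable \<mu>" by (rule continuous_measurable[OF f(1)])
  have fi: "integrable \<mu> f" "integrable \<mu> (\<lambda>x. f (gact g x))"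
    by (rule integrable_const_bound[where B=1]; use f(2) g fm in force)+
  have Fs: "gact (inv g) ` F \<in> sets \<mu>" "V \<in> sets \<mu>"
    using gact_sets[of "inv g" F] closed_sets[OF FV(1)] g open_sets[OF FV(2)] by auto
  have "measure \<mu> (gact (inv g) ` F) = (\<integral>x. indicator (gact (inv g) ` F) x \<partial>\<mu>)"
    using Fs sets.sets_into_space[OF Fs(1)] by (simp add: Int_absorb2)
  also have "\<dots> \<le> (\<integral>x. f (gact g x) \<partial>\<mu>)"
  proof (rule integral_mono)
    fix x assume "x \<in> space \<mu>"
    thus "indicator (gact (inv g) ` F) x \<le> f (gact g x)"
      using f(2)[of "gact g x"] f(3) g by (auto simp: indicator_def)
  qed (use fi Fs in \<open>auto simp: less_top[symmetric]\<close>)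
  also have "\<dots> \<le> exp (- \<omega> * a) * (\<integral>x. f x \<partial>\<mu>)"
    by (rule quasiconformal_function[OF g W f(1,2,4)])
  also have "(\<integral>x. f x \<partial>\<mu>) \<le> (\<integral>x. indicator V x \<partial>\<mu>)"
  proof (rule integral_mono)
    fix x assume "x \<in> space \<mu>"
    thus "f x \<le> indicator V x" using f(2)[of x] f(4)[of x] by (auto simp: indicator_def)
  qed (use fi Fs in \<open>auto simp: less_top[symmetric]\<close>)
  also have "\<dots> = measure \<mu> V"
    using Fs sets.sets_into_space[OF Fs(2)] by (simp add: Int_absorb2)
  finally show ?thesis by simp
qed

text \<open>Two measures are approximated: the image of \<mu> under \<open>gact g\<close> from
  inside by closed sets, and \<mu> itself from outside by open sets.\<close>

lemma quasiconformal_le: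
  assumes g: "g \<in> carrier \<Gamma>"
    and W: "openin T W" "\<And>x. Inl x \<in> W \<Longrightarrow> a \<le> dist (\<phi> g b) x - dist b x"
    and A: "A \<in> sets \<mu>" "A \<subseteq> W"
  shows "measure \<mu> (gact (inv g) ` A) \<le> exp (- \<omega> * a) * measure \<mu> A"
proof (rule field_le_epsilon)
  fix e :: real assume "e > 0"
  \<comment> \<open>The closed set costs \<open>e'\<close>, the open set costs \<open>e'\<close>
    times the conformal factor; together they make \<open>e\<close>.\<close>
  define e' where "e' = e / (1 + exp (- \<omega> * a))"
  have pos: "1 + exp (- \<omega> * a) > 0" by (simp add: add_pos_pos)
  hence "e' * (1 + exp (- \<omega> * a)) = e" by (simp add: e'_def)
  hence e'2: "e' + exp (- \<omega> * a) * e' = e" by (simp add: algebra_simps)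
  have e': "e' > 0" using \<open>e > 0\<close> pos by (simp add: e'_def)
  let ?N = "distr \<mu> \<mu> (gact g)"
  have img: "measure ?N B = measure \<mu> (gact (inv g) ` B)" if "B \<in> sets \<mu>" for B
  proof -
    have "gact (inv g) ` B = gact g -` B \<inter> space \<mu>"
      using gact_image_eq_vimage[of "inv g" B] sets.sets_into_space[OF that] g by simp
    thus ?thesis using that g by (simp add: measure_distr)
  qed
  have N: "finite_measure ?N" using prob_space_distr[OF gact_measurable[OF g]] by (simp add: prob_space_def)
  have AN: "A \<in> sets ?N" "sets ?N = sets \<mu>" using A by simp_all
  obtain F U' where F: "closedin T F" "openin T U'" "F \<subseteq> A" "A \<subseteq> U'" "measure ?N (U' - F) < e'"
    by (rule regular_T[OF N AN(2,1) e'])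
  obtain F' U where U: "closedin T F'" "openin T U" "F' \<subseteq> A" "A \<subseteq> U" "measure \<mu> (U - F') < e'"
    by (rule regular_T[OF finite_measure_axioms refl A(1) e'])
  have Fs: "F \<in> sets \<mu>" "F' \<in> sets \<mu>" "U \<in> sets \<mu>" "U' \<in> sets \<mu>" "W \<in> sets \<mu>"
    using F U W closed_sets open_sets by auto
  interpret N: finite_measure ?N by fact
  have "measure \<mu> (gact (inv g) ` A) = measure ?N A" using img A by simp
  also have "\<dots> \<le> measure ?N (F \<union> (U' - F))"
    by (rule N.finite_measure_mono) (use Fs F in auto)
  also have "\<dots> \<le> measure ?N F + measure ?N (U' - F)"
    by (rule measure_Un_le) (use Fs in auto)
  also have "\<dots> \<le> measure \<mu> (gact (inv g) ` F) + e'" using F(5) img[OF Fs(1)] by simp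
  also have "measure \<mu> (gact (inv g) ` F) \<le> exp (- \<omega> * a) * measure \<mu> (U \<inter> W)"
    by (rule quasiconformal_closed_open[OF g _ F(1)]) (use W U F A in auto)
  also have "measure \<mu> (U \<inter> W) \<le> measure \<mu> (A \<union> (U - F'))"
    by (rule finite_measure_mono) (use Fs A U in auto)
  also have "\<dots> \<le> measure \<mu> A + measure \<mu> (U - F')"
    by (rule measure_Un_le) (use Fs A in auto)
  also have "\<dots> \<le> measure \<mu> A + e'" using U by simp
  finally show "measure \<mu> (gact (inv g) ` A) \<le> exp (- \<omega> * a) * measure \<mu> A + e"
    using e'2 by (simp add: algebra_simps)
qed

text \<open>The upper bound for \<open>inv g\<close> on the translated set: exchanging
  \<open>g\<close> and its inverse changes the sign of the difference of distances.\<close>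

lemma quasiconformal_ge:
  assumes g: "g \<in> carrier \<Gamma>"
    and W: "openin T W" "\<And>x. Inl x \<in> W \<Longrightarrow> dist (\<phi> g b) x - dist b x \<le> a"
    and A: "A \<in> sets \<mu>" "A \<subseteq> W"
  shows "exp (- \<omega> * a) * measure \<mu> A \<le> measure \<mu> (gact (inv g) ` A)"
proof -
  let ?W = "gact (inv g) ` W" and ?A = "gact (inv g) ` A"
  have gi: "inv g \<in> carrier \<Gamma>" using g by simp
  have ii: "gact g ` ?A = A" using g by (simp add: image_image)
  have "measure \<mu> (gact (inv (inv g)) ` ?A) \<le> exp (- \<omega> * (-a)) * measure \<mu> ?A"
  proof (rule quasiconformal_le[OF gi, of ?W])
    show "openin T ?W" using openin_gact_image[OF gi W(1)] .
    show "?A \<in> sets \<mu>" "?A \<subseteq> ?W" using gact_sets[OF gi] A by auto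
    fix x assume "Inl x \<in> ?W"
    then obtain p where p: "p \<in> W" "Inl x = gact (inv g) p" by blast
    have "gact g (Inl x) = p" using g p(2) by simp
    hence "dist (\<phi> g b) (\<phi> g x) - dist b (\<phi> g x) \<le> a" using W(2)[of "\<phi> g x"] p(1) by simp
    thus "- a \<le> dist (\<phi> (inv g) b) x - dist b x"
      using g act_dist_shift[of "inv g" b x] by simp
  qed
  hence "measure \<mu> A \<le> exp (\<omega> * a) * measure \<mu> ?A" using g ii by simp
  hence "exp (- \<omega> * a) * measure \<mu> A \<le> exp (- \<omega> * a) * (exp (\<omega> * a) * measure \<mu> ?A)"
    by (rule mult_left_mono) simp
  thus ?thesis by (simp add: mult.assoc[symmetric] exp_add[symmetric])
qed

end

section \<open>Divergence at the critical exponent\<close>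

locale patterson_nonelementary = patterson b \<delta> \<Gamma> \<phi> \<mu>
  for b :: "'a::heine_borel" and \<delta> and \<Gamma> :: "('g, 'c) monoid_scheme" (structure) and \<phi> and \<mu> +
  assumes nonelementary: "\<not> elementary_group \<Gamma>"
begin

lemma infinite_carrier: "infinite (carrier \<Gamma>)"
  using nonelementary by (simp add: elementary_group_def)

lemma D_pos: "D > 0" using D(1) by linarith

lemma exists_len_ge: "\<exists>g\<in>carrier \<Gamma>. len g > r"
proof (rule ccontr)
  assume "\<not> ?thesis"
  hence "carrier \<Gamma> \<subseteq> gball r" by (auto simp: gball_def not_less)
  thus False using infinite_carrier finite_gball finite_subset by blast
qed

text \<open>An annulus whose half-width 2 D reproduces itself when a geodesic is cut in two, see
  \<open>thick_submult\<close>.\<close>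

definition thick :: "real \<Rightarrow> 'g set" where
  "thick n = {g \<in> carrier \<Gamma>. \<bar>len g - n\<bar> \<le> 2 * D}"

lemma thick_subset: "thick n \<subseteq> gball (n + 2 * D)"
  by (auto simp: thick_def gball_def)

lemma finite_thick [simp]: "finite (thick n)"
  using thick_subset finite_gball finite_subset by blast

lemma thick_nonempty: assumes "n \<ge> 0" shows "thick n \<noteq> {}"
proof -
  obtain g where g: "g \<in> carrier \<Gamma>" "len g > n" using exists_len_ge by blast
  obtain z where z: "dist b z = n" using geodesic_point_gp[of n "\<phi> g b"] assms g by (force simp: len_def)
  obtain u where u: "u \<in> carrier \<Gamma>" "dist z (\<phi> u b) \<le> D" using D(2) by blast
  have "\<bar>len u - n\<bar> \<le> 2 * D"
    using u z D_pos dist_triangle[of b "\<phi> u b" z] dist_triangle[of b z "\<phi> u b"]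
    by (simp add: len_def dist_commute abs_le_iff)
  thus ?thesis using u by (auto simp: thick_def)
qed

lemma card_thick_pos: "n \<ge> 0 \<Longrightarrow> card (thick n) \<ge> 1"
  using thick_nonempty by (simp add: Suc_leI card_gt_0_iff)

text \<open>The length error of \<open>g\<close>, at most 2 D, is shared equally by the two parts of
  the geodesic, which leaves D on each; moving the cut point to the orbit costs another D.\<close>

lemma thick_submult:
  assumes "n \<ge> D" "m \<ge> D"
  shows "card (thick (n + m)) \<le> card (thick n) * card (thick m)"
proof -
  have "thick (n + m) \<subseteq> (\<lambda>(u, v). u \<otimes> v) ` (thick n \<times> thick m)"
  proof
    fix g assume "g \<in> thick (n + m)"
    hence g: "g \<in> carrier \<Gamma>" "\<bar>len g - (n + m)\<bar> \<le> 2 * D" by (auto simp: thick_def)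
    define e where "e = (len g - (n + m)) / 2"
    have e: "\<bar>e\<bar> \<le> D" "len g = n + m + 2 * e" using g by (auto simp: e_def field_simps)
    have "0 \<le> n + e" "n + e \<le> dist b (\<phi> g b)" using e assms by (auto simp: len_def abs_le_iff)
    then obtain z where z: "dist b z = n + e" "dist z (\<phi> g b) = dist b (\<phi> g b) - (n + e)"
      using geodesic_point by blast
    have z2: "dist z (\<phi> g b) = m + e" using z(2) e(2) by (simp add: len_def)
    obtain u where u: "u \<in> carrier \<Gamma>" "dist z (\<phi> u b) \<le> D" using D(2) by blast
    have lu: "len (inv u \<otimes> g) = dist (\<phi> u b) (\<phi> g b)"
      using u g act_dist_shift[of u b "\<phi> g b"] by (simp add: len_def act_mult)
    have "u \<in> thick n"
      using u z(1) e dist_triangle[of b "\<phi> u b" z] dist_triangle[of b z "\<phi> u b"]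
      by (simp add: thick_def len_def dist_commute abs_le_iff)
    moreover have "inv u \<otimes> g \<in> thick m"
      using u g z2 e lu dist_triangle[of "\<phi> u b" "\<phi> g b" z] dist_triangle[of z "\<phi> g b" "\<phi> u b"]
      by (simp add: thick_def dist_commute abs_le_iff)
    moreover have "g = u \<otimes> (inv u \<otimes> g)" using u g by (simp add: \<Gamma>.m_assoc[symmetric])
    ultimately show "g \<in> (\<lambda>(u, v). u \<otimes> v) ` (thick n \<times> thick m)" by force
  qed
  hence "card (thick (n + m)) \<le> card (thick n \<times> thick m)"
    by (rule surj_card_le[rotated]) simp
  thus ?thesis by (simp add: card_cartesian_product)
qed

lemma gball_thick: "gball (real N) \<subseteq> (\<Union>m\<le>N. thick (real m))"
proof
  fix g assume g: "g \<in> gball (real N)"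
  let ?m = "nat \<lfloor>len g\<rfloor>"
  have "real ?m \<le> len g" "len g < real ?m + 1" using len_nonneg[of g] by linarith+
  hence m: "\<bar>len g - real ?m\<bar> \<le> 2 * D" using D(1) by linarith
  have "len g \<le> real N" using g by (simp add: gball_def)
  hence "?m \<le> N" by linarith
  moreover have "g \<in> thick (real ?m)" using g m by (simp add: gball_def thick_def)
  ultimately
  show "g \<in> (\<Union>m\<le>N. thick (real m))" by blast
qed

lemma card_orbit_ball_le: "card (orbit_ball \<Gamma> \<phi> b n) \<le> card (gball (real n))"
  unfolding orbit_ball_eq by (rule card_image_le) simp

text \<open>Fekete: a single annulus with fewer than \<open>exp (\<omega> n)\<close> elements would, by
  submultiplicativity, force a growth rate smaller than \<open>\<omega>\<close>.\<close>

lemma card_thick_ge: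
  fixes n :: nat
  assumes n: "real n \<ge> D"
  shows "real (card (thick (real n))) \<ge> exp (\<omega> * real n)"
proof (rule ccontr)
  let ?t = "\<lambda>m::nat. real (card (thick (real m)))"
  assume "\<not> ?thesis"
  hence lt: "?t n < exp (\<omega> * real n)" by simp
  have n0: "n > 0" using n D(1) by (cases n) auto
  have t1: "?t m \<ge> 1" for m using card_thick_pos[of "real m"] by simp
  define w where "w = ln (?t n) / real n"
  have w: "w \<ge> 0" "w < \<omega>" "?t n = exp (w * real n)"
  proof -
    show "w \<ge> 0" using t1[of n] by (simp add: w_def)
    have "ln (?t n) < \<omega> * real n" using lt t1[of n] by (metis exp_gt_zero ln_exp ln_less_cancel_iff less_le_trans zero_less_one)
    thus "w < \<omega>" using n0 by (simp add: w_def field_simps)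
    show "?t n = exp (w * real n)" using n0 t1[of n] by (simp add: w_def)
  qed
  define M where "M = (\<Sum>r<2*n. ?t r)"
  have M: "?t r \<le> M" if "r < 2 * n" for r
    unfolding M_def using member_le_sum[of r "{..<2*n}" ?t] that by simp
  have M1: "M \<ge> 1" using M[of 0] t1[of 0] n0 by simp
  \<comment> \<open>The remainder is kept between \<open>n\<close> and \<open>2 * n\<close>, since
    \<open>thick_submult\<close> requires both lengths to be at least \<open>D\<close>; hence the
    quotient is lowered by one below.\<close>
  have mult: "?t (k * n + r) \<le> exp (w * real (k * n)) * ?t r" if "r \<ge> n" for k r
  proof (induction k)
    case (Suc k)
    have "?t (Suc k * n + r) = real (card (thick (real n + real (k * n + r))))" by (simp add: algebra_simps)
    also have "\<dots> \<le> real (card (thick (real n)) * card (thick (real (k * n + r))))"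
      using thick_submult[of "real n" "real (k * n + r)"] n that by (simp del: of_nat_mult)
    also have "\<dots> \<le> exp (w * real n) * (exp (w * real (k * n)) * ?t r)"
      using Suc.IH w(3) by (simp add: mult_left_mono)
    also have "\<dots> = exp (w * real (Suc k * n)) * ?t r" by (simp add: algebra_simps exp_add)
    finally show ?case .
  qed simp
  have tm: "?t m \<le> M * exp (w * real m)" for m
  proof (cases "m < 2 * n")
    case True
    have "M * 1 \<le> M * exp (w * real m)" using w M1 by (intro mult_left_mono) auto
    thus ?thesis using M[OF True] by simp
  next
    case False
    define k where "k = m div n - 1"
    have "m div n \<ge> 1" using False n0 by (simp add: div_greater_zero_iff Suc_leI)
    hence "m div n = Suc k" by (simp add: k_def)
    hence mk: "m = k * n + (n + m mod n)" using div_mult_mod_eq[of m n] by simp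
    have "?t m \<le> exp (w * real (k * n)) * ?t (n + m mod n)"
      using mult[of "n + m mod n" k] mk by simp
    also have "\<dots> \<le> exp (w * real m) * M"
    proof (rule mult_mono)
      have "k * n \<le> m" using mk by linarith
      hence "real (k * n) \<le> real m" by (simp only: of_nat_le_iff)
      thus "exp (w * real (k * n)) \<le> exp (w * real m)" using w(1) by (simp add: mult_left_mono del: of_nat_mult)
      show "?t (n + m mod n) \<le> M" by (rule M) (use n0 in simp)
    qed auto
    finally show ?thesis by (simp add: mult.commute)
  qed
  have cb: "real (card (gball (real N))) \<le> (real N + 1) * (M * exp (w * real N))" for N
  proof -
    have "card (gball (real N)) \<le> card (\<Union>m\<le>N. thick (real m))"
      by (rule card_mono[OF _ gball_thick]) simp
    also have "\<dots> \<le> (\<Sum>m\<le>N. card (thick (real m)))" by (rule card_UN_le) simp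
    finally have "real (card (gball (real N))) \<le> (\<Sum>m\<le>N. ?t m)" by (simp flip: of_nat_sum)
    also have "\<dots> \<le> (\<Sum>m\<le>N. M * exp (w * real N))"
    proof (rule sum_mono)
      fix m assume "m \<in> {..N}"
      hence "M * exp (w * real m) \<le> M * exp (w * real N)" using w(1) M1 by (intro mult_left_mono) (auto intro: mult_left_mono)
      thus "?t m \<le> M * exp (w * real N)" using tm[of m] by linarith
    qed
    also have "\<dots> = (real N + 1) * (M * exp (w * real N))" by simp
    finally show ?thesis .
  qed
  \<comment> \<open>The linear factor from summing annuli and the constant \<open>M\<close> vanish
    after normalisation, leaving the rate \<open>w\<close>.\<close>
  let ?f = "\<lambda>N. 1 / real N * (ln (real N + 1) + ln M) + w"
  have up: "1 / real N * ln (real (card (orbit_ball \<Gamma> \<phi> b N))) \<le> ?f N" if "N > 0" for N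
  proof -
    have "ln (real (card (orbit_ball \<Gamma> \<phi> b N))) \<le> ln ((real N + 1) * (M * exp (w * real N)))"
      using orbit_ball_pos[of N] card_orbit_ball_le[of N] cb[of N] by (subst ln_le_cancel_iff) (auto intro: mult_pos_pos M1 less_le_trans[OF zero_less_one])
    also have "\<dots> = ln (real N + 1) + ln M + w * real N" using M1 by (simp add: ln_mult)
    finally show ?thesis using that by (simp add: field_simps)
  qed
  have "?f \<longlonglongrightarrow> 0 + w"
  proof (intro tendsto_add tendsto_const)
    have "(\<lambda>N. ln (real N + 1) / real N) \<longlonglongrightarrow> 0" by real_asymp
    moreover have "(\<lambda>N. ln M / real N) \<longlonglongrightarrow> 0" by real_asymp
    ultimately have "(\<lambda>N. ln (real N + 1) / real N + ln M / real N) \<longlonglongrightarrow> 0 + 0" by (rule tendsto_add)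
    thus "(\<lambda>N. 1 / real N * (ln (real N + 1) + ln M)) \<longlonglongrightarrow> 0" by (simp add: add_divide_distrib)
  qed
  hence "(\<lambda>N. ereal (?f N)) \<longlonglongrightarrow> ereal w" by simp
  hence "limsup (\<lambda>N. ereal (?f N)) = ereal w" by (rule lim_imp_Limsup[rotated]) simp
  moreover have "growth_rate \<Gamma> \<phi> b \<le> limsup (\<lambda>N. ereal (?f N))"
    unfolding growth_rate_def
    by (rule Limsup_mono) (use up in \<open>auto simp: eventually_sequentially intro!: exI[of _ 1]\<close>)
  ultimately show False using w(2) growth_eq by simp
qed

text \<open>Annuli at multiples of \<open>L\<close> are disjoint because \<open>L\<close> exceeds 4
  D, and by \<open>card_thick_ge\<close> each contributes at least the fixed amount \<open>c\<close>
  at the exponent \<omega>.\<close>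

lemma poincare_partial:
  obtains F where "finite F" "F \<subseteq> carrier \<Gamma>" "(\<Sum>g\<in>F. exp (- \<omega> * len g)) \<ge> C"
proof -
  define L where "L = nat \<lceil>4 * D + 1\<rceil>"
  have L: "real L > 4 * D" unfolding L_def using D(1) by linarith
  define c where "c = exp (- 2 * D * \<omega>)"
  have c: "c > 0" by (simp add: c_def)
  obtain J :: nat where J: "C / c \<le> real J" using real_arch_simple by blast
  let ?A = "\<lambda>j::nat. thick (real (L * Suc j))"
  let ?F = "\<Union>j<J. ?A j"
  have dis: "?A i \<inter> ?A j = {}" if "i < j" for i j
  proof -
    have "Suc (Suc i) \<le> Suc j" using that by simp
    hence "L * Suc (Suc i) \<le> L * Suc j" by (rule mult_le_mono2)
    hence "real (L * Suc (Suc i)) \<le> real (L * Suc j)" by (simp only: of_nat_le_iff)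
    hence "real (L * Suc j) - real (L * Suc i) > 4 * D" using L by (simp add: algebra_simps)
    thus ?thesis by (auto simp: thick_def)
  qed
  have "(\<Sum>g\<in>?F. exp (- \<omega> * len g)) = (\<Sum>j<J. \<Sum>g\<in>?A j. exp (- \<omega> * len g))"
  proof (rule sum.UNION_disjoint)
    show "\<forall>i\<in>{..<J}. \<forall>j\<in>{..<J}. i \<noteq> j \<longrightarrow> ?A i \<inter> ?A j = {}"
      using dis by (metis Int_commute linorder_neqE_nat)
  qed auto
  also have "\<dots> \<ge> (\<Sum>j<J. c)"
  proof (rule sum_mono)
    fix j
    let ?n = "L * Suc j"
    have "real L * 1 \<le> real L * real (Suc j)" by (intro mult_left_mono) auto
    hence "real ?n \<ge> D" using L D(1) unfolding of_nat_mult by linarith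
    hence "exp (\<omega> * real ?n) \<le> real (card (?A j))" by (rule card_thick_ge)
    hence "exp (\<omega> * real ?n) * exp (- \<omega> * (real ?n + 2 * D)) \<le> real (card (?A j)) * exp (- \<omega> * (real ?n + 2 * D))"
      by (rule mult_right_mono) simp
    also have "exp (\<omega> * real ?n) * exp (- \<omega> * (real ?n + 2 * D)) = c"
      unfolding c_def exp_add[symmetric] by (rule arg_cong[of _ _ exp]) (simp add: algebra_simps)
    also have "real (card (?A j)) * exp (- \<omega> * (real ?n + 2 * D)) \<le> (\<Sum>g\<in>?A j. exp (- \<omega> * len g))"
    proof (rule sum_bounded_below)
      fix g assume "g \<in> ?A j"
      hence "len g \<le> real ?n + 2 * D" by (auto simp: thick_def)
      thus "exp (- \<omega> * (real ?n + 2 * D)) \<le> exp (- \<omega> * len g)"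
        using mult_left_mono[OF _ \<omega>_nonneg] by fastforce
    qed
    finally show "c \<le> (\<Sum>g\<in>?A j. exp (- \<omega> * len g))" .
  qed
  finally have "(\<Sum>g\<in>?F. exp (- \<omega> * len g)) \<ge> real J * c" by simp
  moreover have "real J * c \<ge> C" using J c by (simp add: field_simps)
  moreover have "finite ?F" by simp
  moreover have "?F \<subseteq> carrier \<Gamma>" by (auto simp: thick_def)
  ultimately show thesis using that by (meson order_trans)
qed

text \<open>The value 0 is the default for a series that is not summable; division by it makes the
  weights 0, so both alternatives make every single weight small.\<close>

lemma poincare_diverges: "\<forall>\<^sub>F i in sequentially. poincare_series \<Gamma> \<phi> b (sexp i) = 0 \<or> poincare_series \<Gamma> \<phi> b (sexp i) \<ge> C"
proof -
  obtain F where F: "finite F" "F \<subseteq> carrier \<Gamma>" "(\<Sum>g\<in>F. exp (- \<omega> * len g)) \<ge> C + 1"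
    using poincare_partial by blast
  have "(\<lambda>i. \<Sum>g\<in>F. exp (- sexp i * len g)) \<longlonglongrightarrow> (\<Sum>g\<in>F. exp (- \<omega> * len g))"
    by (intro tendsto_intros sexp(2))
  hence "\<forall>\<^sub>F i in sequentially. (\<Sum>g\<in>F. exp (- sexp i * len g)) > C"
    by (rule order_tendstoD(1)) (use F(3) in simp)
  thus ?thesis
  proof eventually_elim
    case (elim i)
    show ?case
    proof (cases "(\<lambda>g. exp (- sexp i * dist b (\<phi> g b))) summable_on carrier \<Gamma>")
      case True
      have "(\<Sum>g\<in>F. exp (- sexp i * dist b (\<phi> g b))) \<le> poincare_series \<Gamma> \<phi> b (sexp i)"
        unfolding poincare_series_def by (rule finite_sum_le_infsum[OF True F(1,2)]) simp
      thus ?thesis using elim by (simp add: len_def)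
    next
      case False
      thus ?thesis unfolding poincare_series_def using infsum_not_exists by blast
    qed
  qed
qed

text \<open>Finitely many group elements move \<open>b\<close> into a bounded ball, and each weight
  is eventually at most 1 / C, with \<open>C\<close> chosen to make the total at most
  \<open>e\<close>.\<close>

lemma measure_cball_zero: "measure \<mu> (Inl ` cball b r) = 0"
proof (rule antisym[OF _ measure_nonneg], rule field_le_epsilon)
  fix e :: real assume e: "e > 0"
  let ?F = "Inl ` cball b r" and ?U = "Inl ` ball b (r + 1)"
  have cl: "closedin T ?F" by (rule closedin_Inl) simp
  have "openin T ?U" "?F \<subseteq> ?U" by auto
  then obtain f :: "_ \<Rightarrow> real" where f: "continuous_map T euclideanreal f"
    "\<And>p. p \<in> bordification b \<Longrightarrow> f p \<in> {0..1}" "\<And>p. p \<in> ?F \<Longrightarrow> f p = 1"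
    "\<And>p. p \<in> bordification b \<Longrightarrow> p \<notin> ?U \<Longrightarrow> f p = 0" using urysohn_function[OF cl] by blast
  let ?B = "gball (r + 1)" and ?C = "count_space (carrier \<Gamma>)"
  define C where "C = (real (card ?B) + 1) / e"
  have C: "C > 0" using e by (simp add: C_def)
  have BC: "real (card ?B) / C \<le> e" using e by (simp add: C_def field_simps)
  have fi: "integrable \<mu> f"
    by (rule integrable_const_bound[where B=1]) (use f(2) continuous_measurable[OF f(1)] in auto)
  have lim: "(\<lambda>i. \<integral>g. wt (sexp i) g * f (Inl (\<phi> g b)) \<partial>?C) \<longlonglongrightarrow> (\<integral>x. f x \<partial>\<mu>)"
    by (rule weak_limitD[OF f(1,2)])
  have "\<forall>\<^sub>F i in sequentially. (\<integral>g. wt (sexp i) g * f (Inl (\<phi> g b)) \<partial>?C) \<le> e"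
    using poincare_diverges[of C]
  proof eventually_elim
    case (elim i)
    let ?h = "\<lambda>g. wt (sexp i) g * f (Inl (\<phi> g b))"
    have sub: "{g \<in> carrier \<Gamma>. ?h g \<noteq> 0} \<subseteq> ?B"
    proof
      fix g assume "g \<in> {g \<in> carrier \<Gamma>. ?h g \<noteq> 0}"
      hence g: "g \<in> carrier \<Gamma>" "f (Inl (\<phi> g b)) \<noteq> 0" by auto
      hence "Inl (\<phi> g b) \<in> ?U" using f(4)[of "Inl (\<phi> g b)"] Inl_bord by (cases "Inl (\<phi> g b) \<in> ?U") auto
      thus "g \<in> ?B" using g by (auto simp: gball_def len_def)
    qed
    have "(\<integral>g. ?h g \<partial>?C) = (\<Sum>g | g \<in> carrier \<Gamma> \<and> ?h g \<noteq> 0. ?h g)"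
      by (rule lebesgue_integral_count_space_finite_support) (use sub finite_subset finite_gball in blast)
    also have "\<dots> \<le> (\<Sum>g | g \<in> carrier \<Gamma> \<and> ?h g \<noteq> 0. 1 / C)"
    proof (rule sum_mono)
      fix g
      have f1: "f (Inl (\<phi> g b)) \<le> 1" using f(2)[of "Inl (\<phi> g b)"] by auto
      have "sexp i \<ge> 0" using sexp(1)[of i] \<omega>_nonneg by linarith
      hence "exp (- sexp i * len g) \<le> 1" by simp
      hence "wt (sexp i) g \<le> 1 / C"
        using elim C unfolding wt_def
        by (cases "poincare_series \<Gamma> \<phi> b (sexp i) = 0") (auto intro!: frac_le)
      hence "?h g \<le> 1 / C * 1" using f1 f(2)[of "Inl (\<phi> g b)"] C by (intro mult_mono) auto
      thus "?h g \<le> 1 / C" by simp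
    qed
    also have "\<dots> = real (card {g \<in> carrier \<Gamma>. ?h g \<noteq> 0}) / C" by simp
    also have "\<dots> \<le> real (card ?B) / C"
      using card_mono[OF _ sub] C by (intro divide_right_mono) auto
    also have "\<dots> \<le> e" by (rule BC)
    finally show ?case .
  qed
  hence le: "(\<integral>x. f x \<partial>\<mu>) \<le> e" by (rule tendsto_upperbound[OF lim]) simp
  have Fs: "?F \<in> sets \<mu>" by (rule closed_sets[OF cl])
  have "measure \<mu> ?F = (\<integral>x. indicator ?F x \<partial>\<mu>)"
    using Fs sets.sets_into_space[OF Fs] by (simp add: Int_absorb2)
  also have "\<dots> \<le> (\<integral>x. f x \<partial>\<mu>)"
  proof (rule integral_mono)
    fix x assume "x \<in> space \<mu>"
    thus "indicator ?F x \<le> f x" using f(2)[of x] f(3)[of x] by (auto simp: indicator_def)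
  qed (use fi Fs in \<open>auto simp: less_top[symmetric]\<close>)
  finally show "measure \<mu> ?F \<le> 0 + e" using le by simp
qed

lemma measure_boundary: "measure \<mu> (boundary_part b) = 1"
proof -
  have "(\<Union>n::nat. Inl ` cball b (real n)) \<in> null_sets \<mu>"
  proof (rule null_sets_UN)
    fix n :: nat
    show "Inl ` cball b (real n) \<in> null_sets \<mu>"
      using measure_cball_zero closed_sets[OF closedin_Inl[OF compact_cball]]
      by (auto simp: null_sets_def emeasure_eq_measure)
  qed
  moreover have "(\<Union>n::nat. Inl ` cball b (real n)) = range (Inl :: 'a \<Rightarrow> 'a + (nat \<Rightarrow> 'a) set)"
    using real_arch_simple by fastforce
  ultimately have r: "range Inl \<in> null_sets \<mu>" by simp
  have "boundary_part b = space \<mu> - range Inl" by (auto simp: bordification_def boundary_part_def)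
  hence "measure \<mu> (boundary_part b) = 1 - measure \<mu> (range Inl)"
    using prob_compl[of "range Inl"] r by (simp add: null_sets_def)
  thus ?thesis using r by (simp add: measure_eq_0_null_sets)
qed

end

section \<open>Finite orbits on the boundary\<close>

text \<open>The first nonnegative value after a negative one is at most a single step
  \<open>K\<close>. This is used to bring an element to bounded Busemann value by a power of a fixed
  one.\<close>

lemma int_quasi_linear_small_value:
  fixes f :: "int \<Rightarrow> real"
  assumes step: "\<And>n. 1 \<le> f (n + 1) - f n" "\<And>n. f (n + 1) - f n \<le> K"
  shows "\<exists>n. \<bar>f n\<bar> \<le> K"
proof -
  have up: "f (n + int j) \<ge> f n + real j" for n j
  proof (induction j)
    case (Suc j)
    thus ?case using step(1)[of "n + int j"] by (simp add: algebra_simps)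
  qed simp
  define k where "k = nat \<lceil>f 0\<rceil> + 1"
  have "f (- int k) + real k \<le> f 0" using up[of "- int k" k] by simp
  moreover have "f 0 < real k" unfolding k_def by linarith
  ultimately have neg: "f (- int k) < 0" by linarith
  have "\<exists>j. f (- int k + int j) \<ge> 0"
  proof (rule exI[of _ "nat \<lceil>- f (- int k)\<rceil>"])
    show "f (- int k + int (nat \<lceil>- f (- int k)\<rceil>)) \<ge> 0"
      using up[of "- int k" "nat \<lceil>- f (- int k)\<rceil>"] by linarith
  qed
  then obtain j where j: "f (- int k + int j) \<ge> 0" "\<And>i. i < j \<Longrightarrow> \<not> f (- int k + int i) \<ge> 0"
    using exists_least_iff[of "\<lambda>j. f (- int k + int j) \<ge> 0"] by blast
  then obtain i where i: "j = Suc i" using neg by (cases j) auto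
  have "f (- int k + int i) < 0" using j(2)[of i] i by simp
  moreover have "f (- int k + int i + 1) - f (- int k + int i) \<le> K" by (rule step(2))
  moreover have "- int k + int i + 1 = - int k + int j" using i by simp
  ultimately have "\<bar>f (- int k + int j)\<bar> \<le> K" using j(1) by (simp only: abs_of_nonneg)
  thus ?thesis by blast
qed

lemma int_strict_step_inj:
  fixes f :: "int \<Rightarrow> real"
  assumes "\<And>n. 1 \<le> f (n + 1) - f n"
  shows "inj f"
proof -
  have "f n < f (n + 1)" for n using assms[of n] by linarith
  hence step: "f (m + int j) < f (m + int (Suc j))" for m j
    by (metis add.assoc of_nat_Suc add.commute)
  have "f m < f (m + int (Suc j))" for m j
  proof (induction j)
    case 0 show ?case using step[of m 0] by simp
  next
    case (Suc j) thus ?case using step[of m "Suc j"] by (rule less_trans)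
  qed
  hence "f m < f n" if "m < n" for m n
    using that zless_iff_Suc_zadd[of m n] by auto
  thus ?thesis by (intro injI) (metis less_irrefl linorder_neqE)
qed

context hyperbolic_action
begin

text \<open>The Busemann function of a boundary point is, up to bounded errors, a homomorphism on the
  stabiliser. Its coarse fibres are finite: far out towards the fixed point, elements with bounded
  Busemann value displace a point by a bounded amount only.\<close>

lemma virtually_Z_of_finite_orbit:
  assumes \<xi>: "\<xi> \<in> gromov_boundary b" and orb: "finite ((\<lambda>g. gbd g \<xi>) ` carrier \<Gamma>)"
    and inf: "infinite (carrier \<Gamma>)"
  shows "virtually_Z \<Gamma>"
proof -
  define S where "S = {g \<in> carrier \<Gamma>. gbd g \<xi> = \<xi>}"
  have Sc: "g \<in> carrier \<Gamma>" if "g \<in> S" for g using that by (simp add: S_def)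
  have Sinv: "inv g \<in> S" if "g \<in> S" for g
    using that gbd_mult[of "inv g" g \<xi>] by (simp add: S_def gbd_one)
  have Smult: "g \<otimes> h \<in> S" if "g \<in> S" "h \<in> S" for g h
    using that by (simp add: S_def gbd_mult)
  have S1: "\<one> \<in> S" by (simp add: S_def gbd_one)
  have infS: "infinite S"
  proof
    assume fin: "finite S"
    have "finite {g \<in> carrier \<Gamma>. gbd g \<xi> = \<zeta>}" if z: "\<zeta> \<in> (\<lambda>g. gbd g \<xi>) ` carrier \<Gamma>" for \<zeta>
    proof -
      obtain k where k: "k \<in> carrier \<Gamma>" "\<zeta> = gbd k \<xi>" using z by blast
      have "{g \<in> carrier \<Gamma>. gbd g \<xi> = \<zeta>} \<subseteq> (\<lambda>s. k \<otimes> s) ` S"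
      proof
        fix g assume "g \<in> {g \<in> carrier \<Gamma>. gbd g \<xi> = \<zeta>}"
        hence g: "g \<in> carrier \<Gamma>" "gbd g \<xi> = gbd k \<xi>" using k by auto
        hence "gbd (inv k \<otimes> g) \<xi> = \<xi>" using k by (simp add: gbd_mult gbd_one flip: gbd_mult[of "inv k" k])
        hence "inv k \<otimes> g \<in> S" using g k by (simp add: S_def)
        moreover have "g = k \<otimes> (inv k \<otimes> g)" using g k by (simp add: \<Gamma>.m_assoc[symmetric])
        ultimately show "g \<in> (\<lambda>s. k \<otimes> s) ` S" by blast
      qed
      thus ?thesis using fin finite_subset by blast
    qed
    hence "finite (\<Union>\<zeta>\<in>(\<lambda>g. gbd g \<xi>) ` carrier \<Gamma>. {g \<in> carrier \<Gamma>. gbd g \<xi> = \<zeta>})" using orb by blast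
    moreover have "carrier \<Gamma> \<subseteq> (\<Union>\<zeta>\<in>(\<lambda>g. gbd g \<xi>) ` carrier \<Gamma>. {g \<in> carrier \<Gamma>. gbd g \<xi> = \<zeta>})" by auto
    ultimately show False using inf finite_subset by blast
  qed
  obtain u where u: "u \<in> \<xi>" using \<xi> boundary_nonempty by blast
  have nearu: "near R u u" for R using boundary_class[OF \<xi> u u] .
  have nearg: "near R (\<phi> g \<circ> u) u" if "g \<in> S" for g R
  proof -
    have "\<phi> g \<circ> u \<in> \<xi>" using that u unfolding S_def gbd_def by blast
    thus ?thesis using boundary_class[OF \<xi> _ u] by blast
  qed
  define bf where "bf x p = dist x p - dist b p" for x p :: 'a
  have "\<forall>g. \<exists>\<beta> N. \<forall>i\<ge>N. \<bar>bf (\<phi> g b) (u i) - \<beta>\<bar> \<le> 2 * \<delta>"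
  proof
    fix g
    obtain N where N: "\<forall>i\<ge>N. \<forall>j\<ge>N. gp (u i) (u j) > dist b (\<phi> g b) + \<delta>"
      using nearu unfolding near_def by blast
    have "\<forall>i\<ge>N. \<bar>bf (\<phi> g b) (u i) - bf (\<phi> g b) (u N)\<bar> \<le> 2 * \<delta>"
      using N busemann_stable unfolding bf_def by blast
    thus "\<exists>\<beta> N. \<forall>i\<ge>N. \<bar>bf (\<phi> g b) (u i) - \<beta>\<bar> \<le> 2 * \<delta>" by blast
  qed
  \<comment> \<open>The values need not converge along \<open>u\<close>, so \<beta> is a number from
    which they eventually differ by at most 2 \<delta>.\<close>
  then obtain \<beta> where \<beta>: "\<And>g. \<exists>N. \<forall>i\<ge>N. \<bar>bf (\<phi> g b) (u i) - \<beta> g\<bar> \<le> 2 * \<delta>" by metis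
  hence \<beta>ev: "\<forall>\<^sub>F i in sequentially. \<bar>bf (\<phi> g b) (u i) - \<beta> g\<bar> \<le> 2 * \<delta>" for g
    by (simp add: eventually_sequentially)
  have nearev: "\<forall>\<^sub>F i in sequentially. gp (\<phi> g (u i)) (u i) > R" if "g \<in> S" for g R
    using nearg[OF that, of R] unfolding near_def eventually_sequentially by auto
  \<comment> \<open>Four errors of 2 \<delta>: three from replacing Busemann values by \<beta>, one
    from moving \<open>u i\<close> by \<open>inv g\<close>.\<close>
  define B where "B = 8 * \<delta>"
  have quasi: "\<bar>\<beta> (g \<otimes> h) - \<beta> g - \<beta> h\<bar> \<le> B" if gh: "g \<in> S" "h \<in> S" for g h
  proof -
    have "\<forall>\<^sub>F i in sequentially. \<bar>bf (\<phi> g b) (u i) - \<beta> g\<bar> \<le> 2 * \<delta> \<and> \<bar>bf (\<phi> h b) (u i) - \<beta> h\<bar> \<le> 2 * \<delta> \<and>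
      \<bar>bf (\<phi> (g \<otimes> h) b) (u i) - \<beta> (g \<otimes> h)\<bar> \<le> 2 * \<delta> \<and> gp (\<phi> (inv g) (u i)) (u i) > dist b (\<phi> h b) + \<delta>"
      by (intro eventually_conj \<beta>ev nearev Sinv gh)
    then obtain i where i: "\<bar>bf (\<phi> g b) (u i) - \<beta> g\<bar> \<le> 2 * \<delta>" "\<bar>bf (\<phi> h b) (u i) - \<beta> h\<bar> \<le> 2 * \<delta>"
      "\<bar>bf (\<phi> (g \<otimes> h) b) (u i) - \<beta> (g \<otimes> h)\<bar> \<le> 2 * \<delta>" "gp (\<phi> (inv g) (u i)) (u i) > dist b (\<phi> h b) + \<delta>"
      by (auto simp: eventually_sequentially)
    have "\<bar>bf (\<phi> h b) (\<phi> (inv g) (u i)) - bf (\<phi> h b) (u i)\<bar> \<le> 2 * \<delta>"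
      using busemann_stable[OF i(4)] by (simp add: bf_def)
    moreover have "bf (\<phi> (g \<otimes> h) b) (u i) = bf (\<phi> h b) (\<phi> (inv g) (u i)) + bf (\<phi> g b) (u i)"
      using act_dist_shift[of g "\<phi> h b" "u i"] act_dist_shift[of g b "u i"] Sc[OF gh(1)] Sc[OF gh(2)]
      by (simp add: bf_def act_mult)
    ultimately show ?thesis using i(1-3) unfolding B_def by linarith
  qed
  have fib: "finite {g \<in> S. \<bar>\<beta> g\<bar> \<le> C}" for C
  proof (cases "C \<ge> 0")
    case False
    hence "{g \<in> S. \<bar>\<beta> g\<bar> \<le> C} = {}" by auto
    thus ?thesis by (simp only: finite.emptyI)
  next
    case C: True
    show ?thesis
    proof (rule finite_if_finite_subsets_card_bdd[where C="card (gball (C + 8 * \<delta> + 2 * D))", THEN conjunct1])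
      fix J assume J: "J \<subseteq> {g \<in> S. \<bar>\<beta> g\<bar> \<le> C}" "finite J"
      \<comment> \<open>Depth of the point \<open>p\<close> below, beyond the lengths of all
        elements of \<open>J\<close>. The point depends on \<open>J\<close>, the resulting bound on
        the size of \<open>J\<close> does not.\<close>
      define t where "t = Max (insert 0 (len ` J)) + \<delta> + 1"
      have t: "t > len g + \<delta>" if "g \<in> J" for g
      proof -
        have "len g \<le> Max (insert 0 (len ` J))" by (rule Max_ge) (use that J(2) in auto)
        thus ?thesis unfolding t_def by linarith
      qed
      have "Max (insert 0 (len ` J)) \<ge> 0" using J(2) by simp
      hence t0: "t \<ge> 0" using \<delta>_nonneg by (simp add: t_def)
      have "\<forall>\<^sub>F i in sequentially. \<forall>g\<in>J. \<bar>bf (\<phi> g b) (u i) - \<beta> g\<bar> \<le> 2 * \<delta> \<and> gp (\<phi> (inv g) (u i)) (u i) > t \<and> gp (\<phi> g (u i)) (u i) > t"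
        by (intro eventually_ball_finite J ballI eventually_conj \<beta>ev nearev Sinv) (use J in auto)
      moreover have "\<forall>\<^sub>F i in sequentially. gp (\<phi> \<one> (u i)) (u i) > t" by (rule nearev[OF S1])
      ultimately have "\<forall>\<^sub>F i in sequentially. (\<forall>g\<in>J. \<bar>bf (\<phi> g b) (u i) - \<beta> g\<bar> \<le> 2 * \<delta> \<and> gp (\<phi> (inv g) (u i)) (u i) > t \<and> gp (\<phi> g (u i)) (u i) > t) \<and> gp (u i) (u i) > t"
        by eventually_elim simp
      then obtain i where i: "\<And>g. g \<in> J \<Longrightarrow> \<bar>bf (\<phi> g b) (u i) - \<beta> g\<bar> \<le> 2 * \<delta>"
        "\<And>g. g \<in> J \<Longrightarrow> gp (\<phi> (inv g) (u i)) (u i) > t" "\<And>g. g \<in> J \<Longrightarrow> gp (\<phi> g (u i)) (u i) > t"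
        "dist b (u i) > t" by (auto simp: eventually_sequentially gromov_product_self)
      let ?q = "u i"
      obtain p where p: "dist b p = t" "gp p ?q = t" "dist p ?q = dist b ?q - t"
        using geodesic_point_gp[OF t0, of ?q] i(4) by auto
      have "dist p (\<phi> g p) \<le> C + 8 * \<delta>" if g: "g \<in> J" for g
      proof -
        have gS: "g \<in> S" "\<bar>\<beta> g\<bar> \<le> C" using g J by auto
        have gc: "g \<in> carrier \<Gamma>" by (rule Sc[OF gS(1)])
        have bg: "\<bar>bf (\<phi> g b) ?q\<bar> \<le> C + 2 * \<delta>" using i(1)[OF g] gS(2) by linarith
        have lg: "len g + \<delta> < t" by (rule t[OF g])
        have "gp p (\<phi> (inv g) ?q) \<ge> t - \<delta>"
          using hyp[where o'=b and x=p and y="?q" and z="\<phi> (inv g) ?q"] p(2) i(2)[OF g]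
          by (simp add: gromov_product_commute)
        hence "dist p (\<phi> (inv g) ?q) \<le> dist b (\<phi> (inv g) ?q) - t + 2 * \<delta>"
          using dist_eq_gromov_product[of p "\<phi> (inv g) ?q" b] p(1) by linarith
        hence 1: "dist (\<phi> g p) ?q \<le> dist b ?q - t + C + 4 * \<delta>"
          using act_dist_shift[OF gc, of p ?q] act_dist_shift[OF gc, of b ?q] bg by (simp add: bf_def)
        have "gp p ?q > dist b (\<phi> (inv g) b) + \<delta>"
          using lg p(2) len_inv[OF gc] by (simp add: len_def)
        from busemann_stable[OF this]
        have "dist (\<phi> (inv g) b) p \<le> t + dist (\<phi> (inv g) b) ?q - dist b ?q + 2 * \<delta>" using p(1) by linarith
        moreover have "gp (\<phi> g ?q) ?q > dist b (\<phi> g b) + \<delta>"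
          using lg i(3)[OF g] by (simp add: len_def)
        from busemann_stable[OF this]
        have "dist b (\<phi> g ?q) \<le> dist b ?q + C + 4 * \<delta>" using bg gc by (simp add: bf_def)
        moreover have "dist (\<phi> (inv g) b) ?q = dist b (\<phi> g ?q)" "dist (\<phi> (inv g) b) p = dist b (\<phi> g p)"
          using act_dist_shift[of "inv g" b] gc by auto
        ultimately have 2: "dist b (\<phi> g p) \<le> t + C + 6 * \<delta>" by linarith
        \<comment> \<open>By 1 and 2 the image of \<open>p\<close> is hardly farther from
          \<open>b\<close> and from the remote point \<open>?q\<close> than \<open>p\<close> itself,
          so the four-point inequality bounds the displacement.\<close>
        have "dist p (\<phi> g p) + dist b ?q \<le> max (dist p b + dist (\<phi> g p) ?q) (dist p ?q + dist b (\<phi> g p)) + 2 * \<delta>"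
          using four_point[of p "\<phi> g p" b ?q] by simp
        thus ?thesis using 1 2 p \<delta>_nonneg by (simp add: dist_commute max_def split: if_splits)
      qed
      hence "J \<subseteq> {g \<in> carrier \<Gamma>. dist p (\<phi> g p) \<le> C + 8 * \<delta>}" using J Sc by auto
      hence "card J \<le> card {g \<in> carrier \<Gamma>. dist p (\<phi> g p) \<le> C + 8 * \<delta>}"
        by (rule card_mono[OF finite_displacement])
      also have "\<dots> \<le> card (gball (C + 8 * \<delta> + 2 * D))" by (rule card_displacement)
      finally show "card J \<le> card (gball (C + 8 * \<delta> + 2 * D))" .
    qed
  qed
  \<comment> \<open>An element whose value beats the defect \<open>B\<close> by more than 1: left
    multiplication by it shifts \<beta> in one direction by at least 1, so its powers are
    distinct.\<close>
  have "\<not> S \<subseteq> {g \<in> S. \<bar>\<beta> g\<bar> \<le> B + 1}" using fib[of "B + 1"] infS finite_subset by blast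
  then obtain g where g: "g \<in> S" "\<bar>\<beta> g\<bar> > B + 1" by force
  have gc: "g \<in> carrier \<Gamma>" by (rule Sc[OF g(1)])
  define \<sigma> where "\<sigma> = sgn (\<beta> g)"
  have B0: "B \<ge> 0" using \<delta>_nonneg by (simp add: B_def)
  have \<sigma>: "\<sigma> * \<beta> g = \<bar>\<beta> g\<bar>" "\<bar>\<sigma>\<bar> = 1" using g(2) B0 by (auto simp: \<sigma>_def sgn_if)
  have powS: "g [^] n \<in> S" for n :: int
  proof -
    have nat: "g [^] k \<in> S" for k :: nat
      by (induction k) (use S1 Smult g in auto)
    show ?thesis
    proof (cases "n \<ge> 0")
      case True
      then obtain k where "n = int k" using nonneg_int_cases by blast
      thus ?thesis using nat[of k] by (simp add: int_pow_int)
    next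
      case False
      then obtain k where "n = - int k" by (metis int_cases2 of_nat_0_le_iff)
      thus ?thesis using Sinv[OF nat[of k]] gc by (simp add: \<Gamma>.int_pow_neg int_pow_int)
    qed
  qed
  have step: "1 \<le> \<sigma> * \<beta> (g [^] (n + 1) \<otimes> x) - \<sigma> * \<beta> (g [^] n \<otimes> x)"
    "\<sigma> * \<beta> (g [^] (n + 1) \<otimes> x) - \<sigma> * \<beta> (g [^] n \<otimes> x) \<le> \<bar>\<beta> g\<bar> + B" if x: "x \<in> S" for x and n :: int
  proof -
    have "g [^] (n + 1) \<otimes> x = g \<otimes> (g [^] n \<otimes> x)"
    proof -
      have "g [^] (1 + n) = g [^] (1::int) \<otimes> g [^] n" by (rule \<Gamma>.int_pow_mult[OF gc])
      thus ?thesis using gc Sc[OF x] by (simp add: \<Gamma>.m_assoc add.commute \<Gamma>.int_pow_1)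
    qed
    hence "\<bar>\<beta> (g [^] (n + 1) \<otimes> x) - \<beta> g - \<beta> (g [^] n \<otimes> x)\<bar> \<le> B"
      using quasi[OF g(1) Smult[OF powS[of n] x]] by simp
    hence "\<bar>\<sigma> * (\<beta> (g [^] (n + 1) \<otimes> x) - \<beta> g - \<beta> (g [^] n \<otimes> x))\<bar> \<le> B"
      using \<sigma>(2) by (simp add: abs_mult)
    hence "\<bar>\<sigma> * \<beta> (g [^] (n + 1) \<otimes> x) - \<bar>\<beta> g\<bar> - \<sigma> * \<beta> (g [^] n \<otimes> x)\<bar> \<le> B"
      using \<sigma>(1) by (simp add: algebra_simps)
    thus "1 \<le> \<sigma> * \<beta> (g [^] (n + 1) \<otimes> x) - \<sigma> * \<beta> (g [^] n \<otimes> x)"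
      "\<sigma> * \<beta> (g [^] (n + 1) \<otimes> x) - \<sigma> * \<beta> (g [^] n \<otimes> x) \<le> \<bar>\<beta> g\<bar> + B" using g(2) by linarith+
  qed
  define K where "K = range (\<lambda>n::int. g [^] n)"
  have inj: "inj (\<lambda>n::int. g [^] n)"
  proof (rule injI)
    fix m n :: int assume "g [^] m = g [^] n"
    thus "m = n" using injD[OF int_strict_step_inj[of "\<lambda>n. \<sigma> * \<beta> (g [^] n \<otimes> \<one>)"], of m n] step(1)[OF S1] by simp
  qed
  have subK: "subgroup K \<Gamma>"
  proof
    show "K \<subseteq> carrier \<Gamma>" using gc by (auto simp: K_def)
    show "\<one> \<in> K" unfolding K_def by (metis int_pow_0 rangeI)
    show "x \<otimes> y \<in> K" if "x \<in> K" "y \<in> K" for x y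
      using that gc unfolding K_def by (auto simp: \<Gamma>.int_pow_mult[symmetric])
    show "inv x \<in> K" if "x \<in> K" for x
      using that gc unfolding K_def by (auto simp: \<Gamma>.int_pow_neg[symmetric])
  qed
  have "(\<lambda>n::int. g [^] n) \<in> iso integer_group (\<Gamma>\<lparr>carrier := K\<rparr>)"
    unfolding iso_def
    using gc inj by (auto simp: hom_def K_def \<Gamma>.int_pow_mult bij_betw_def)
  hence "integer_group \<cong> \<Gamma>\<lparr>carrier := K\<rparr>" unfolding is_iso_def by blast
  hence isoK: "\<Gamma>\<lparr>carrier := K\<rparr> \<cong> integer_group"
    by (rule group.iso_sym[OF group_integer_group])
  let ?Y = "{y \<in> S. \<bar>\<beta> y\<bar> \<le> \<bar>\<beta> g\<bar> + B}"
  have "\<forall>\<zeta>\<in>(\<lambda>g. gbd g \<xi>) ` carrier \<Gamma>. \<exists>r\<in>carrier \<Gamma>. gbd r \<xi> = \<zeta>" by blast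
  then obtain r where r: "\<And>\<zeta>. \<zeta> \<in> (\<lambda>g. gbd g \<xi>) ` carrier \<Gamma> \<Longrightarrow> r \<zeta> \<in> carrier \<Gamma> \<and> gbd (r \<zeta>) \<xi> = \<zeta>" by metis
  have "rcosets K \<subseteq> (\<lambda>(y, \<zeta>). K #> (y \<otimes> inv (r \<zeta>))) ` (?Y \<times> (\<lambda>g. gbd g \<xi>) ` carrier \<Gamma>)"
  proof
    fix Q assume "Q \<in> rcosets K"
    then obtain a where a: "a \<in> carrier \<Gamma>" "Q = K #> a" unfolding RCOSETS_def by blast
    \<comment> \<open>A representative of this orbit point corrects \<open>a\<close> into the
      stabiliser, and a power of \<open>g\<close> then makes its value bounded. Finitely many such
      elements and finitely many orbit points label all cosets.\<close>
    let ?\<zeta> = "gbd (inv a) \<xi>"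
    have z: "?\<zeta> \<in> (\<lambda>g. gbd g \<xi>) ` carrier \<Gamma>" using a by auto
    let ?x = "a \<otimes> r ?\<zeta>"
    have "gbd ?x \<xi> = gbd a (gbd (inv a) \<xi>)" using a r[OF z] by (simp add: gbd_mult)
    also have "\<dots> = \<xi>" using a gbd_mult[of a "inv a" \<xi>] by (simp add: gbd_one)
    finally have x: "?x \<in> S" using a r[OF z] by (simp add: S_def)
    obtain n :: int where n: "\<bar>\<sigma> * \<beta> (g [^] n \<otimes> ?x)\<bar> \<le> \<bar>\<beta> g\<bar> + B"
      using int_quasi_linear_small_value[of "\<lambda>n. \<sigma> * \<beta> (g [^] n \<otimes> ?x)" "\<bar>\<beta> g\<bar> + B"] step[OF x] by blast
    let ?y = "g [^] n \<otimes> ?x"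
    have y: "?y \<in> ?Y" using n \<sigma>(2) Smult[OF powS x] by (simp add: abs_mult)
    have "?y \<otimes> inv (r ?\<zeta>) = g [^] n \<otimes> a" using a r[OF z] gc by (simp add: \<Gamma>.m_assoc)
    hence "K #> (?y \<otimes> inv (r ?\<zeta>)) = K #> (g [^] n) #> a"
      using a gc subgroup.subset[OF subK] by (simp add: \<Gamma>.coset_mult_assoc)
    also have "K #> (g [^] n) = K" using subK by (intro \<Gamma>.coset_join2) (use gc in \<open>auto simp: K_def\<close>)
    finally show "Q \<in> (\<lambda>(y, \<zeta>). K #> (y \<otimes> inv (r \<zeta>))) ` (?Y \<times> (\<lambda>g. gbd g \<xi>) ` carrier \<Gamma>)"
      using a(2) y z by force
  qed
  hence "finite (rcosets K)" using fib orb by (meson finite_SigmaI finite_imageI finite_subset)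
  thus ?thesis using subK isoK unfolding virtually_Z_def by blast
qed

end

section \<open>The shadow lemma\<close>

lemma exp_minus_mult_le_iff: "exp (- w * a) * m \<le> M \<longleftrightarrow> m \<le> exp (w * a) * (M :: real)"
  by (simp add: exp_minus field_simps)

context hyperbolic
begin

text \<open>Roughly the points whose geodesics from \<open>b\<close> pass within \<open>r\<close> of
  \<open>x\<close>. The interior is taken so that quasi-conformality and tails of sequences
  apply.\<close>

definition shadow :: "real \<Rightarrow> 'a \<Rightarrow> ('a + (nat \<Rightarrow> 'a) set) set" where
  "shadow r x = T interior_of hood (dist b x - r) (Inl x)"

lemma openin_shadow [simp]: "openin T (shadow r x)"
  by (simp add: shadow_def)

lemma shadow_ext: "p \<in> shadow r x \<Longrightarrow> ext p (Inl x) > ereal (dist b x - r)"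
  using interior_of_subset[of T "hood (dist b x - r) (Inl x)"] by (auto simp: shadow_def hood_def)

lemma shadow_gp: "Inl y \<in> shadow r x \<Longrightarrow> gp y x > dist b x - r"
  using shadow_ext ext_Inl_Inl by blast

lemma shadow_bord: "p \<in> shadow r x \<Longrightarrow> p \<in> bordification b"
  using interior_of_subset[of T "hood (dist b x - r) (Inl x)"] by (auto simp: shadow_def hood_def)

lemma shadowI:
  assumes "p \<in> bordification b" "ext p (Inl x) > ereal (dist b x - r + cc + 1)"
  shows "p \<in> shadow r x"
  using hood_interior[of "Inl x" "dist b x - r" "hood (dist b x - r) (Inl x)"] assms
  by (auto simp: shadow_def hood_def)

lemma boundary_in_shadowI:
  assumes "\<xi> \<in> gromov_boundary b" "v \<in> \<xi>" "\<exists>\<^sub>F i in sequentially. gp (v i) x \<ge> dist b x - C"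
    and "0 \<le> C" "r \<ge> C + \<delta> + cc + 3"
  shows "Inr \<xi> \<in> shadow r x"
proof -
  obtain N where N: "\<forall>i\<ge>N. \<forall>j\<ge>N. gp (v i) (v j) > dist b x"
    using boundary_class[OF assms(1,2,2), of "dist b x"] unfolding near_def by blast
  obtain i where i: "i \<ge> N" "gp (v i) x \<ge> dist b x - C"
    using assms(3) unfolding frequently_sequentially by blast
  have "gp x (v j) > dist b x - C - \<delta> - 1" if "j \<ge> N" for j
  proof -
    have "gp (v i) (v j) > dist b x" using N i that by blast
    thus ?thesis using hyp[where o'=b and x=x and y="v i" and z="v j"] i(2) assms(4)
      by (simp add: gromov_product_commute)
  qed
  hence "near (dist b x - C - \<delta> - 1) (\<lambda>_. x) v" unfolding near_const by blast
  from extI[OF const_seq _ this, of "Inr \<xi>" "dist b x - r + cc + 1"]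
  have "ext (Inl x) (Inr \<xi>) > ereal (dist b x - r + cc + 1)" using assms by simp
  thus ?thesis using assms(1) by (intro shadowI) (simp_all add: ext_sym)
qed

text \<open>An open set containing a boundary point contains points of X, so the common point may be
  taken in X, where \<open>shadow_gp\<close> gives honest products.\<close>

lemma shadow_overlap:
  assumes "p \<in> shadow r x" "p \<in> shadow r y"
  shows "dist x y \<le> \<bar>dist b x - dist b y\<bar> + 2 * r + 2 * \<delta>"
proof -
  obtain z where z: "Inl z \<in> shadow r x" "Inl z \<in> shadow r y"
  proof (cases p)
    case (Inl z) thus ?thesis using that assms by blast
  next
    case (Inr \<xi>)
    have "openin T (shadow r x \<inter> shadow r y)" by (simp add: openin_Int)
    moreover obtain u where "u \<in> \<xi>" using boundary_nonempty[of \<xi>] shadow_bord[OF assms(1)] Inr by auto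
    ultimately have "\<forall>\<^sub>F i in sequentially. Inl (u i) \<in> shadow r x \<inter> shadow r y"
      using boundary_eventually_open[of "shadow r x \<inter> shadow r y" \<xi> u] assms Inr by simp
    thus ?thesis using that by (auto simp: eventually_sequentially)
  qed
  have "gp x y \<ge> min (dist b x - r) (dist b y - r) - \<delta>"
    using hyp[where o'=b and x=x and y=z and z=y] shadow_gp[OF z(1)] shadow_gp[OF z(2)]
    by (simp add: gromov_product_commute)
  thus ?thesis using dist_eq_gromov_product[of x y b] by (simp add: min_def split: if_splits)
qed

lemma shadow_busemann: "Inl y \<in> shadow r x \<Longrightarrow> dist x y - dist b y \<le> 2 * r - dist b x"
  using shadow_gp[of y r x] dist_eq_gromov_product[of y x b] by (simp add: dist_commute)

end

context hyperbolic_action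
begin

text \<open>The orbit point lies near the point at distance \<open>n\<close> on a geodesic towards a
  late term. The threshold is that of \<open>boundary_in_shadowI\<close> for C = 2 D + \<delta>: D
  for the length, D for the product, \<delta> for passing to later terms.\<close>

lemma shadow_cover:
  assumes "\<xi> \<in> gromov_boundary b" "n \<ge> 0" "r \<ge> 2 * D + 2 * \<delta> + cc + 3"
  shows "\<exists>g\<in>carrier \<Gamma>. \<bar>len g - n\<bar> \<le> D \<and> Inr \<xi> \<in> shadow r (\<phi> g b)"
proof -
  obtain u where u: "u \<in> \<xi>" using assms boundary_nonempty by blast
  obtain N where N: "\<forall>i\<ge>N. \<forall>j\<ge>N. gp (u i) (u j) > n"
    using boundary_class[OF assms(1) u u, of n] unfolding near_def by blast
  have "dist b (u N) > n" using N gromov_product_self[of b "u N"] by force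
  then obtain z where z: "dist b z = n" "gp z (u N) = n"
    using geodesic_point_gp[of n "u N"] assms(2) by (metis less_imp_le)
  obtain g where g: "g \<in> carrier \<Gamma>" "dist z (\<phi> g b) \<le> D" using D(2) by blast
  have lg: "\<bar>len g - n\<bar> \<le> D"
    using g z(1) dist_triangle[of b "\<phi> g b" z] dist_triangle[of b z "\<phi> g b"]
    by (simp add: len_def dist_commute abs_le_iff)
  have "gp (\<phi> g b) (u N) \<ge> n - D"
    using gromov_product_diff_le[of b z "u N" "\<phi> g b"] z(2) g(2) by linarith
  hence "gp (u j) (\<phi> g b) \<ge> len g - (2 * D + \<delta>)" if "j \<ge> N" for j
  proof -
    have "gp (u N) (u j) > n" using N that by blast
    thus ?thesis using hyp[where o'=b and x="\<phi> g b" and y="u N" and z="u j"] lg \<open>gp (\<phi> g b) (u N) \<ge> n - D\<close> D(1)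
      by (simp add: gromov_product_commute min_def split: if_splits)
  qed
  hence "\<forall>\<^sub>F i in sequentially. gp (u i) (\<phi> g b) \<ge> dist b (\<phi> g b) - (2 * D + \<delta>)"
    by (auto simp: eventually_sequentially len_def)
  hence "\<exists>\<^sub>F i in sequentially. gp (u i) (\<phi> g b) \<ge> dist b (\<phi> g b) - (2 * D + \<delta>)"
    by (intro eventually_frequently) auto
  from boundary_in_shadowI[OF assms(1) u this] show ?thesis
    using assms(3) D(1) \<delta>_nonneg g(1) lg by auto
qed

end

context patterson_nonelementary
begin

lemma shadow_sets [simp]: "shadow r x \<in> sets \<mu>"
  by (rule open_sets[OF openin_shadow])

lemma infinite_boundary_orbit:
  "\<xi> \<in> gromov_boundary b \<Longrightarrow> infinite ((\<lambda>g. gbd g \<xi>) ` carrier \<Gamma>)"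
  using virtually_Z_of_finite_orbit infinite_carrier nonelementary
  unfolding elementary_group_def by blast

text \<open>Otherwise a cluster point of witnesses \<open>y\<^sub>k\<close> for larger and larger finite sets \<open>F\<close> would be a
  global fixed point on the boundary.\<close>

lemma extension_lemma:
  obtains F C where "finite F" "F \<subseteq> carrier \<Gamma>" "C \<ge> 0" "\<And>y z. \<exists>f\<in>F. gp (\<phi> f z) y \<le> C"
proof (rule ccontr)
  assume no: "\<not> thesis"
  have "\<forall>k::nat. \<exists>y z. \<forall>f\<in>gball (real k). gp (\<phi> f z) y > real k"
  proof (rule ccontr)
    assume "\<not> ?thesis"
    then obtain k :: nat where k: "\<And>y z. \<exists>f\<in>gball (real k). gp (\<phi> f z) y \<le> real k"
      by (meson not_less)
    have "gball (real k) \<subseteq> carrier \<Gamma>" by (auto simp: gball_def)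
    from that[OF finite_gball this _ k] show False using no by simp
  qed
  then obtain y z where yz: "\<And>(k::nat) f. f \<in> gball (real k) \<Longrightarrow> gp (\<phi> f (z k)) (y k) > real k" by metis
  have yk: "gp (z k) (y k) > real k" for k using yz[of \<one> k] by (simp add: gball_def)
  obtain p where p: "p \<in> bordification b" "\<And>U. openin T U \<Longrightarrow> p \<in> U \<Longrightarrow> \<exists>\<^sub>F k in sequentially. Inl (y k) \<in> U"
    using cluster_point[of "\<lambda>k. Inl (y k)"] by auto
  show False
  proof (cases p)
    \<comment> \<open>The norm of \<open>y k\<close> exceeds \<open>k\<close>, so there is no
      accumulation in X.\<close>
    case (Inl x)
    have "\<exists>\<^sub>F k in sequentially. y k \<in> ball x 1"
      using p(2)[of "Inl ` ball x 1"] Inl by (simp add: image_iff)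
    then obtain k where k: "k \<ge> nat \<lceil>dist b x + 1\<rceil>" "y k \<in> ball x 1"
      unfolding frequently_sequentially by blast
    have "dist b (y k) > real k" using yk[of k] gromov_product_le'[of b "z k" "y k"] by linarith
    thus False using k dist_triangle[of b "y k" x] by simp linarith
  next
    case (Inr \<eta>)
    hence \<eta>: "\<eta> \<in> gromov_boundary b" using p(1) by simp
    have "gbd g \<eta> = \<eta>" if g: "g \<in> carrier \<Gamma>" for g
    proof (rule ext_infinite_eq[OF gbd_boundary[OF g \<eta>] \<eta>])
      fix R :: real
      \<comment> \<open>Two uses of \<open>ext_trans\<close> cost 2 \<open>cc\<close>; the larger
        threshold \<open>?R\<close> also covers the loss in \<open>ext_gact\<close>.\<close>
      let ?Q = "R + 2 * cc"
      let ?R = "?Q + len g + 1"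
      have "p \<in> T interior_of hood ?R p"
        using hood_interior[of p ?R "hood ?R p"] self_hood[OF \<eta>] Inr p(1) by auto
      hence "\<exists>\<^sub>F k in sequentially. Inl (y k) \<in> T interior_of hood ?R p" by (intro p(2)) simp
      then obtain k where k: "k \<ge> nat \<lceil>?Q + len g + \<delta> + 1\<rceil> + nat \<lceil>len g\<rceil>" "Inl (y k) \<in> T interior_of hood ?R p"
        unfolding frequently_sequentially by blast
      have kk: "real k \<ge> ?Q + len g + \<delta> + 1" "real k \<ge> len g" using k(1) by linarith+
      have "Inl (y k) \<in> hood ?R p" using subsetD[OF interior_of_subset k(2)] .
      hence e1: "ext (Inl (y k)) (Inr \<eta>) > ereal ?R" using Inr by (simp add: hood_def)
      have e2: "ext (Inr (gbd g \<eta>)) (Inl (\<phi> g (y k))) > ereal ?Q"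
        using ext_gact[OF g e1] by (simp add: ext_sym)
      \<comment> \<open>The translate of \<open>z k\<close> is the link: it is close to
        \<open>y k\<close> by the choice of witnesses for \<open>g\<close>, and close to the
        translate of \<open>y k\<close> by their choice for the identity.\<close>
      have "gp (\<phi> g (z k)) (y k) > real k" using g kk(2) by (intro yz) (simp add: gball_def)
      moreover have "gp (\<phi> g (y k)) (\<phi> g (z k)) > real k - len g"
        using gp_act_ge[OF g, of "z k" "y k"] yk[of k] by (simp add: gromov_product_commute)
      ultimately have "gp (\<phi> g (y k)) (y k) > real k - len g - \<delta>"
        using hyp[where o'=b and x="\<phi> g (y k)" and y="\<phi> g (z k)" and z="y k"] len_nonneg[of g] by linarith
      hence e3: "ext (Inl (\<phi> g (y k))) (Inl (y k)) > ereal ?Q"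
        using kk(1) by (intro ext_Inl_InlI) linarith
      have e4: "ext (Inl (\<phi> g (y k))) (Inr \<eta>) > ereal (?Q - cc)"
      proof (rule ext_trans[OF e3])
        show "ext (Inl (y k)) (Inr \<eta>) > ereal ?Q" by (rule le_less_trans[OF _ e1]) simp
      qed (use \<eta> in auto)
      have cc0: "cc \<ge> 0" using \<delta>_nonneg by (simp add: cc_def)
      have "ext (Inr (gbd g \<eta>)) (Inl (\<phi> g (y k))) > ereal (?Q - cc)"
        by (rule le_less_trans[OF _ e2]) (use cc0 in simp)
      from ext_trans[OF this e4] show "ext (Inr (gbd g \<eta>)) (Inr \<eta>) > ereal R"
        using gbd_boundary[OF g \<eta>] \<eta> by simp
    qed
    hence "(\<lambda>g. gbd g \<eta>) ` carrier \<Gamma> \<subseteq> {\<eta>}" by auto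
    thus False using infinite_boundary_orbit[OF \<eta>] finite_subset by blast
  qed
qed

text \<open>On the shadow the difference of distances is at most \<open>2 * r - len g\<close>, and
  its image under \<open>inv g\<close> has mass at most 1.\<close>

lemma shadow_upper:
  assumes "g \<in> carrier \<Gamma>"
  shows "measure \<mu> (shadow r (\<phi> g b)) \<le> exp (2 * \<omega> * r) * exp (- \<omega> * len g)"
proof -
  let ?S = "shadow r (\<phi> g b)"
  have "exp (- \<omega> * (2 * r - len g)) * measure \<mu> ?S \<le> measure \<mu> (gact (inv g) ` ?S)"
  proof (rule quasiconformal_ge[OF assms openin_shadow])
    show "dist (\<phi> g b) x - dist b x \<le> 2 * r - len g" if "Inl x \<in> ?S" for x
      using shadow_busemann[OF that] by (simp add: len_def)
  qed simp_all
  also have "\<dots> \<le> 1" by (rule prob_le_1)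
  finally have "measure \<mu> ?S \<le> exp (\<omega> * (2 * r - len g))"
    unfolding exp_minus_mult_le_iff by simp
  also have "\<dots> = exp (2 * \<omega> * r) * exp (- \<omega> * len g)"
    unfolding exp_add[symmetric] by (rule arg_cong[of _ _ exp]) (simp add: algebra_simps)
  finally show ?thesis .
qed

lemma measure_gact_le:
  assumes "g \<in> carrier \<Gamma>" "A \<in> sets \<mu>"
  shows "measure \<mu> (gact (inv g) ` A) \<le> exp (\<omega> * len g) * measure \<mu> A"
proof -
  have "measure \<mu> (gact (inv g) ` A) \<le> exp (- \<omega> * (- len g)) * measure \<mu> A"
  proof (rule quasiconformal_le[OF assms(1), of "bordification b"])
    show "openin T (bordification b)" using openin_topspace[of T] by simp
    show "- len g \<le> dist (\<phi> g b) x - dist b x" for x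
      using dist_triangle[of b x "\<phi> g b"] by (simp add: len_def)
    show "A \<subseteq> bordification b" using sets.sets_into_space[OF assms(2)] by simp
  qed fact
  thus ?thesis by simp
qed

text \<open>Pulled back by \<open>inv g\<close>, the shadow contains all boundary points having
  bounded product with the image of \<open>b\<close> under \<open>inv g\<close>. By
  \<open>extension_lemma\<close> some \<open>f\<close> in a fixed finite set moves any boundary
  point there, so boundedly many translates of the pulled back shadow cover the boundary and its
  mass is bounded below.\<close>

lemma shadow_lower:
  obtains r0 c where "c > 0" "\<And>r g. r \<ge> r0 \<Longrightarrow> g \<in> carrier \<Gamma> \<Longrightarrow>
    measure \<mu> (shadow r (\<phi> g b)) \<ge> c * exp (- \<omega> * len g)"
proof -
  obtain F C where F: "finite F" "F \<subseteq> carrier \<Gamma>" "C \<ge> 0" "\<And>y z. \<exists>f\<in>F. gp (\<phi> f z) y \<le> C"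
    using extension_lemma by blast
  have Fne: "F \<noteq> {}" using F(4)[of b b] by blast
  let ?s = "\<Sum>f\<in>F. exp (\<omega> * len f)"
  have spos: "?s > 0" using F(1) Fne by (intro sum_pos) auto
  show thesis
  proof (rule that)
    show "1 / ?s > 0" using spos by simp
    fix r g assume r: "r \<ge> C + \<delta> + cc + 3" and g: "g \<in> carrier \<Gamma>"
    let ?S = "shadow r (\<phi> g b)" and ?S' = "gact (inv g) ` shadow r (\<phi> g b)"
    have Sm: "?S \<in> sets \<mu>" "?S' \<in> sets \<mu>" using gact_sets[of "inv g" ?S] g by simp_all
    have "boundary_part b \<subseteq> (\<Union>f\<in>F. gact (inv f) ` ?S')"
    proof
      fix p assume "p \<in> boundary_part b"
      then obtain \<xi> where \<xi>: "p = Inr \<xi>" "\<xi> \<in> gromov_boundary b" by (auto simp: boundary_part_iff)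
      obtain u where u: "u \<in> \<xi>" using \<xi> boundary_nonempty by blast
      have "\<exists>f\<in>F. \<exists>\<^sub>F i in sequentially. gp (\<phi> f (u i)) (\<phi> (inv g) b) \<le> C"
      proof (rule ccontr)
        assume "\<not> ?thesis"
        hence "\<forall>\<^sub>F i in sequentially. \<forall>f\<in>F. \<not> gp (\<phi> f (u i)) (\<phi> (inv g) b) \<le> C"
          using F(1) by (intro eventually_ball_finite) (auto simp: not_frequently)
        then obtain i where "\<forall>f\<in>F. \<not> gp (\<phi> f (u i)) (\<phi> (inv g) b) \<le> C" by (auto simp: eventually_sequentially)
        thus False using F(4) by blast
      qed
      then obtain f where f: "f \<in> F" "\<exists>\<^sub>F i in sequentially. gp (\<phi> f (u i)) (\<phi> (inv g) b) \<le> C" by blast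
      have fc: "f \<in> carrier \<Gamma>" using f F by blast
      let ?v = "\<phi> (g \<otimes> f) \<circ> u"
      \<comment> \<open>\<open>gromov_product_complement\<close> after translation by
        \<open>g\<close>: a bounded product at the other end of the side becomes a product within
        \<open>C\<close> of its full length.\<close>
      have e: "gp (?v i) (\<phi> g b) = dist b (\<phi> g b) - gp (\<phi> f (u i)) (\<phi> (inv g) b)" for i
        using gp_act[OF g, of "\<phi> f (u i)" b] gromov_product_complement[of b "\<phi> (inv g) b" "\<phi> f (u i)"]
          len_inv[OF g] g fc by (simp add: len_def act_mult gromov_product_commute)
      have "Inr (gbd (g \<otimes> f) \<xi>) \<in> ?S"
      proof (rule boundary_in_shadowI[OF gbd_boundary[OF _ \<xi>(2)] _ _ F(3) r])
        show "g \<otimes> f \<in> carrier \<Gamma>" using g fc by simp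
        show "?v \<in> gbd (g \<otimes> f) \<xi>" using u by (auto simp: gbd_def)
        show "\<exists>\<^sub>F i in sequentially. dist b (\<phi> g b) - C \<le> gp (?v i) (\<phi> g b)"
          using f(2) unfolding e by (auto elim: frequently_elim1)
      qed
      hence "gact g (gact f p) \<in> ?S" using g fc \<xi>(1) by (simp add: gbd_mult)
      moreover have "p = gact (inv f) (gact (inv g) (gact g (gact f p)))" using g fc by simp
      ultimately show "p \<in> (\<Union>f\<in>F. gact (inv f) ` ?S')" using f(1) by blast
    qed
    moreover have gSm: "gact (inv f) ` ?S' \<in> sets \<mu>" if "f \<in> F" for f
      using that F(2) by (intro gact_sets[OF _ Sm(2)]) auto
    ultimately have "measure \<mu> (boundary_part b) \<le> measure \<mu> (\<Union>f\<in>F. gact (inv f) ` ?S')"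
      using F(1) by (intro finite_measure_mono sets.finite_UN) auto
    also have "\<dots> \<le> (\<Sum>f\<in>F. measure \<mu> (gact (inv f) ` ?S'))"
      using F(1) gSm by (intro finite_measure_subadditive_finite) auto
    also have "\<dots> \<le> (\<Sum>f\<in>F. exp (\<omega> * len f) * measure \<mu> ?S')"
      by (intro sum_mono measure_gact_le Sm) (use F in auto)
    also have "\<dots> = ?s * measure \<mu> ?S'" by (simp add: sum_distrib_right)
    also have "\<dots> \<le> ?s * (exp (\<omega> * len g) * measure \<mu> ?S)"
      by (intro mult_left_mono measure_gact_le g Sm) (use spos in simp)
    finally have "1 \<le> ?s * (exp (\<omega> * len g) * measure \<mu> ?S)" by (simp add: measure_boundary)
    hence "1 / ?s \<le> exp (\<omega> * len g) * measure \<mu> ?S" using spos by (simp add: field_simps)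
    hence "1 / ?s * exp (- \<omega> * len g) \<le> exp (\<omega> * len g) * measure \<mu> ?S * exp (- \<omega> * len g)"
      by (rule mult_right_mono) simp
    also have "\<dots> = measure \<mu> ?S" by (simp add: mult.commute[of _ "measure \<mu> ?S"] mult.assoc exp_add[symmetric])
    finally show "1 / ?s * exp (- \<omega> * len g) \<le> measure \<mu> ?S" .
  qed
qed

text \<open>One radius for which both the covering property and the lower mass bound hold.\<close>

definition \<rho> :: real where
  "\<rho> = (SOME r. r \<ge> 2 * D + 2 * \<delta> + cc + 3 \<and>
     (\<exists>c>0. \<forall>g\<in>carrier \<Gamma>. measure \<mu> (shadow r (\<phi> g b)) \<ge> c * exp (- \<omega> * len g)))"

abbreviation Sh :: "'a \<Rightarrow> ('a + (nat \<Rightarrow> 'a) set) set" where "Sh \<equiv> shadow \<rho>"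

lemma \<rho>: "\<rho> \<ge> 2 * D + 2 * \<delta> + cc + 3"
  and Sh_lower: "\<exists>c>0. \<forall>g\<in>carrier \<Gamma>. measure \<mu> (Sh (\<phi> g b)) \<ge> c * exp (- \<omega> * len g)"
proof -
  obtain r0 c where c: "c > 0" "\<And>r g. r \<ge> r0 \<Longrightarrow> g \<in> carrier \<Gamma> \<Longrightarrow>
    measure \<mu> (shadow r (\<phi> g b)) \<ge> c * exp (- \<omega> * len g)" by (rule shadow_lower) (rule that, auto)
  have "\<exists>r. r \<ge> 2 * D + 2 * \<delta> + cc + 3 \<and>
     (\<exists>c>0. \<forall>g\<in>carrier \<Gamma>. measure \<mu> (shadow r (\<phi> g b)) \<ge> c * exp (- \<omega> * len g))"
    by (rule exI[of _ "max r0 (2 * D + 2 * \<delta> + cc + 3)"]) (use c in auto)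
  from someI_ex[OF this] show "\<rho> \<ge> 2 * D + 2 * \<delta> + cc + 3"
    "\<exists>c>0. \<forall>g\<in>carrier \<Gamma>. measure \<mu> (Sh (\<phi> g b)) \<ge> c * exp (- \<omega> * len g)"
    unfolding \<rho>_def by auto
qed

lemma \<rho>_nonneg: "\<rho> \<ge> 0" using \<rho> D(1) \<delta>_nonneg by (simp add: cc_def)

definition c\<^sub>0 :: real where
  "c\<^sub>0 = (SOME c. c > 0 \<and> (\<forall>g\<in>carrier \<Gamma>. measure \<mu> (Sh (\<phi> g b)) \<ge> c * exp (- \<omega> * len g)))"

lemma c\<^sub>0: "c\<^sub>0 > 0" "g \<in> carrier \<Gamma> \<Longrightarrow> measure \<mu> (Sh (\<phi> g b)) \<ge> c\<^sub>0 * exp (- \<omega> * len g)"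
  using someI_ex[OF Sh_lower] unfolding c\<^sub>0_def[symmetric] by auto

lemma Sh_cover:
  "\<xi> \<in> gromov_boundary b \<Longrightarrow> n \<ge> 0 \<Longrightarrow> \<exists>g\<in>carrier \<Gamma>. \<bar>len g - n\<bar> \<le> D \<and> Inr \<xi> \<in> Sh (\<phi> g b)"
  using shadow_cover \<rho> by blast

text \<open>Elements of the annulus whose shadows share a point differ by a group element of bounded
  length, by \<open>shadow_overlap\<close>. So the multiplicity is bounded, and the counting
  function is integrated.\<close>

lemma sum_shadows_le:
  assumes G: "finite G" "G \<subseteq> carrier \<Gamma>" and l: "\<And>g. g \<in> G \<Longrightarrow> m \<le> len g \<and> len g \<le> m + w"
  shows "(\<Sum>g\<in>G. measure \<mu> (Sh (\<phi> g b)))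
     \<le> real (card (gball (w + 2 * \<rho> + 2 * \<delta>))) * measure \<mu> (\<Union>g\<in>G. Sh (\<phi> g b))"
proof -
  let ?k = "card (gball (w + 2 * \<rho> + 2 * \<delta>))"
  let ?U = "\<Union>g\<in>G. Sh (\<phi> g b)"
  have Sm: "Sh (\<phi> g b) \<in> sets \<mu>" for g by simp
  have Um: "?U \<in> sets \<mu>" using G Sm by auto
  have mult: "card {g\<in>G. p \<in> Sh (\<phi> g b)} \<le> ?k" for p
  proof (cases "{g\<in>G. p \<in> Sh (\<phi> g b)} = {}")
    case False
    then obtain g where g: "g \<in> G" "p \<in> Sh (\<phi> g b)" by blast
    have gc: "g \<in> carrier \<Gamma>" using g G by blast
    have "(\<lambda>h. inv g \<otimes> h) ` {h\<in>G. p \<in> Sh (\<phi> h b)} \<subseteq> gball (w + 2 * \<rho> + 2 * \<delta>)"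
    proof (rule image_subsetI)
      fix h assume "h \<in> {h\<in>G. p \<in> Sh (\<phi> h b)}"
      hence h: "h \<in> G" "p \<in> Sh (\<phi> h b)" "h \<in> carrier \<Gamma>" using G by auto
      have "len (inv g \<otimes> h) = dist (\<phi> g b) (\<phi> h b)"
        using gc h act_dist_shift[of g b "\<phi> h b"] by (simp add: len_def act_mult)
      also have "\<dots> \<le> \<bar>len g - len h\<bar> + 2 * \<rho> + 2 * \<delta>"
        using shadow_overlap[OF g(2) h(2)] by (simp add: len_def)
      also have "\<dots> \<le> w + 2 * \<rho> + 2 * \<delta>" using l[OF g(1)] l[OF h(1)] by linarith
      finally show "inv g \<otimes> h \<in> gball (w + 2 * \<rho> + 2 * \<delta>)" using gc h by (simp add: gball_def)
    qed
    moreover have "inj_on (\<lambda>h. inv g \<otimes> h) {h\<in>G. p \<in> Sh (\<phi> h b)}"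
      
    proof (rule inj_onI)
      fix x y assume xy: "x \<in> {h\<in>G. p \<in> Sh (\<phi> h b)}" "y \<in> {h\<in>G. p \<in> Sh (\<phi> h b)}"
        "inv g \<otimes> x = inv g \<otimes> y"
      hence "x \<in> carrier \<Gamma>" "y \<in> carrier \<Gamma>" using G by auto
      thus "x = y" using xy(3) gc by simp
    qed
    ultimately show ?thesis by (intro card_inj_on_le[where B="gball (w + 2 * \<rho> + 2 * \<delta>)"]) auto
  next
    case True
    have "card {g\<in>G. p \<in> Sh (\<phi> g b)} = 0" unfolding True by simp
    thus ?thesis by linarith
  qed
  have "(\<Sum>g\<in>G. measure \<mu> (Sh (\<phi> g b))) = (\<Sum>g\<in>G. \<integral>p. indicator (Sh (\<phi> g b)) p \<partial>\<mu>)"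
    using Sm sets.sets_into_space[OF Sm] by (intro sum.cong) (auto simp: Int_absorb2)
  also have "\<dots> = (\<integral>p. (\<Sum>g\<in>G. indicator (Sh (\<phi> g b)) p) \<partial>\<mu>)"
    using Sm by (intro Bochner_Integration.integral_sum[symmetric]) (simp add: less_top[symmetric])
  also have "\<dots> \<le> (\<integral>p. real ?k * indicator ?U p \<partial>\<mu>)"
  proof (rule integral_mono)
    show "integrable \<mu> (\<lambda>p. \<Sum>g\<in>G. indicator (Sh (\<phi> g b)) p :: real)"
      using Sm by (intro Bochner_Integration.integrable_sum) (simp add: less_top[symmetric])
    show "integrable \<mu> (\<lambda>p. real ?k * indicator ?U p)"
      using Um by (intro integrable_mult_right) (simp add: less_top[symmetric])
    fix p
    have "(\<Sum>g\<in>G. indicator (Sh (\<phi> g b)) p :: real) = real (card {g\<in>G. p \<in> Sh (\<phi> g b)})"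
      using G(1) by (simp add: indicator_def sum.If_cases Int_def)
    also have "\<dots> \<le> real ?k * indicator ?U p"
    proof (cases "p \<in> ?U")
      case True thus ?thesis using mult[of p] by simp
    next
      case False
      hence "{g\<in>G. p \<in> Sh (\<phi> g b)} = {}" by auto
      thus ?thesis by (simp only: card.empty) simp
    qed
    finally show "(\<Sum>g\<in>G. indicator (Sh (\<phi> g b)) p :: real) \<le> real ?k * indicator ?U p" .
  qed
  also have "\<dots> = real ?k * measure \<mu> ?U"
    using Um sets.sets_into_space[OF Um] by (simp add: Int_absorb2)
  finally show ?thesis .
qed

lemma boundary_ne: "gromov_boundary b \<noteq> {}"
proof
  assume "gromov_boundary b = {}"
  hence "boundary_part b = {}" by (simp add: boundary_part_def)
  thus False using measure_boundary by simp
qed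

text \<open>If \<open>\<omega> = 0\<close>, all shadows have mass at least \<open>c\<^sub>0\<close>; as distinct boundary points have disjoint
  small shadows, the boundary would be finite.\<close>

lemma \<omega>_pos: "\<omega> > 0"
proof (rule ccontr)
  assume "\<not> \<omega> > 0"
  hence w0: "\<omega> = 0" using \<omega>_nonneg by simp
  have low: "c\<^sub>0 \<le> measure \<mu> (Sh (\<phi> g b))" if "g \<in> carrier \<Gamma>" for g using c\<^sub>0(2)[OF that] w0 by simp
  have "finite (gromov_boundary b)"
  proof (rule finite_if_finite_subsets_card_bdd[where C="nat \<lfloor>1 / c\<^sub>0\<rfloor>", THEN conjunct1])
    fix X assume X: "X \<subseteq> gromov_boundary b" "finite X"
    have "\<forall>\<xi>\<in>X. \<forall>\<eta>\<in>X. \<exists>R::real. \<xi> \<noteq> \<eta> \<longrightarrow> \<not> ext (Inr \<xi>) (Inr \<eta>) > ereal R"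
      using X ext_infinite_eq by blast
    then obtain R where R: "\<And>\<xi> \<eta>. \<xi> \<in> X \<Longrightarrow> \<eta> \<in> X \<Longrightarrow> \<xi> \<noteq> \<eta> \<Longrightarrow> \<not> ext (Inr \<xi>) (Inr \<eta>) > ereal (R \<xi> \<eta>)" by metis
    \<comment> \<open>\<open>D\<close> and \<rho> are the tolerances of the cover and of the
      shadows; the multiples of \<open>cc\<close> pay for joining two boundary points through a
      common point of their shadows.\<close>
    define n where "n = Max (insert 0 ((\<lambda>(\<xi>, \<eta>). R \<xi> \<eta>) ` (X \<times> X))) + D + \<rho> + 3 * cc"
    have nR: "n \<ge> R \<xi> \<eta> + D + \<rho> + 3 * cc" if "\<xi> \<in> X" "\<eta> \<in> X" for \<xi> \<eta>
    proof -
      have "R \<xi> \<eta> \<le> Max (insert 0 ((\<lambda>(\<xi>, \<eta>). R \<xi> \<eta>) ` (X \<times> X)))"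
        by (rule Max_ge) (use X that in auto)
      thus ?thesis unfolding n_def by linarith
    qed
    have "Max (insert 0 ((\<lambda>(\<xi>, \<eta>). R \<xi> \<eta>) ` (X \<times> X))) \<ge> 0" using X(2) by simp
    moreover have cc0: "cc \<ge> 0" using \<delta>_nonneg by (simp add: cc_def)
    ultimately have "n \<ge> 0" using D_pos \<rho>_nonneg unfolding n_def by linarith
    hence "\<forall>\<xi>\<in>X. \<exists>g\<in>carrier \<Gamma>. \<bar>len g - n\<bar> \<le> D \<and> Inr \<xi> \<in> Sh (\<phi> g b)" using Sh_cover X(1) by blast
    then obtain g where g: "\<And>\<xi>. \<xi> \<in> X \<Longrightarrow> g \<xi> \<in> carrier \<Gamma> \<and> \<bar>len (g \<xi>) - n\<bar> \<le> D \<and> Inr \<xi> \<in> Sh (\<phi> (g \<xi>) b)" by metis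
    let ?S = "\<lambda>\<xi>. Sh (\<phi> (g \<xi>) b)"
    have "disjoint_family_on ?S X"
      unfolding disjoint_family_on_def
    proof (intro ballI impI)
      fix \<xi> \<eta> assume xe: "\<xi> \<in> X" "\<eta> \<in> X" "\<xi> \<noteq> \<eta>"
      show "?S \<xi> \<inter> ?S \<eta> = {}"
      proof (rule ccontr)
        assume "?S \<xi> \<inter> ?S \<eta> \<noteq> {}"
        then obtain p where p: "p \<in> ?S \<xi>" "p \<in> ?S \<eta>" by blast
        let ?m = "n - D - \<rho>"
        have e: "ext q (Inl (\<phi> (g \<zeta>) b)) > ereal ?m" if "q \<in> ?S \<zeta>" "\<zeta> \<in> X" for q \<zeta>
          by (rule le_less_trans[OF _ shadow_ext[OF that(1)]]) (use g[OF that(2)] in \<open>simp add: len_def abs_le_iff\<close>)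
        have "ext (Inr \<xi>) p > ereal (?m - cc)"
          by (rule ext_trans[of _ _ "Inl (\<phi> (g \<xi>) b)"])
            (use e[of "Inr \<xi>" \<xi>] e[of p \<xi>] g xe p X shadow_bord[OF p(1)] in \<open>auto simp: ext_sym\<close>)
        moreover have "ext p (Inr \<eta>) > ereal (?m - cc)"
          by (rule ext_trans[of _ _ "Inl (\<phi> (g \<eta>) b)"])
            (use e[of "Inr \<eta>" \<eta>] e[of p \<eta>] g xe p X shadow_bord[OF p(1)] in \<open>auto simp: ext_sym\<close>)
        ultimately have "ext (Inr \<xi>) (Inr \<eta>) > ereal (?m - cc - cc)"
          by (rule ext_trans) (use xe X shadow_bord[OF p(1)] in auto)
        moreover have "R \<xi> \<eta> \<le> ?m - cc - cc" using nR[OF xe(1,2)] cc0 by linarith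
        ultimately have "ext (Inr \<xi>) (Inr \<eta>) > ereal (R \<xi> \<eta>)" by (meson ereal_less_eq(3) order_le_less_trans)
        thus False using R[OF xe] by blast
      qed
    qed
    hence "(\<Sum>\<xi>\<in>X. measure \<mu> (?S \<xi>)) = measure \<mu> (\<Union>\<xi>\<in>X. ?S \<xi>)"
      using X(2) by (intro finite_measure_finite_Union[symmetric]) auto
    also have "\<dots> \<le> 1" by simp
    finally have "(\<Sum>\<xi>\<in>X. measure \<mu> (?S \<xi>)) \<le> 1" .
    moreover have "(\<Sum>\<xi>\<in>X. c\<^sub>0) \<le> (\<Sum>\<xi>\<in>X. measure \<mu> (?S \<xi>))" by (intro sum_mono low) (use g in auto)
    ultimately have "real (card X) * c\<^sub>0 \<le> 1" by simp
    hence "real (card X) \<le> 1 / c\<^sub>0" using c\<^sub>0(1) by (simp add: field_simps)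
    thus "card X \<le> nat \<lfloor>1 / c\<^sub>0\<rfloor>" by linarith
  qed
  moreover obtain \<xi> where \<xi>: "\<xi> \<in> gromov_boundary b" using boundary_ne by blast
  moreover have "(\<lambda>g. gbd g \<xi>) ` carrier \<Gamma> \<subseteq> gromov_boundary b" using gbd_boundary \<xi> by blast
  ultimately have "finite ((\<lambda>g. gbd g \<xi>) ` carrier \<Gamma>)" by (meson finite_subset)
  thus False using infinite_boundary_orbit[OF \<xi>] by simp
qed

section \<open>Purely exponential growth\<close>

lemma growth_upper:
  obtains C where "C > 0" "\<And>x. real (card (gball x)) \<le> C * exp (\<omega> * x)"
proof -
  let ?k = "real (card (gball (1 + 2 * \<rho> + 2 * \<delta>)))"
  let ?A = "\<lambda>k::nat. {g \<in> carrier \<Gamma>. real k \<le> len g \<and> len g \<le> real k + 1}"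
  have Af: "finite (?A k)" for k by (rule finite_subset[OF _ finite_gball[of "real k + 1"]]) (auto simp: gball_def)
  define a where "a = ?k / c\<^sub>0 * exp \<omega>"
  have A: "real (card (?A k)) \<le> a * exp (\<omega> * real k)" for k
  proof -
    have "real (card (?A k)) * (c\<^sub>0 * exp (- \<omega> * (real k + 1))) \<le> (\<Sum>g\<in>?A k. measure \<mu> (Sh (\<phi> g b)))"
    proof (rule sum_bounded_below)
      fix g assume g: "g \<in> ?A k"
      hence "exp (- \<omega> * (real k + 1)) \<le> exp (- \<omega> * len g)" using \<omega>_nonneg by (auto intro: mult_left_mono)
      hence "c\<^sub>0 * exp (- \<omega> * (real k + 1)) \<le> c\<^sub>0 * exp (- \<omega> * len g)" using c\<^sub>0(1) by simp
      also have "\<dots> \<le> measure \<mu> (Sh (\<phi> g b))" using g c\<^sub>0(2) by blast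
      finally show "c\<^sub>0 * exp (- \<omega> * (real k + 1)) \<le> measure \<mu> (Sh (\<phi> g b))" .
    qed
    also have "\<dots> \<le> ?k * measure \<mu> (\<Union>g\<in>?A k. Sh (\<phi> g b))"
      by (rule sum_shadows_le[OF Af]) auto
    also have "\<dots> \<le> ?k * 1" by (intro mult_left_mono) auto
    finally have "real (card (?A k)) * (c\<^sub>0 * exp (- \<omega> * (real k + 1))) \<le> ?k" by simp
    hence "real (card (?A k)) * (c\<^sub>0 * exp (- \<omega> * (real k + 1))) * exp (\<omega> * (real k + 1)) \<le> ?k * exp (\<omega> * (real k + 1))"
      by (rule mult_right_mono) simp
    hence "real (card (?A k)) * c\<^sub>0 \<le> ?k * exp (\<omega> * (real k + 1))"
      by (simp add: mult.assoc exp_add[symmetric])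
    thus ?thesis using c\<^sub>0(1) by (simp add: a_def field_simps exp_add)
  qed
  let ?q = "exp (- \<omega>)"
  \<comment> \<open>Positivity of \<omega> makes the sum over annuli geometric, so the outermost
    annulus dominates.\<close>
  have q: "0 < ?q" "?q < 1" using \<omega>_pos by auto
  define C where "C = (a * (1 / (1 - ?q)) + 1) * exp \<omega>"
  have kc: "a \<ge> 0" using c\<^sub>0(1) by (simp add: a_def)
  have Cpos: "C > 0" unfolding C_def using kc q
    by (intro mult_pos_pos add_nonneg_pos mult_nonneg_nonneg) auto
  have nat: "real (card (gball (real n))) \<le> a * (1 / (1 - ?q)) * exp (\<omega> * real n)" for n :: nat
  proof -
    have "gball (real n) \<subseteq> (\<Union>k\<le>n. ?A k)"
    proof
      fix g assume g: "g \<in> gball (real n)"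
      let ?m = "nat \<lfloor>len g\<rfloor>"
      have "real ?m \<le> len g" "len g \<le> real ?m + 1" using len_nonneg[of g] by linarith+
      hence "g \<in> ?A ?m" using g unfolding gball_def by blast
      moreover have "len g \<le> real n" using g by (simp add: gball_def)
      hence "?m \<le> n" by linarith
      ultimately show "g \<in> (\<Union>k\<le>n. ?A k)" by blast
    qed
    hence "card (gball (real n)) \<le> card (\<Union>k\<le>n. ?A k)" by (rule card_mono[rotated]) (use Af in simp)
    also have "\<dots> \<le> (\<Sum>k\<le>n. card (?A k))" by (rule card_UN_le) simp
    finally have "real (card (gball (real n))) \<le> (\<Sum>k\<le>n. real (card (?A k)))" by (simp flip: of_nat_sum)
    also have "\<dots> \<le> (\<Sum>k\<le>n. a * exp (\<omega> * real k))" by (intro sum_mono A)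
    also have "\<dots> = a * (\<Sum>k\<le>n. exp (\<omega> * real k))" by (simp add: sum_distrib_left)
    also have "(\<Sum>k\<le>n. exp (\<omega> * real k)) = (\<Sum>k\<le>n. exp (\<omega> * real n) * ?q ^ k)"
    proof -
      have "(\<Sum>k\<le>n. exp (\<omega> * real k)) = (\<Sum>k\<le>n. exp (\<omega> * real (n - k)))"
        by (rule sum.reindex_bij_witness[where i="\<lambda>k. n - k" and j="\<lambda>k. n - k"]) auto
      also have "\<dots> = (\<Sum>k\<le>n. exp (\<omega> * real n) * ?q ^ k)"
        by (rule sum.cong) (auto simp: exp_of_nat_mult[symmetric] exp_add[symmetric] of_nat_diff algebra_simps)
      finally show ?thesis .
    qed
    also have "\<dots> = exp (\<omega> * real n) * (\<Sum>k\<le>n. ?q ^ k)" by (simp add: sum_distrib_left)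
    also have "a * (exp (\<omega> * real n) * (\<Sum>k\<le>n. ?q ^ k)) \<le> a * (exp (\<omega> * real n) * (1 / (1 - ?q)))"
    proof (intro mult_left_mono kc)
      have "(\<Sum>k\<le>n. ?q ^ k) \<le> (\<Sum>k. ?q ^ k)"
        by (rule sum_le_suminf) (use q in \<open>auto intro: summable_geometric\<close>)
      also have "(\<Sum>k. ?q ^ k) = 1 / (1 - ?q)" by (rule suminf_geometric) (use q in simp)
      finally show "(\<Sum>k\<le>n. ?q ^ k) \<le> 1 / (1 - ?q)" .
    qed simp
    finally show ?thesis by (simp only: mult_ac)
  qed
  show thesis
  proof (rule that[OF Cpos])
    fix x
    show "real (card (gball x)) \<le> C * exp (\<omega> * x)"
    proof (cases "x \<ge> 0")
      case True
      let ?n = "nat \<lceil>x\<rceil>"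
      have n: "x \<le> real ?n" "real ?n \<le> x + 1" using True by linarith+
      have "gball x \<subseteq> gball (real ?n)" using n unfolding gball_def by auto
      hence "card (gball x) \<le> card (gball (real ?n))" by (rule card_mono[OF finite_gball])
      hence "real (card (gball x)) \<le> a * (1 / (1 - ?q)) * exp (\<omega> * real ?n)"
        using nat[of ?n] by linarith
      also have "\<dots> \<le> (a * (1 / (1 - ?q)) + 1) * exp (\<omega> * (x + 1))"
        by (intro mult_mono add_nonneg_nonneg mult_nonneg_nonneg) (use n kc q \<omega>_nonneg in \<open>auto intro: mult_left_mono\<close>)
      also have "\<dots> = C * exp (\<omega> * x)" by (simp add: C_def exp_add algebra_simps)
      finally show ?thesis .
    next
      case False
      have "\<not> len g \<le> x" for g using len_nonneg[of g] False by linarith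
      hence "gball x = {}" by (auto simp: gball_def)
      thus ?thesis using Cpos by (simp only: card.empty) simp
    qed
  qed
qed

text \<open>Covering \<open>A\<close> at level n - D with tolerance \<open>D\<close> keeps the
  centres inside the ball of radius \<open>n\<close> and outside that of radius n - 2 D;
  \<open>shadow_upper\<close> bounds the mass of each shadow.\<close>

lemma shadow_count:
  assumes A: "A \<in> sets \<mu>" "A \<subseteq> boundary_part b" and n: "real n \<ge> D"
  shows "measure \<mu> A * exp (\<omega> * real n)
    \<le> real (card {x \<in> orbit_ball \<Gamma> \<phi> b n. dist b x \<ge> real n - 2 * D \<and> Sh x \<inter> A \<noteq> {}})
       * exp (2 * \<omega> * (\<rho> + D))"
proof -
  let ?K = "exp (2 * \<omega> * (\<rho> + D))"
  let ?S = "{x \<in> orbit_ball \<Gamma> \<phi> b n. dist b x \<ge> real n - 2 * D \<and> Sh x \<inter> A \<noteq> {}}"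
  have fin: "finite ?S" by simp
  have "A \<subseteq> (\<Union>x\<in>?S. Sh x)"
  proof
    fix p assume p: "p \<in> A"
    then obtain \<xi> where \<xi>: "p = Inr \<xi>" "\<xi> \<in> gromov_boundary b"
      using A(2) by (metis boundary_part_iff subsetD)
    obtain g where g: "g \<in> carrier \<Gamma>" "\<bar>len g - (real n - D)\<bar> \<le> D" "Inr \<xi> \<in> Sh (\<phi> g b)"
      using Sh_cover[OF \<xi>(2), of "real n - D"] n by auto
    hence "\<phi> g b \<in> ?S" using p \<xi>(1) by (auto simp: orbit_ball_def len_def abs_le_iff)
    thus "p \<in> (\<Union>x\<in>?S. Sh x)" using g(3) \<xi>(1) by blast
  qed
  hence "measure \<mu> A \<le> measure \<mu> (\<Union>x\<in>?S. Sh x)"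
    by (intro finite_measure_mono sets.finite_UN fin) auto
  also have "\<dots> \<le> (\<Sum>x\<in>?S. measure \<mu> (Sh x))"
    by (intro finite_measure_subadditive_finite fin) auto
  also have "\<dots> \<le> (\<Sum>x\<in>?S. ?K * exp (- \<omega> * real n))"
  proof (rule sum_mono)
    fix x assume "x \<in> ?S"
    then obtain g where g: "g \<in> carrier \<Gamma>" "x = \<phi> g b" "len g \<ge> real n - 2 * D"
      by (auto simp: orbit_ball_def len_def)
    have "measure \<mu> (Sh x) \<le> exp (2 * \<omega> * \<rho>) * exp (- \<omega> * len g)"
      using shadow_upper[OF g(1), of \<rho>] g(2) by simp
    also have "\<dots> \<le> exp (2 * \<omega> * \<rho>) * exp (- \<omega> * (real n - 2 * D))"
      using g(3) mult_left_mono[OF g(3) \<omega>_nonneg] by simp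
    also have "\<dots> = ?K * exp (- \<omega> * real n)" by (simp add: exp_add[symmetric] algebra_simps)
    finally show "measure \<mu> (Sh x) \<le> ?K * exp (- \<omega> * real n)" .
  qed
  also have "\<dots> = exp (- \<omega> * real n) * (real (card ?S) * ?K)" by simp
  finally show ?thesis
    using exp_minus_mult_le_iff[of \<omega> "- real n" "measure \<mu> A" "real (card ?S) * ?K"]
    by (simp add: mult.commute)
qed

lemma growth_lower:
  obtains c where "c > 0" "\<And>n::nat. real n \<ge> D \<Longrightarrow> real (card (orbit_ball \<Gamma> \<phi> b n)) \<ge> c * exp (\<omega> * real n)"
proof -
  let ?K = "exp (2 * \<omega> * (\<rho> + D))"
  show thesis
  proof (rule that[of "1 / ?K"])
    fix n :: nat assume n: "real n \<ge> D"
    let ?S = "{x \<in> orbit_ball \<Gamma> \<phi> b n. dist b x \<ge> real n - 2 * D \<and> Sh x \<inter> boundary_part b \<noteq> {}}"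
    have "exp (\<omega> * real n) \<le> real (card ?S) * ?K"
      using shadow_count[OF boundary_sets order_refl n] by (simp add: measure_boundary)
    also have "card ?S \<le> card (orbit_ball \<Gamma> \<phi> b n)" by (rule card_mono) auto
    hence "real (card ?S) * ?K \<le> real (card (orbit_ball \<Gamma> \<phi> b n)) * ?K"
      by (intro mult_right_mono) auto
    finally show "1 / ?K * exp (\<omega> * real n) \<le> real (card (orbit_ball \<Gamma> \<phi> b n))"
      by (simp add: field_simps)
  qed simp
qed

end

section \<open>Conservativity and quotient growth\<close>

lemma card_le_fibers:
  assumes "finite S" "\<And>x. x \<in> S \<Longrightarrow> card {y \<in> S. f y = f x} \<le> k"
  shows "card S \<le> card (f ` S) * k"
proof -
  have "S = (\<Union>q\<in>f ` S. {y \<in> S. f y = q})" by auto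
  hence "card S \<le> (\<Sum>q\<in>f ` S. card {y \<in> S. f y = q})"
    using card_UN_le[of "f ` S" "\<lambda>q. {y \<in> S. f y = q}"] assms(1) by simp
  also have "\<dots> \<le> (\<Sum>q\<in>f ` S. k)" by (rule sum_mono) (use assms(2) in auto)
  finally show ?thesis by simp
qed

context patterson_nonelementary
begin

lemma subgroup_carrier: "subgroup H \<Gamma> \<Longrightarrow> h \<in> H \<Longrightarrow> h \<in> carrier \<Gamma>"
  using subgroup.subset by blast

lemma sets_restrict_boundary:
  "A \<in> sets (restrict_space \<mu> (boundary_part b)) \<longleftrightarrow> A \<subseteq> boundary_part b \<and> A \<in> sets \<mu>"
  using boundary_sets boundary_part_subset by (subst sets_restrict_space_iff) (auto simp: Int_absorb2)

lemma emeasure_restrict_boundary: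
  "A \<subseteq> boundary_part b \<Longrightarrow> emeasure (restrict_space \<mu> (boundary_part b)) A = emeasure \<mu> A"
  using boundary_sets boundary_part_subset by (intro emeasure_restrict_space) (auto simp: Int_absorb2)

lemma measure_gact_zero_iff:
  assumes "g \<in> carrier \<Gamma>" "A \<in> sets \<mu>"
  shows "measure \<mu> (gact g ` A) = 0 \<longleftrightarrow> measure \<mu> A = 0"
proof -
  have gA: "gact g ` A \<in> sets \<mu>" by (rule gact_sets[OF assms])
  have "measure \<mu> (gact g ` A) \<le> exp (\<omega> * len g) * measure \<mu> A"
    using measure_gact_le[of "inv g" A] assms by simp
  moreover have "measure \<mu> A \<le> exp (\<omega> * len g) * measure \<mu> (gact g ` A)"
    using measure_gact_le[OF assms(1) gA] assms(1) by (simp add: image_image)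
  ultimately show ?thesis
    by (metis measure_nonneg mult_zero_right antisym)
qed

lemma measure_class_preserving_boundary:
  assumes H: "subgroup H \<Gamma>"
  shows "measure_class_preserving (\<Gamma>\<lparr>carrier := H\<rparr>) (restrict_space \<mu> (boundary_part b)) (boundary_action b \<phi>)"
  unfolding measure_class_preserving_def
proof (intro conjI ballI)
  let ?M = "restrict_space \<mu> (boundary_part b)"
  have sp: "space ?M = boundary_part b" using boundary_part_subset by (auto simp: space_restrict_space)
  show "group_action (\<Gamma>\<lparr>carrier := H\<rparr>) (space ?M) (boundary_action b \<phi>)"
    unfolding sp by (rule group_action_boundary[OF H])
  fix g assume "g \<in> carrier (\<Gamma>\<lparr>carrier := H\<rparr>)"
  hence g: "g \<in> carrier \<Gamma>" using subgroup_carrier[OF H] by simp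
  show "boundary_action b \<phi> g \<in> measurable ?M ?M"
  proof (rule measurableI)
    fix p assume "p \<in> space ?M"
    thus "boundary_action b \<phi> g p \<in> space ?M"
      unfolding sp using g by (simp add: boundary_action_eq gact_boundary_part)
  next
    fix A assume "A \<in> sets ?M"
    hence A: "A \<subseteq> boundary_part b" "A \<in> sets \<mu>" by (auto simp: sets_restrict_boundary)
    have "boundary_action b \<phi> g -` A \<inter> space ?M = (gact g -` A \<inter> space \<mu>) \<inter> boundary_part b"
      unfolding sp using boundary_part_subset by (auto simp: boundary_action_eq)
    moreover have "gact g -` A \<inter> space \<mu> \<in> sets \<mu>" by (rule measurable_sets[OF gact_measurable[OF g] A(2)])
    ultimately show "boundary_action b \<phi> g -` A \<inter> space ?M \<in> sets ?M"
      using boundary_sets by (auto simp: sets_restrict_boundary)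
  qed
  fix A assume "A \<in> sets ?M"
  hence A: "A \<subseteq> boundary_part b" "A \<in> sets \<mu>" by (auto simp: sets_restrict_boundary)
  have "gact g ` A \<subseteq> boundary_part b" using A(1) gact_boundary_part[OF g] by blast
  thus "emeasure ?M (boundary_action b \<phi> g ` A) = 0 \<longleftrightarrow> emeasure ?M A = 0"
    using measure_gact_zero_iff[OF g A(2)] A
    by (simp add: boundary_action_image emeasure_restrict_boundary emeasure_eq_measure)
qed

lemma conservative_iff:
  assumes H: "subgroup H \<Gamma>"
  shows "conservative (\<Gamma>\<lparr>carrier := H\<rparr>) (restrict_space \<mu> (boundary_part b)) (boundary_action b \<phi>) \<longleftrightarrow>
    (\<forall>A\<in>sets \<mu>. A \<subseteq> boundary_part b \<longrightarrow> measure \<mu> A > 0 \<longrightarrow> (\<exists>h\<in>H - {\<one>}. gact h ` A \<inter> A \<noteq> {}))"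
proof -
  have "countable H" using countable_carrier subgroup.subset[OF H] countable_subset by blast
  thus ?thesis
    using measure_class_preserving_boundary[OF H]
    by (auto simp: conservative_def sets_restrict_boundary emeasure_restrict_boundary
      boundary_action_image emeasure_eq_measure)
qed

section \<open>Orbits of the subgroup and the quotient metric\<close>

lemma orbit_subgroup: "orbit (\<Gamma>\<lparr>carrier := H\<rparr>) \<phi> x = {\<phi> h x | h. h \<in> H}"
  by (simp add: orbit_def)

lemma orbit_eqD:
  assumes "subgroup H \<Gamma>" "orbit (\<Gamma>\<lparr>carrier := H\<rparr>) \<phi> x = orbit (\<Gamma>\<lparr>carrier := H\<rparr>) \<phi> y"
  obtains h where "h \<in> H" "x = \<phi> h y"
proof -
  have "x = \<phi> \<one> x" by simp
  hence "x \<in> orbit (\<Gamma>\<lparr>carrier := H\<rparr>) \<phi> x"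
    unfolding orbit_subgroup using subgroup.one_closed[OF assms(1)] by blast
  hence "x \<in> orbit (\<Gamma>\<lparr>carrier := H\<rparr>) \<phi> y" by (simp only: assms(2))
  hence "x \<in> {\<phi> h y | h. h \<in> H}" by (simp only: orbit_subgroup)
  thus thesis using that by blast
qed

lemma orbit_act:
  assumes H: "subgroup H \<Gamma>" and h: "h \<in> H"
  shows "orbit (\<Gamma>\<lparr>carrier := H\<rparr>) \<phi> (\<phi> h x) = orbit (\<Gamma>\<lparr>carrier := H\<rparr>) \<phi> x"
proof -
  have c: "k \<in> carrier \<Gamma>" if "k \<in> H" for k using subgroup_carrier[OF H that] .
  show ?thesis
    unfolding orbit_subgroup
  proof (intro equalityI subsetI)
    fix y assume "y \<in> {\<phi> k (\<phi> h x) | k. k \<in> H}"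
    then obtain k where k: "k \<in> H" "y = \<phi> k (\<phi> h x)" by blast
    have "y = \<phi> (k \<otimes> h) x" using k c h by (simp add: act_mult)
    moreover have "k \<otimes> h \<in> H" using k h subgroup.m_closed[OF H] by simp
    ultimately show "y \<in> {\<phi> k x | k. k \<in> H}" by blast
  next
    fix y assume "y \<in> {\<phi> k x | k. k \<in> H}"
    then obtain k where k: "k \<in> H" "y = \<phi> k x" by blast
    have "y = \<phi> (k \<otimes> inv h) (\<phi> h x)" using k c h by (simp add: act_mult)
    moreover have "k \<otimes> inv h \<in> H" using k h H by (simp add: subgroup.m_closed subgroup.m_inv_closed)
    ultimately show "y \<in> {\<phi> k (\<phi> h x) | k. k \<in> H}" by blast
  qed
qed

lemma quotient_dist_le:
  assumes "subgroup H \<Gamma>" "h \<in> H"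
  shows "quotient_dist H \<phi> b x \<le> dist b (\<phi> h x)"
  unfolding quotient_dist_def by (rule cINF_lower[OF _ assms(2)]) (auto intro: bdd_belowI2[of _ 0])

lemma quotient_dist_approx:
  assumes "subgroup H \<Gamma>"
  obtains h where "h \<in> H" "dist b (\<phi> h x) < quotient_dist H \<phi> b x + 1"
proof -
  have "H \<noteq> {}" using subgroup.one_closed[OF assms] by blast
  moreover have "bdd_below ((\<lambda>h. dist b (\<phi> h x)) ` H)" by (auto intro: bdd_belowI2[of _ 0])
  ultimately have "\<exists>h\<in>H. dist b (\<phi> h x) < quotient_dist H \<phi> b x + 1"
    using cINF_less_iff[of H "\<lambda>h. dist b (\<phi> h x)" "quotient_dist H \<phi> b x + 1"]
    by (simp add: quotient_dist_def)
  thus thesis using that by blast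
qed

lemma finite_quotient_ball:
  assumes H: "subgroup H \<Gamma>"
  shows "finite (quotient_ball \<Gamma> H \<phi> b n)"
proof (rule finite_subset)
  show "quotient_ball \<Gamma> H \<phi> b n \<subseteq> (\<lambda>x. orbit (\<Gamma>\<lparr>carrier := H\<rparr>) \<phi> x) ` orbit_ball \<Gamma> \<phi> b (n + 1)"
  proof
    fix Q assume "Q \<in> quotient_ball \<Gamma> H \<phi> b n"
    then obtain g where g: "g \<in> carrier \<Gamma>" "Q = orbit (\<Gamma>\<lparr>carrier := H\<rparr>) \<phi> (\<phi> g b)" "quotient_dist H \<phi> b (\<phi> g b) \<le> real n"
      by (auto simp: quotient_ball_def)
    obtain h where h: "h \<in> H" "dist b (\<phi> h (\<phi> g b)) < quotient_dist H \<phi> b (\<phi> g b) + 1"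
      using quotient_dist_approx[OF H] by blast
    have hc: "h \<in> carrier \<Gamma>" by (rule subgroup_carrier[OF H h(1)])
    have "\<phi> (h \<otimes> g) b \<in> orbit_ball \<Gamma> \<phi> b (n + 1)"
      unfolding orbit_ball_def using h(2) g hc by (auto simp: act_mult intro!: exI[of _ "h \<otimes> g"])
    moreover have "Q = orbit (\<Gamma>\<lparr>carrier := H\<rparr>) \<phi> (\<phi> (h \<otimes> g) b)"
      using orbit_act[OF H h(1)] g hc by (simp add: act_mult)
    ultimately show "Q \<in> (\<lambda>x. orbit (\<Gamma>\<lparr>carrier := H\<rparr>) \<phi> x) ` orbit_ball \<Gamma> \<phi> b (n + 1)" by blast
  qed
qed simp

section \<open>From a wandering set to exponentially many orbits\<close>

text \<open>The translates of \<open>A \<inter> W h\<close> by \<open>inv h\<close> are disjoint and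
  have at least exp(- \<omega> L) times its mass. So the number of \<open>h\<close> with a point in
  \<open>W h\<close> has integral at most \<open>M\<close> over \<open>A\<close>, and Markov's
  inequality bounds this number outside a set of mass smaller than that of \<open>A\<close>.\<close>

lemma wandering_imp_few_horospheric:
  assumes H: "subgroup H \<Gamma>"
    and A: "A \<in> sets \<mu>" "A \<subseteq> boundary_part b" "measure \<mu> A > 0"
    and wand: "\<And>h. h \<in> H \<Longrightarrow> h \<noteq> \<one> \<Longrightarrow> gact h ` A \<inter> A = {}"
    and W: "\<And>h. h \<in> H \<Longrightarrow> openin T (W h)"
      "\<And>h x. h \<in> H \<Longrightarrow> Inl x \<in> W h \<Longrightarrow> dist (\<phi> h b) x - dist b x \<le> L"
  obtains A' and K :: nat where "A' \<in> sets \<mu>" "A' \<subseteq> A" "measure \<mu> A' > 0"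
    "\<forall>p\<in>A'. \<forall>J. finite J \<longrightarrow> J \<subseteq> H \<longrightarrow> (\<forall>h\<in>J. p \<in> W h) \<longrightarrow> card J \<le> K"
proof -
  have c: "k \<in> carrier \<Gamma>" if "k \<in> H" for k using subgroup_carrier[OF H that] .
  have Wm: "A \<inter> W h \<in> sets \<mu>" if "h \<in> H" for h using A(1) open_sets[OF W(1)[OF that]] by auto
  have gm: "gact (inv h) ` (A \<inter> W h) \<in> sets \<mu>" if "h \<in> H" for h
    using gact_sets[of "inv h"] Wm[OF that] c[OF that] by simp
  have disj: "gact (inv h) ` A \<inter> gact (inv k) ` A = {}" if hk: "h \<in> H" "k \<in> H" "h \<noteq> k" for h k
  proof (rule ccontr)
    assume "gact (inv h) ` A \<inter> gact (inv k) ` A \<noteq> {}"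
    then obtain p q where pq: "p \<in> A" "q \<in> A" "gact (inv h) p = gact (inv k) q" by blast
    have kh: "k \<otimes> inv h \<in> H" using hk H by (simp add: subgroup.m_closed subgroup.m_inv_closed)
    have "gact (k \<otimes> inv h) p = gact k (gact (inv k) q)"
      using pq(3) c hk by (simp add: gact_mult)
    also have "\<dots> = q" using c hk by simp
    finally have "gact (k \<otimes> inv h) ` A \<inter> A \<noteq> {}" using pq by blast
    moreover have "k \<otimes> inv h \<noteq> \<one>"
      using hk c by (metis \<Gamma>.inv_closed \<Gamma>.inv_equality \<Gamma>.inv_inv)
    ultimately show False using wand[OF kh] by blast
  qed
  define M where "M = exp (\<omega> * L)"
  have sumle: "(\<Sum>h\<in>J. measure \<mu> (A \<inter> W h)) \<le> M" if J: "finite J" "J \<subseteq> H" for J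
  proof -
    have "(\<Sum>h\<in>J. measure \<mu> (A \<inter> W h)) \<le> (\<Sum>h\<in>J. M * measure \<mu> (gact (inv h) ` (A \<inter> W h)))"
    proof (rule sum_mono)
      fix h assume "h \<in> J"
      hence h: "h \<in> H" using J by blast
      have "exp (- \<omega> * L) * measure \<mu> (A \<inter> W h) \<le> measure \<mu> (gact (inv h) ` (A \<inter> W h))"
        by (rule quasiconformal_ge[OF c[OF h] W(1)[OF h] W(2)[OF h] Wm[OF h]]) auto
      thus "measure \<mu> (A \<inter> W h) \<le> M * measure \<mu> (gact (inv h) ` (A \<inter> W h))"
        unfolding exp_minus_mult_le_iff M_def .
    qed
    also have "\<dots> = M * (\<Sum>h\<in>J. measure \<mu> (gact (inv h) ` (A \<inter> W h)))" by (simp add: sum_distrib_left)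
    also have "(\<Sum>h\<in>J. measure \<mu> (gact (inv h) ` (A \<inter> W h))) = measure \<mu> (\<Union>h\<in>J. gact (inv h) ` (A \<inter> W h))"
    proof (rule finite_measure_finite_Union[symmetric])
      show "disjoint_family_on (\<lambda>h. gact (inv h) ` (A \<inter> W h)) J"
        unfolding disjoint_family_on_def using disj J by blast
    qed (use J gm in auto)
    also have "M * \<dots> \<le> M * 1" by (intro mult_left_mono) (auto simp: M_def)
    finally show ?thesis by simp
  qed
  \<comment> \<open>Large enough for Markov's bound M / K to stay below the mass of
    \<open>A\<close>.\<close>
  obtain K :: nat where K: "M / measure \<mu> A < real K" using reals_Archimedean2 by blast
  have M0: "M > 0" by (simp add: M_def)
  have K0: "real K > 0" by (rule le_less_trans[OF _ K]) (use M0 A(3) in simp)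
  have MK: "M / real K < measure \<mu> A" using K K0 A(3) by (simp add: field_simps)
  \<comment> \<open>A finite exhaustion of the subgroup: the exceptional sets increase, and their
    union obeys the same bound.\<close>
  define J where "J n = H \<inter> gball (real n)" for n :: nat
  have Jf: "finite (J n)" "J n \<subseteq> H" for n by (auto simp: J_def)
  define B where "B n = {p \<in> space \<mu>. (\<Sum>h\<in>J n. indicator (A \<inter> W h) p) \<ge> real K}" for n
  have meas: "(\<lambda>p. \<Sum>h\<in>J n. indicator (A \<inter> W h) p :: real) \<in> borel_measurable \<mu>" for n
    using Wm Jf(2) by (intro borel_measurable_sum borel_measurable_indicator) auto
  have Bm: "B n \<in> sets \<mu>" for n
    unfolding B_def using meas[of n] by measurable
  have int: "integrable \<mu> (indicator (A \<inter> W h) :: _ \<Rightarrow> real)" if "h \<in> J n" for h n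
    using Wm[of h] Jf(2)[of n] that by (intro integrable_real_indicator) (auto simp: less_top[symmetric])
  have Bb: "measure \<mu> (B n) \<le> M / real K" for n
  proof -
    have "real K * measure \<mu> (B n) = (\<integral>p. real K * indicator (B n) p \<partial>\<mu>)"
      using Bm[of n] sets.sets_into_space[OF Bm[of n]] by (simp add: Int_absorb2)
    also have "\<dots> \<le> (\<integral>p. (\<Sum>h\<in>J n. indicator (A \<inter> W h) p) \<partial>\<mu>)"
    proof (rule integral_mono)
      show "integrable \<mu> (\<lambda>p. real K * indicator (B n) p)"
        using Bm[of n] by (intro integrable_mult_right) (simp add: less_top[symmetric])
      show "integrable \<mu> (\<lambda>p. \<Sum>h\<in>J n. indicator (A \<inter> W h) p :: real)"
        by (rule Bochner_Integration.integrable_sum[OF int])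
      fix p assume "p \<in> space \<mu>"
      show "real K * indicator (B n) p \<le> (\<Sum>h\<in>J n. indicator (A \<inter> W h) p)"
        by (cases "p \<in> B n") (auto simp: B_def intro: sum_nonneg)
    qed
    also have "\<dots> = (\<Sum>h\<in>J n. \<integral>p. indicator (A \<inter> W h) p \<partial>\<mu>)"
      by (rule Bochner_Integration.integral_sum[OF int])
    also have "\<dots> = (\<Sum>h\<in>J n. measure \<mu> (A \<inter> W h))"
    proof (rule sum.cong)
      fix h assume "h \<in> J n"
      hence "A \<inter> W h \<in> sets \<mu>" using Wm Jf(2) by blast
      from sets.sets_into_space[OF this] this
      show "(\<integral>p. indicator (A \<inter> W h) p \<partial>\<mu>) = measure \<mu> (A \<inter> W h)" by (simp add: Int_absorb2)
    qed simp
    also have "\<dots> \<le> M" by (rule sumle[OF Jf])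
    finally show ?thesis using K0 by (simp add: field_simps)
  qed
  have incB: "incseq B"
  proof (rule incseq_SucI)
    fix n
    have "J n \<subseteq> J (Suc n)" by (auto simp: J_def gball_def)
    hence "(\<Sum>h\<in>J n. indicator (A \<inter> W h) p) \<le> (\<Sum>h\<in>J (Suc n). indicator (A \<inter> W h) p :: real)" for p
      by (intro sum_mono2 Jf) auto
    thus "B n \<subseteq> B (Suc n)" unfolding B_def by (auto intro: order_trans)
  qed
  have "(\<lambda>n. measure \<mu> (B n)) \<longlonglongrightarrow> measure \<mu> (\<Union>n. B n)"
    by (rule finite_Lim_measure_incseq) (use Bm incB in auto)
  hence UB: "measure \<mu> (\<Union>n. B n) \<le> M / real K" by (rule LIMSEQ_le_const2) (use Bb in auto)
  show thesis
  proof (rule that[of "A - (\<Union>n. B n)" K])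
    have UBm: "(\<Union>n. B n) \<in> sets \<mu>" using Bm by auto
    show "A - (\<Union>n. B n) \<in> sets \<mu>" using A Bm by auto
    have "measure \<mu> A \<le> measure \<mu> ((A - (\<Union>n. B n)) \<union> (\<Union>n. B n))"
      by (rule finite_measure_mono) (use A Bm in auto)
    also have "\<dots> \<le> measure \<mu> (A - (\<Union>n. B n)) + measure \<mu> (\<Union>n. B n)"
      by (rule measure_Un_le) (use A Bm in auto)
    finally show "measure \<mu> (A - (\<Union>n. B n)) > 0" using UB MK by linarith
    have "card F \<le> K"
      if p: "p \<in> A - (\<Union>n. B n)" and F: "finite F" "F \<subseteq> H" "\<forall>h\<in>F. p \<in> W h" for p F
    proof -
      define n where "n = nat \<lceil>Max (insert 0 (len ` F))\<rceil>"
      have "F \<subseteq> J n"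
      proof
        fix h assume h: "h \<in> F"
        have "len h \<le> Max (insert 0 (len ` F))" by (rule Max_ge) (use F h in auto)
        also have "\<dots> \<le> real n" unfolding n_def by linarith
        finally show "h \<in> J n" using h F(2) c by (auto simp: J_def gball_def)
      qed
      have "real (card F) = (\<Sum>h\<in>F. indicator (A \<inter> W h) p)"
        using p F(3) by simp
      also have "\<dots> \<le> (\<Sum>h\<in>J n. indicator (A \<inter> W h) p)"
        by (rule sum_mono2[OF Jf(1) \<open>F \<subseteq> J n\<close>]) auto
      also have "\<dots> < real K"
      proof -
        have "p \<in> space \<mu>" using p A sets.sets_into_space by blast
        moreover have "p \<notin> B n" using p by blast
        ultimately show ?thesis unfolding B_def by auto
      qed
      finally show ?thesis by simp
    qed
    thus "\<forall>p\<in>A - (\<Union>n. B n). \<forall>J. finite J \<longrightarrow> J \<subseteq> H \<longrightarrow> (\<forall>h\<in>J. p \<in> W h) \<longrightarrow> card J \<le> K" by blast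
  qed auto
qed

lemma wandering_imp_large_quotient:
  assumes H: "subgroup H \<Gamma>"
    and A: "A \<in> sets \<mu>" "A \<subseteq> boundary_part b" "measure \<mu> A > 0"
    and wand: "\<And>h. h \<in> H \<Longrightarrow> h \<noteq> \<one> \<Longrightarrow> gact h ` A \<inter> A = {}"
  obtains c where "c > 0" "\<And>n::nat. real n \<ge> D \<Longrightarrow>
    real (card (quotient_ball \<Gamma> H \<phi> b n)) \<ge> c * exp (\<omega> * real n)"
proof -
  have c: "k \<in> carrier \<Gamma>" if "k \<in> H" for k using subgroup_carrier[OF H that] .
  \<comment> \<open>For \<open>y\<close> in the shadow of \<open>x\<close>, the difference d(h b, y)
    - d(b, y) is at most d(h b, x) + 2 \<rho> - d(b, x), where d(h b, x) is at most \<open>n\<close>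
    and d(b, x) at least n - 2 D.\<close>
  define L where "L = 2 * \<rho> + 2 * D"
  \<comment> \<open>All boundary points are included; taking the interior then keeps those with a
    neighbourhood whose points in X satisfy the inequality.\<close>
  define V where "V h = Inl ` {x. dist (\<phi> h b) x - dist b x \<le> L} \<union> boundary_part b" for h
  define W where "W h = T interior_of V h" for h
  have WV: "p \<in> V h" if "p \<in> W h" for p h
    using subsetD[OF interior_of_subset that[unfolded W_def]] .
  obtain A' and K :: nat where A': "A' \<in> sets \<mu>" "A' \<subseteq> A" "measure \<mu> A' > 0"
    "\<forall>p\<in>A'. \<forall>J. finite J \<longrightarrow> J \<subseteq> H \<longrightarrow> (\<forall>h\<in>J. p \<in> W h) \<longrightarrow> card J \<le> K"
  proof (rule wandering_imp_few_horospheric[OF H A, of W L])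
    show "gact h ` A \<inter> A = {}" if "h \<in> H" "h \<noteq> \<one>" for h by (rule wand[OF that])
    show "openin T (W h)" for h by (simp add: W_def)
    show "dist (\<phi> h b) x - dist b x \<le> L" if "Inl x \<in> W h" for h x
      using WV[OF that] by (auto simp: V_def boundary_part_def)
  qed (rule that)
  let ?e = "exp (2 * \<omega> * (\<rho> + D))"
  show thesis
  \<comment> \<open>\<open>K\<close> may be 0, and \<open>real K + 1\<close> keeps the constant
    positive.\<close>
  proof (rule that[of "measure \<mu> A' / (?e * (real K + 1))"])
    show "measure \<mu> A' / (?e * (real K + 1)) > 0" using A'(3) by (simp add: add_nonneg_pos)
    fix n :: nat assume n: "real n \<ge> D"
    let ?S = "{x \<in> orbit_ball \<Gamma> \<phi> b n. dist b x \<ge> real n - 2 * D \<and> Sh x \<inter> A' \<noteq> {}}"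
    have fin: "finite ?S" by simp
    have "A' \<subseteq> boundary_part b" using A'(2) A(2) by (rule order_trans)
    note S = shadow_count[OF A'(1) this n]
    let ?o = "orbit (\<Gamma>\<lparr>carrier := H\<rparr>) \<phi>"
    have few: "card {h \<in> H. dist (\<phi> h b) x \<le> real n} \<le> K" "finite {h \<in> H. dist (\<phi> h b) x \<le> real n}" if x: "x \<in> ?S" for x
    proof -
      obtain p where p: "p \<in> Sh x" "p \<in> A'" using x by blast
      let ?J = "{h \<in> H. dist (\<phi> h b) x \<le> real n}"
      show fJ: "finite ?J" by (rule finite_orbit_near) (use c in blast)
      have "Sh x \<subseteq> W h" if h: "h \<in> ?J" for h
        unfolding W_def
      proof (rule interior_of_maximal)
        show "Sh x \<subseteq> V h"
        proof
          fix q assume q: "q \<in> Sh x"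
          show "q \<in> V h"
          proof (cases q)
            case (Inl y)
            have "dist x y - dist b y \<le> 2 * \<rho> - dist b x" using shadow_busemann q Inl by blast
            hence "dist (\<phi> h b) y - dist b y \<le> L"
              using h x dist_triangle[of "\<phi> h b" y x] by (auto simp: L_def)
            thus ?thesis using Inl by (simp add: V_def)
          next
            case (Inr \<xi>)
            thus ?thesis using shadow_bord[OF q] by (auto simp: V_def boundary_part_iff)
          qed
        qed
      qed simp
      thus "card ?J \<le> K" using p using A'(4)[rule_format, OF p(2) fJ] by auto
    qed
    have "card ?S \<le> card (?o ` ?S) * K"
    proof (rule card_le_fibers[OF fin])
      fix x assume x: "x \<in> ?S"
      \<comment> \<open>A point \<open>\<phi> h x\<close> of norm at most \<open>n\<close> means
        that \<open>inv h\<close> brings \<open>b\<close> within \<open>n\<close> of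
        \<open>x\<close>, and by \<open>few\<close> there are at most \<open>K\<close> such
        elements.\<close>
      have "{y \<in> ?S. ?o y = ?o x} \<subseteq> (\<lambda>h. \<phi> (inv h) x) ` {h \<in> H. dist (\<phi> h b) x \<le> real n}"
      proof
        fix y assume y: "y \<in> {y \<in> ?S. ?o y = ?o x}"
        then obtain h where h: "h \<in> H" "y = \<phi> h x" using orbit_eqD[OF H, of y x] by blast
        have "dist b y \<le> real n" using y by (auto simp: orbit_ball_def)
        hence "dist (\<phi> (inv h) b) x \<le> real n"
          using act_dist_shift[of "inv h" b x] c[OF h(1)] h(2) by simp
        moreover have "inv h \<in> H" using subgroup.m_inv_closed[OF H h(1)] .
        moreover have "y = \<phi> (inv (inv h)) x" using h c by simp
        ultimately show "y \<in> (\<lambda>h. \<phi> (inv h) x) ` {h \<in> H. dist (\<phi> h b) x \<le> real n}" by blast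
      qed
      from surj_card_le[OF few(2)[OF x] this]
      show "card {y \<in> ?S. ?o y = ?o x} \<le> K" using few(1)[OF x] by linarith
    qed
    also have "card (?o ` ?S) \<le> card (quotient_ball \<Gamma> H \<phi> b n)"
    proof (rule card_mono[OF finite_quotient_ball[OF H]])
      show "?o ` ?S \<subseteq> quotient_ball \<Gamma> H \<phi> b n"
      proof
        fix Q assume "Q \<in> ?o ` ?S"
        then obtain g where g: "g \<in> carrier \<Gamma>" "Q = ?o (\<phi> g b)" "dist b (\<phi> g b) \<le> real n"
          by (auto simp: orbit_ball_def)
        moreover have "quotient_dist H \<phi> b (\<phi> g b) \<le> real n"
          using quotient_dist_le[OF H subgroup.one_closed[OF H], of "\<phi> g b"] g(3) by simp
        ultimately show "Q \<in> quotient_ball \<Gamma> H \<phi> b n" unfolding quotient_ball_def by blast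
      qed
    qed
    finally have "card ?S \<le> card (quotient_ball \<Gamma> H \<phi> b n) * K" by simp
    hence "real (card ?S) \<le> real (card (quotient_ball \<Gamma> H \<phi> b n)) * real K"
      by (simp only: of_nat_mult[symmetric] of_nat_le_iff)
    also have "\<dots> \<le> real (card (quotient_ball \<Gamma> H \<phi> b n)) * (real K + 1)" by (intro mult_left_mono) auto
    finally have S2: "real (card ?S) * ?e \<le> real (card (quotient_ball \<Gamma> H \<phi> b n)) * (real K + 1) * ?e"
      by (rule mult_right_mono) simp
    from order_trans[OF S S2]
    have "measure \<mu> A' * exp (\<omega> * real n) \<le> real (card (quotient_ball \<Gamma> H \<phi> b n)) * (?e * (real K + 1))"
      by (simp only: mult_ac)
    moreover have "?e * (real K + 1) > 0" by (simp add: add_nonneg_pos)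
    ultimately show "measure \<mu> A' / (?e * (real K + 1)) * exp (\<omega> * real n) \<le> real (card (quotient_ball \<Gamma> H \<phi> b n))"
      by (simp add: pos_divide_le_eq)
  qed
qed

lemma small_quotient_imp_recurrent:
  assumes H: "subgroup H \<Gamma>"
    and lim: "(\<lambda>n. real (card (quotient_ball \<Gamma> H \<phi> b n)) / real (card (orbit_ball \<Gamma> \<phi> b n))) \<longlonglongrightarrow> 0"
    and A: "A \<in> sets \<mu>" "A \<subseteq> boundary_part b" "measure \<mu> A > 0"
  shows "\<exists>h\<in>H - {\<one>}. gact h ` A \<inter> A \<noteq> {}"
proof (rule ccontr)
  assume "\<not> ?thesis"
  hence wand: "gact h ` A \<inter> A = {}" if "h \<in> H" "h \<noteq> \<one>" for h using that by blast
  obtain c where c: "c > 0" "\<And>n::nat. real n \<ge> D \<Longrightarrow> real (card (quotient_ball \<Gamma> H \<phi> b n)) \<ge> c * exp (\<omega> * real n)"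
    using wandering_imp_large_quotient[OF H A wand] by blast
  obtain C where C: "C > 0" "\<And>x. real (card (gball x)) \<le> C * exp (\<omega> * x)" using growth_upper by blast
  have "c / C \<le> real (card (quotient_ball \<Gamma> H \<phi> b n)) / real (card (orbit_ball \<Gamma> \<phi> b n))" if n: "n \<ge> nat \<lceil>D\<rceil>" for n
  proof -
    have nD: "real n \<ge> D" using n by linarith
    have "real (card (orbit_ball \<Gamma> \<phi> b n)) \<le> C * exp (\<omega> * real n)"
      using card_orbit_ball_le[of n] C(2)[of "real n"] by linarith
    moreover have "real (card (orbit_ball \<Gamma> \<phi> b n)) > 0" using orbit_ball_pos[of n] by linarith
    ultimately have "c * exp (\<omega> * real n) / (C * exp (\<omega> * real n)) \<le> real (card (quotient_ball \<Gamma> H \<phi> b n)) / real (card (orbit_ball \<Gamma> \<phi> b n))"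
      using c(2)[OF nD] c(1) by (intro frac_le) auto
    thus ?thesis by simp
  qed
  hence "c / C \<le> 0" by (intro LIMSEQ_le_const[OF lim]) blast
  thus False using c(1) C(1) by (simp add: divide_le_0_iff)
qed

section \<open>From exponentially many orbits to a set with bounded returns\<close>

lemma orbit_representatives:
  assumes H: "subgroup H \<Gamma>"
  obtains R where "finite R" "R \<subseteq> carrier \<Gamma>" "card R = card (quotient_ball \<Gamma> H \<phi> b n)"
    "\<And>g. g \<in> R \<Longrightarrow> len g \<le> real n + 1"
    "\<And>g h. g \<in> R \<Longrightarrow> h \<in> H \<Longrightarrow> dist (\<phi> h b) (\<phi> g b) \<ge> len g - 1"
    "\<And>g g' h. g \<in> R \<Longrightarrow> g' \<in> R \<Longrightarrow> h \<in> H \<Longrightarrow> \<phi> h (\<phi> g b) = \<phi> g' b \<Longrightarrow> g = g'"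
proof -
  let ?o = "orbit (\<Gamma>\<lparr>carrier := H\<rparr>) \<phi>" and ?Q = "quotient_ball \<Gamma> H \<phi> b n"
  have c: "k \<in> carrier \<Gamma>" if "k \<in> H" for k using subgroup_carrier[OF H that] .
  have "\<forall>Q\<in>?Q. \<exists>g\<in>carrier \<Gamma>. Q = ?o (\<phi> g b) \<and> len g \<le> real n + 1 \<and>
    (\<forall>h\<in>H. dist (\<phi> h b) (\<phi> g b) \<ge> len g - 1)"
  proof
    fix Q assume "Q \<in> ?Q"
    then obtain g where g: "g \<in> carrier \<Gamma>" "Q = ?o (\<phi> g b)" "quotient_dist H \<phi> b (\<phi> g b) \<le> real n"
      by (auto simp: quotient_ball_def)
    \<comment> \<open>A point of the orbit that is nearest to \<open>b\<close> up to 1; this 1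
      reappears in the length bound and in \<open>len g - 1\<close>.\<close>
    obtain h where h: "h \<in> H" "dist b (\<phi> h (\<phi> g b)) < quotient_dist H \<phi> b (\<phi> g b) + 1"
      using quotient_dist_approx[OF H] by blast
    let ?g = "h \<otimes> g"
    have gc: "?g \<in> carrier \<Gamma>" "Q = ?o (\<phi> ?g b)" using g h c orbit_act[OF H h(1)] by (simp_all add: act_mult)
    have lg: "len ?g < quotient_dist H \<phi> b (\<phi> g b) + 1" using h(2) g(1) c[OF h(1)] by (simp add: len_def act_mult)
    have "dist (\<phi> k b) (\<phi> ?g b) \<ge> len ?g - 1" if k: "k \<in> H" for k
    proof -
      have kh: "inv k \<otimes> h \<in> H" using k h(1) H by (simp add: subgroup.m_closed subgroup.m_inv_closed)
      have "quotient_dist H \<phi> b (\<phi> g b) \<le> dist b (\<phi> (inv k \<otimes> h) (\<phi> g b))" by (rule quotient_dist_le[OF H kh])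
      also have "\<dots> = dist (\<phi> k b) (\<phi> ?g b)"
        using act_dist_shift[of k b "\<phi> ?g b"] c[OF k] c[OF h(1)] g(1) by (simp add: act_mult)
      finally show ?thesis using lg by linarith
    qed
    thus "\<exists>g\<in>carrier \<Gamma>. Q = ?o (\<phi> g b) \<and> len g \<le> real n + 1 \<and> (\<forall>h\<in>H. dist (\<phi> h b) (\<phi> g b) \<ge> len g - 1)"
      using gc lg g(3) by (intro bexI[of _ ?g]) auto
  qed
  then obtain r where r: "\<And>Q. Q \<in> ?Q \<Longrightarrow> r Q \<in> carrier \<Gamma> \<and> Q = ?o (\<phi> (r Q) b) \<and> len (r Q) \<le> real n + 1 \<and>
    (\<forall>h\<in>H. dist (\<phi> h b) (\<phi> (r Q) b) \<ge> len (r Q) - 1)" by metis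
  have "inj_on r ?Q" by (rule inj_onI) (metis r)
  show thesis
  proof (rule that[of "r ` ?Q"])
    show "finite (r ` ?Q)" using finite_quotient_ball[OF H] by simp
    show "card (r ` ?Q) = card ?Q" by (rule card_image) fact
    fix g g' h assume *: "g \<in> r ` ?Q" "g' \<in> r ` ?Q" "h \<in> H" "\<phi> h (\<phi> g b) = \<phi> g' b"
    then obtain Q Q' where Q: "Q \<in> ?Q" "Q' \<in> ?Q" "g = r Q" "g' = r Q'" by blast
    have "?o (\<phi> g b) = ?o (\<phi> g' b)" using orbit_act[OF H *(3), of "\<phi> g b"] *(4) by simp
    hence "Q = Q'" using r Q by metis
    thus "g = g'" using Q by simp
  qed (use r in auto)
qed

text \<open>Each point of the quotient is reached from the base point by as many geodesics of length at
  most \<open>n + m\<close> as there are \<open>h \<in> H\<close> with \<open>d(h b, g b) \<le> n + m\<close>, and all these geodesics together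
  number at most \<open>#N\<^sub>\<Gamma>(b, n + m)\<close>. Hence a positive proportion of quotient points of norm
  about \<open>n\<close> are reached a bounded number of times.\<close>

lemma large_quotient_imp_good_representatives:
  assumes H: "subgroup H \<Gamma>" and c: "c > 0"
  obtains L and K :: nat where "L \<ge> 0" and "\<And>n. real (card (quotient_ball \<Gamma> H \<phi> b n)) \<ge> c * exp (\<omega> * real n) \<Longrightarrow>
    \<exists>G. finite G \<and> G \<subseteq> carrier \<Gamma> \<and> real (card G) \<ge> c / 2 * exp (\<omega> * real n) \<and>
      (\<forall>g\<in>G. real n - L \<le> len g \<and> len g \<le> real n + 1 \<and> (\<forall>h\<in>H. dist (\<phi> h b) (\<phi> g b) \<ge> len g - 1) \<and>
        card {h \<in> H. dist (\<phi> h b) (\<phi> g b) \<le> real n + m} \<le> K)"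
proof -
  have Hc: "k \<in> carrier \<Gamma>" if "k \<in> H" for k using subgroup_carrier[OF H that] .
  obtain C where C: "C > 0" "\<And>x. real (card (gball x)) \<le> C * exp (\<omega> * x)" using growth_upper by blast
  \<comment> \<open>Elements shorter than n - L number at most c / 4 times exp(\<omega> n).\<close>
  define L where "L = max 0 (ln (4 * C / c) / \<omega>)"
  have L: "C * exp (- \<omega> * L) \<le> c / 4"
  proof -
    have "\<omega> * L \<ge> ln (4 * C / c)" using \<omega>_pos by (simp add: L_def field_simps max_def)
    hence "exp (\<omega> * L) \<ge> 4 * C / c" using C(1) c by (metis divide_pos_pos exp_le_cancel_iff exp_ln mult_pos_pos zero_less_numeral)
    hence "4 * C \<le> exp (\<omega> * L) * c" using c by (simp add: field_simps)
    thus ?thesis using exp_minus_mult_le_iff[of \<omega> L "4 * C" c] by (simp add: mult_ac)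
  qed
  \<comment> \<open>Markov threshold: at most c / 4 times exp(\<omega> n) representatives exceed it,
    so removing both bad sets leaves half of the assumed number.\<close>
  obtain K :: nat where K: "4 * C * exp (\<omega> * m) / c \<le> real K" using real_arch_simple by blast
  show thesis
  proof (rule that[of L K])
    show "L \<ge> 0" by (simp add: L_def)
    fix n assume Q: "real (card (quotient_ball \<Gamma> H \<phi> b n)) \<ge> c * exp (\<omega> * real n)"
    let ?e = "exp (\<omega> * real n)"
    obtain R where R: "finite R" "R \<subseteq> carrier \<Gamma>" "card R = card (quotient_ball \<Gamma> H \<phi> b n)"
      "\<And>g. g \<in> R \<Longrightarrow> len g \<le> real n + 1"
      "\<And>g h. g \<in> R \<Longrightarrow> h \<in> H \<Longrightarrow> dist (\<phi> h b) (\<phi> g b) \<ge> len g - 1"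
      "\<And>g g' h. g \<in> R \<Longrightarrow> g' \<in> R \<Longrightarrow> h \<in> H \<Longrightarrow> \<phi> h (\<phi> g b) = \<phi> g' b \<Longrightarrow> g = g'"
      using orbit_representatives[OF H, of n] by blast
    let ?J = "\<lambda>g. {h \<in> H. dist (\<phi> h b) (\<phi> g b) \<le> real n + m}"
    have Jf: "finite (?J g)" for g by (rule finite_orbit_near) (use Hc in blast)
    let ?B1 = "{g \<in> R. len g < real n - L}" and ?B2 = "{g \<in> R. card (?J g) > K}"
    have "?B1 \<subseteq> gball (real n - L)" using R(2) by (auto simp: gball_def)
    hence "card ?B1 \<le> card (gball (real n - L))" by (rule card_mono[OF finite_gball])
    hence "real (card ?B1) \<le> C * exp (\<omega> * (real n - L))" using C(2)[of "real n - L"] by linarith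
    also have "\<dots> = (C * exp (- \<omega> * L)) * ?e" by (simp add: exp_add[symmetric] algebra_simps)
    also have "\<dots> \<le> c / 4 * ?e" by (rule mult_right_mono[OF L]) simp
    finally have B1: "real (card ?B1) \<le> c / 4 * ?e" .
    have "(\<Sum>g\<in>R. card (?J g)) = card (SIGMA g:R. ?J g)" using R(1) Jf by simp
    \<comment> \<open>Double counting: \<open>inv h \<otimes> g\<close> determines the orbit, hence
      the representative \<open>g\<close>, hence \<open>h\<close>; its length is d(h b, g
      b).\<close>
    also have "\<dots> \<le> card (gball (real n + m))"
    proof (rule card_inj_on_le[of "\<lambda>(g, h). inv h \<otimes> g"])
      show "inj_on (\<lambda>(g, h). inv h \<otimes> g) (SIGMA g:R. ?J g)"
      proof (rule inj_onI, clarify)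
        fix g h g' h'
        assume *: "g \<in> R" "h \<in> H" "g' \<in> R" "h' \<in> H" "inv h \<otimes> g = inv h' \<otimes> g'"
        have cs: "g \<in> carrier \<Gamma>" "g' \<in> carrier \<Gamma>" "h \<in> carrier \<Gamma>" "h' \<in> carrier \<Gamma>" using * R(2) Hc by auto
        have "\<phi> (h' \<otimes> inv h) (\<phi> g b) = \<phi> h' (\<phi> (inv h \<otimes> g) b)" using cs by (simp add: act_mult)
        also have "\<dots> = \<phi> g' b" unfolding *(5) using cs by (simp add: act_mult)
        finally have "\<phi> (h' \<otimes> inv h) (\<phi> g b) = \<phi> g' b" .
        moreover have "h' \<otimes> inv h \<in> H" using *(2,4) H by (simp add: subgroup.m_closed subgroup.m_inv_closed)
        ultimately have gg: "g = g'" using R(6) * by blast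
        hence "inv h = inv h'" using *(5) cs by simp
        hence "h = h'" using cs by (metis \<Gamma>.inv_inv)
        thus "g = g' \<and> h = h'" using gg by simp
      qed
      show "(\<lambda>(g, h). inv h \<otimes> g) ` (SIGMA g:R. ?J g) \<subseteq> gball (real n + m)"
      proof clarify
        fix g h assume *: "g \<in> R" "h \<in> H" "dist (\<phi> h b) (\<phi> g b) \<le> real n + m"
        have cs: "g \<in> carrier \<Gamma>" "h \<in> carrier \<Gamma>" using * R(2) Hc by auto
        have "len (inv h \<otimes> g) = dist (\<phi> h b) (\<phi> g b)"
          using cs act_dist_shift[of h b "\<phi> g b"] by (simp add: len_def act_mult)
        thus "inv h \<otimes> g \<in> gball (real n + m)" using *(3) cs by (simp add: gball_def)
      qed
    qed simp
    finally have sumJ: "(\<Sum>g\<in>R. real (card (?J g))) \<le> C * exp (\<omega> * (real n + m))"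
      using C(2)[of "real n + m"] by (simp flip: of_nat_sum)
    have "real (card ?B2) * real K \<le> (\<Sum>g\<in>?B2. real (card (?J g)))"
      by (rule sum_bounded_below) auto
    also have "\<dots> \<le> (\<Sum>g\<in>R. real (card (?J g)))" by (rule sum_mono2[OF R(1)]) auto
    also have "\<dots> \<le> C * exp (\<omega> * (real n + m))" by (rule sumJ)
    also have "\<dots> = (4 * C * exp (\<omega> * m) / c) * (c / 4 * ?e)" using c by (simp add: exp_add field_simps)
    also have "\<dots> \<le> real K * (c / 4 * ?e)" by (rule mult_right_mono[OF K]) (use c in simp)
    finally have KB: "real (card ?B2) * real K \<le> (c / 4 * ?e) * real K" by (simp only: mult.commute)
    have "0 < 4 * C * exp (\<omega> * m) / c" using C(1) c by simp
    hence "real K > 0" using K by linarith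
    hence B2: "real (card ?B2) \<le> c / 4 * ?e" using KB by (simp only: mult_le_cancel_right)
    let ?G = "R - (?B1 \<union> ?B2)"
    have "real (card R) - real (card (?B1 \<union> ?B2)) \<le> real (card ?G)"
      using diff_card_le_card_Diff[of "?B1 \<union> ?B2" R] R(1) by simp
    moreover have "real (card (?B1 \<union> ?B2)) \<le> real (card ?B1) + real (card ?B2)"
      using card_Un_le[of ?B1 ?B2] by linarith
    ultimately have G: "real (card ?G) \<ge> c / 2 * ?e" using B1 B2 Q R(3) by linarith
    show "\<exists>G. finite G \<and> G \<subseteq> carrier \<Gamma> \<and> real (card G) \<ge> c / 2 * exp (\<omega> * real n) \<and>
      (\<forall>g\<in>G. real n - L \<le> len g \<and> len g \<le> real n + 1 \<and> (\<forall>h\<in>H. dist (\<phi> h b) (\<phi> g b) \<ge> len g - 1) \<and>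
        card {h \<in> H. dist (\<phi> h b) (\<phi> g b) \<le> real n + m} \<le> K)"
    proof (rule exI[of _ ?G], intro conjI ballI)
      show "finite ?G" "?G \<subseteq> carrier \<Gamma>" using R(1,2) by auto
      show "c / 2 * exp (\<omega> * real n) \<le> real (card ?G)" by (rule G)
      fix g assume g: "g \<in> ?G"
      show "real n - L \<le> len g" "card (?J g) \<le> K" using g by auto
      show "len g \<le> real n + 1" using g R(4) by blast
      fix h assume "h \<in> H"
      thus "len g - 1 \<le> dist (\<phi> h b) (\<phi> g b)" using g R(5) by blast
    qed
  qed
qed

text \<open>Suppose \<open>p\<close> and its translate by \<open>h\<close> lie in \<open>E\<close>.
  The translate is in a deep shadow of a nearest representative, so \<open>h b\<close> is hardly
  closer to it than \<open>b\<close>. Applying \<open>inv h\<close>, the image of \<open>b\<close>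
  under \<open>inv h\<close> is hardly farther from \<open>p\<close> than \<open>b\<close>, hence
  within n + m of any chosen \<open>g b\<close> at level \<open>n\<close> whose shadow contains
  \<open>p\<close>; such elements number at most \<open>K\<close>. The mass of the limit superior is
  at least the uniform bound \<open>c2\<close> for the levels.\<close>

lemma limsup_shadows:
  assumes H: "subgroup H \<Gamma>" and c: "c > 0"
    and freq: "\<And>N. \<exists>n\<ge>N. real (card (quotient_ball \<Gamma> H \<phi> b n)) \<ge> c * exp (\<omega> * real n)"
  obtains E and K :: nat where "E \<in> sets \<mu>" "E \<subseteq> boundary_part b" "measure \<mu> E > 0"
    "\<forall>p\<in>E. \<forall>J. finite J \<longrightarrow> J \<subseteq> H \<longrightarrow> (\<forall>h\<in>J. gact h p \<in> E) \<longrightarrow> card J \<le> K"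
proof -
  have Hc: "k \<in> carrier \<Gamma>" if "k \<in> H" for k using subgroup_carrier[OF H that] .
  \<comment> \<open>1 from nearest points being taken up to 1, 4 \<delta> from two uses of
    \<open>busemann_stable\<close>, 1 from \<open>len g \<le> real n + 1\<close>.\<close>
  define m where "m = 2 + 4 * \<delta>"
  obtain L and K :: nat where L: "L \<ge> 0" and good: "\<And>n. real (card (quotient_ball \<Gamma> H \<phi> b n)) \<ge> c * exp (\<omega> * real n) \<Longrightarrow>
    \<exists>G. finite G \<and> G \<subseteq> carrier \<Gamma> \<and> real (card G) \<ge> c / 2 * exp (\<omega> * real n) \<and>
      (\<forall>g\<in>G. real n - L \<le> len g \<and> len g \<le> real n + 1 \<and> (\<forall>h\<in>H. dist (\<phi> h b) (\<phi> g b) \<ge> len g - 1) \<and>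
        card {h \<in> H. dist (\<phi> h b) (\<phi> g b) \<le> real n + m} \<le> K)"
    using large_quotient_imp_good_representatives[OF H c, of m] by blast
  define I where "I = {n. real (card (quotient_ball \<Gamma> H \<phi> b n)) \<ge> c * exp (\<omega> * real n)}"
  have "\<forall>n\<in>I. \<exists>G. finite G \<and> G \<subseteq> carrier \<Gamma> \<and> real (card G) \<ge> c / 2 * exp (\<omega> * real n) \<and>
      (\<forall>g\<in>G. real n - L \<le> len g \<and> len g \<le> real n + 1 \<and> (\<forall>h\<in>H. dist (\<phi> h b) (\<phi> g b) \<ge> len g - 1) \<and>
        card {h \<in> H. dist (\<phi> h b) (\<phi> g b) \<le> real n + m} \<le> K)"
    using good by (simp add: I_def)
  from bchoice[OF this] obtain G where G': "\<forall>n\<in>I. finite (G n) \<and> G n \<subseteq> carrier \<Gamma> \<and> real (card (G n)) \<ge> c / 2 * exp (\<omega> * real n) \<and>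
      (\<forall>g\<in>G n. real n - L \<le> len g \<and> len g \<le> real n + 1 \<and> (\<forall>h\<in>H. dist (\<phi> h b) (\<phi> g b) \<ge> len g - 1) \<and>
        card {h \<in> H. dist (\<phi> h b) (\<phi> g b) \<le> real n + m} \<le> K)" ..
  have G: "finite (G n)" "G n \<subseteq> carrier \<Gamma>" "real (card (G n)) \<ge> c / 2 * exp (\<omega> * real n)"
    "g \<in> G n \<Longrightarrow> real n - L \<le> len g \<and> len g \<le> real n + 1"
    "g \<in> G n \<Longrightarrow> h \<in> H \<Longrightarrow> dist (\<phi> h b) (\<phi> g b) \<ge> len g - 1"
    "g \<in> G n \<Longrightarrow> card {h \<in> H. dist (\<phi> h b) (\<phi> g b) \<le> real n + m} \<le> K"
    if "n \<in> I" for n g h using bspec[OF G' that] by auto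
  define U where "U n = (\<Union>g\<in>G n. Sh (\<phi> g b))" for n
  have Um: "U n \<in> sets \<mu>" if "n \<in> I" for n unfolding U_def using G(1)[OF that] by auto
  let ?k = "real (card (gball (L + 1 + 2 * \<rho> + 2 * \<delta>)))"
  define c2 where "c2 = c / 2 * c\<^sub>0 * exp (- \<omega>) / (?k + 1)"
  have c2: "c2 > 0" unfolding c2_def using c c\<^sub>0(1) by (intro divide_pos_pos mult_pos_pos) (auto simp: add_nonneg_pos)
  have Ul: "measure \<mu> (U n) \<ge> c2" if n: "n \<in> I" for n
  proof -
    have "c / 2 * exp (\<omega> * real n) * (c\<^sub>0 * exp (- \<omega> * (real n + 1))) \<le> real (card (G n)) * (c\<^sub>0 * exp (- \<omega> * (real n + 1)))"
      using G(3)[OF n] c\<^sub>0(1) by (intro mult_right_mono) auto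
    also have "\<dots> \<le> (\<Sum>g\<in>G n. measure \<mu> (Sh (\<phi> g b)))"
    proof (rule sum_bounded_below)
      fix g assume g: "g \<in> G n"
      have "len g \<le> real n + 1" using G(4)[OF n g] by simp
      from mult_left_mono[OF this \<omega>_nonneg]
      have "exp (- \<omega> * (real n + 1)) \<le> exp (- \<omega> * len g)" by simp
      hence "c\<^sub>0 * exp (- \<omega> * (real n + 1)) \<le> c\<^sub>0 * exp (- \<omega> * len g)" using c\<^sub>0(1) by simp
      also have "\<dots> \<le> measure \<mu> (Sh (\<phi> g b))" using g c\<^sub>0(2) G(2)[OF n] by blast
      finally show "c\<^sub>0 * exp (- \<omega> * (real n + 1)) \<le> measure \<mu> (Sh (\<phi> g b))" .
    qed
    also have "\<dots> \<le> ?k * measure \<mu> (U n)"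
      unfolding U_def by (rule sum_shadows_le[OF G(1,2)[OF n], of "real n - L"]) (use G(4)[OF n] in force)
    also have "\<dots> \<le> (?k + 1) * measure \<mu> (U n)" by (intro mult_right_mono) auto
    also have "c / 2 * exp (\<omega> * real n) * (c\<^sub>0 * exp (- \<omega> * (real n + 1)))
        = c / 2 * c\<^sub>0 * (exp (\<omega> * real n) * exp (- \<omega> * (real n + 1)))" by (simp only: mult_ac)
    also have "exp (\<omega> * real n) * exp (- \<omega> * (real n + 1)) = exp (- \<omega>)"
      unfolding exp_add[symmetric] by (rule arg_cong[of _ _ exp]) (simp add: algebra_simps)
    finally have "c / 2 * c\<^sub>0 * exp (- \<omega>) \<le> measure \<mu> (U n) * (?k + 1)" by (simp only: mult.commute)
    thus ?thesis unfolding c2_def by (subst pos_divide_le_eq) (auto simp: add_nonneg_pos)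
  qed
  define F where "F N = (\<Union>n\<in>I \<inter> {N..}. U n)" for N
  have Fm: "F N \<in> sets \<mu>" for N unfolding F_def using Um by (intro sets.countable_UN') auto
  have Fl: "measure \<mu> (F N) \<ge> c2" for N
  proof -
    obtain n where n: "n \<ge> N" "n \<in> I" using freq[of N] by (auto simp: I_def)
    hence "U n \<subseteq> F N" unfolding F_def by auto
    hence "measure \<mu> (U n) \<le> measure \<mu> (F N)" by (intro finite_measure_mono Fm)
    thus ?thesis using Ul[OF n(2)] by linarith
  qed
  have "(\<lambda>N. measure \<mu> (F N)) \<longlonglongrightarrow> measure \<mu> (\<Inter>N. F N)"
  proof (rule finite_Lim_measure_decseq)
    show "decseq F" unfolding F_def decseq_def by fastforce
  qed (use Fm in auto)
  hence Fl2: "measure \<mu> (\<Inter>N. F N) \<ge> c2" by (rule LIMSEQ_le_const) (use Fl in auto)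
  have IFm: "(\<Inter>N. F N) \<in> sets \<mu>" using Fm by auto
  define E where "E = (\<Inter>N. F N) \<inter> boundary_part b"
  have Em: "E \<in> sets \<mu>" unfolding E_def using IFm boundary_sets by auto
  show thesis
  proof (rule that[of E K])
    show "E \<in> sets \<mu>" "E \<subseteq> boundary_part b" using Em by (auto simp: E_def)
    have bm: "space \<mu> - boundary_part b \<in> sets \<mu>" by (rule sets.compl_sets[OF boundary_sets])
    have "measure \<mu> (\<Inter>N. F N) \<le> measure \<mu> (E \<union> (space \<mu> - boundary_part b))"
      using Em bm sets.sets_into_space[OF IFm] by (intro finite_measure_mono) (auto simp: E_def)
    also have "\<dots> \<le> measure \<mu> E + measure \<mu> (space \<mu> - boundary_part b)"
      by (rule measure_Un_le[OF Em bm])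
    also have "measure \<mu> (space \<mu> - boundary_part b) = 0"
      using prob_compl[OF boundary_sets] measure_boundary by simp
    finally show "measure \<mu> E > 0" using Fl2 c2 by linarith
    show "\<forall>p\<in>E. \<forall>J. finite J \<longrightarrow> J \<subseteq> H \<longrightarrow> (\<forall>h\<in>J. gact h p \<in> E) \<longrightarrow> card J \<le> K"
    proof (intro ballI allI impI)
      fix p J assume p: "p \<in> E" and J: "finite J" "J \<subseteq> H" "\<forall>h\<in>J. gact h p \<in> E"
      obtain \<xi> where \<xi>: "p = Inr \<xi>" "\<xi> \<in> gromov_boundary b" using p by (auto simp: E_def boundary_part_iff)
      define l where "l = Max (insert 0 (len ` J))"
      have l: "len h \<le> l" if "h \<in> J" for h unfolding l_def by (rule Max_ge) (use J that in auto)
      \<comment> \<open>At levels beyond \<open>N\<close> the shadows are deep enough for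
        \<open>busemann_stable\<close> to apply to every element of \<open>J\<close>.\<close>
      define N where "N = nat \<lceil>l + \<delta> + L + \<rho> + 1\<rceil>"
      have N: "real n - L - \<rho> > len h + \<delta>" if "n \<ge> N" "h \<in> J" for n h
      proof -
        have "real N \<ge> l + \<delta> + L + \<rho> + 1" unfolding N_def by linarith
        moreover have "real n \<ge> real N" using that(1) by simp
        ultimately show ?thesis using l[OF that(2)] by linarith
      qed
      have ex: "\<exists>n\<ge>N. n \<in> I \<and> (\<exists>g\<in>G n. q \<in> Sh (\<phi> g b))" if "q \<in> E" for q
      proof -
        have "q \<in> F N" using that unfolding E_def by blast
        thus ?thesis unfolding F_def U_def by auto
      qed
      obtain n g where n: "n \<ge> N" "n \<in> I" and g: "g \<in> G n" "p \<in> Sh (\<phi> g b)" using ex[OF p] by blast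
      have "\<forall>h\<in>J. \<exists>n' g'. n' \<ge> N \<and> n' \<in> I \<and> g' \<in> G n' \<and> gact h p \<in> Sh (\<phi> g' b)" using ex J(3) by blast
      then obtain n' g' where n': "\<And>h. h \<in> J \<Longrightarrow> n' h \<ge> N \<and> n' h \<in> I \<and> g' h \<in> G (n' h) \<and> gact h p \<in> Sh (\<phi> (g' h) b)"
        by metis
      obtain u where u: "u \<in> \<xi>" using \<xi> boundary_nonempty by blast
      \<comment> \<open>Shadows are open, so one late term of \<open>u\<close> can replace
        \<open>p\<close> in its own shadow and, for all \<open>h\<close> in \<open>J\<close> at
        once, in the shadows of the translates.\<close>
      have "\<forall>\<^sub>F i in sequentially. Inl (u i) \<in> Sh (\<phi> g b)"
        by (rule boundary_eventually_open[OF _ _ u]) (use g \<xi> in auto)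
      moreover have "\<forall>\<^sub>F i in sequentially. \<forall>h\<in>J. Inl (\<phi> h (u i)) \<in> Sh (\<phi> (g' h) b)"
      proof (intro eventually_ball_finite J(1) ballI)
        fix h assume h: "h \<in> J"
        have "\<forall>\<^sub>F i in sequentially. Inl ((\<phi> h \<circ> u) i) \<in> Sh (\<phi> (g' h) b)"
        proof (rule boundary_eventually_open[of _ "gbd h \<xi>"])
          show "Inr (gbd h \<xi>) \<in> Sh (\<phi> (g' h) b)" using n'[OF h] \<xi> by simp
          show "\<phi> h \<circ> u \<in> gbd h \<xi>" unfolding gbd_def using u by (rule imageI)
        qed simp
        thus "\<forall>\<^sub>F i in sequentially. Inl (\<phi> h (u i)) \<in> Sh (\<phi> (g' h) b)" by simp
      qed
      ultimately have "\<forall>\<^sub>F i in sequentially. Inl (u i) \<in> Sh (\<phi> g b) \<and> (\<forall>h\<in>J. Inl (\<phi> h (u i)) \<in> Sh (\<phi> (g' h) b))"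
        by (rule eventually_conj)
      then obtain i where i: "Inl (u i) \<in> Sh (\<phi> g b)" "\<And>h. h \<in> J \<Longrightarrow> Inl (\<phi> h (u i)) \<in> Sh (\<phi> (g' h) b)"
        by (auto simp: eventually_sequentially)
      let ?q = "u i"
      have close: "dist (\<phi> (inv h) b) (\<phi> g b) \<le> real n + m" if h: "h \<in> J" for h
      proof -
        have hc: "h \<in> carrier \<Gamma>" "h \<in> H" using h J(2) Hc by auto
        let ?p = "\<phi> h ?q" and ?x = "\<phi> (g' h) b"
        have g'l: "real (n' h) - L \<le> len (g' h)" "dist (\<phi> h b) ?x \<ge> len (g' h) - 1"
          using n'[OF h] G(4)[of "n' h" "g' h"] G(5)[of "n' h" "g' h" h] hc by auto
        have "gp ?p ?x > dist b (\<phi> h b) + \<delta>"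
          using shadow_gp[OF i(2)[OF h]] N[of "n' h" h] n'[OF h] h g'l(1) by (simp add: len_def)
        from busemann_stable[OF this] have "dist (\<phi> h b) ?p - dist b ?p \<ge> - 1 - 2 * \<delta>"
          using g'l(2) by (simp add: len_def abs_le_iff)
        moreover have "dist b ?p = dist (\<phi> (inv h) b) ?q" using act_dist_shift[of "inv h" b ?q] hc by simp
        ultimately have 1: "dist (\<phi> (inv h) b) ?q - dist b ?q \<le> 1 + 2 * \<delta>" using hc by simp
        have "gp ?q (\<phi> g b) > dist b (\<phi> (inv h) b) + \<delta>"
          using shadow_gp[OF i(1)] N[OF n(1) h] G(4)[OF n(2) g(1)] len_inv[OF hc(1)] by (simp add: len_def)
        from busemann_stable[OF this] have "dist (\<phi> (inv h) b) (\<phi> g b) - len g \<le> 1 + 4 * \<delta>"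
          using 1 by (simp add: len_def abs_le_iff)
        thus ?thesis using G(4)[OF n(2) g(1)] by (simp add: m_def)
      qed
      have "(\<lambda>h. inv h) ` J \<subseteq> {h \<in> H. dist (\<phi> h b) (\<phi> g b) \<le> real n + m}"
        using close J(2) subgroup.m_inv_closed[OF H] by auto
      moreover have "inj_on (\<lambda>h. inv h) J" using J(2) Hc by (intro inj_onI) (metis \<Gamma>.inv_inv subsetD)
      moreover have "finite {h \<in> H. dist (\<phi> h b) (\<phi> g b) \<le> real n + m}"
        by (rule finite_orbit_near) (use Hc in blast)
      ultimately have "card J \<le> card {h \<in> H. dist (\<phi> h b) (\<phi> g b) \<le> real n + m}"
        by (intro card_inj_on_le)
      thus "card J \<le> K" using G(6)[OF n(2) g(1)] by linarith
    qed
  qed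
qed

text \<open>Upgrades nonempty returns to returns of positive mass. If all were null, removing
  countably many null sets from \<open>B\<close> would leave a set of the same mass without any
  return.\<close>

lemma recurrent_positive:
  assumes H: "subgroup H \<Gamma>"
    and rec: "\<And>A. A \<in> sets \<mu> \<Longrightarrow> A \<subseteq> boundary_part b \<Longrightarrow> measure \<mu> A > 0 \<Longrightarrow> \<exists>h\<in>H - {\<one>}. gact h ` A \<inter> A \<noteq> {}"
    and B: "B \<in> sets \<mu>" "B \<subseteq> boundary_part b" "measure \<mu> B > 0"
  obtains h where "h \<in> H" "h \<noteq> \<one>" "measure \<mu> (gact h ` B \<inter> B) > 0"
proof (rule ccontr)
  note wit = that
  assume no: "\<not> thesis"
  have zero: "measure \<mu> (gact h ` B \<inter> B) = 0" if "h \<in> H" "h \<noteq> \<one>" for h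
    using no wit[OF that] by (auto simp: zero_less_measure_iff)
  have gm: "gact h ` B \<inter> B \<in> sets \<mu>" if "h \<in> H" for h
    using gact_sets[OF subgroup_carrier[OF H that] B(1)] B(1) by auto
  have cH: "countable (H - {\<one>})" using countable_carrier subgroup.subset[OF H] countable_subset by blast
  let ?Z = "\<Union>h\<in>H - {\<one>}. gact h ` B \<inter> B"
  have Z: "?Z \<in> null_sets \<mu>"
    by (rule null_sets_UN'[OF cH]) (use gm zero in \<open>auto simp: null_sets_def emeasure_eq_measure\<close>)
  have "measure \<mu> (B - ?Z) = measure \<mu> B" using measure_Diff_null_set[OF B(1) Z] .
  moreover have "B - ?Z \<in> sets \<mu>" using B(1) Z by auto
  moreover have "B - ?Z \<subseteq> boundary_part b" using B(2) by blast
  ultimately have "\<exists>h\<in>H - {\<one>}. gact h ` (B - ?Z) \<inter> (B - ?Z) \<noteq> {}"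
    using rec[of "B - ?Z"] B(3) by simp
  then obtain h where h: "h \<in> H" "h \<noteq> \<one>" "gact h ` (B - ?Z) \<inter> (B - ?Z) \<noteq> {}" by blast
  then obtain p where "p \<in> gact h ` B" "p \<in> B" "p \<notin> ?Z" by blast
  thus False using h(1,2) by blast
qed

lemma recurrent_imp_small_quotient:
  assumes H: "subgroup H \<Gamma>" and tf: "torsion_free (\<Gamma>\<lparr>carrier := H\<rparr>)"
    and rec: "\<And>A. A \<in> sets \<mu> \<Longrightarrow> A \<subseteq> boundary_part b \<Longrightarrow> measure \<mu> A > 0 \<Longrightarrow> \<exists>h\<in>H - {\<one>}. gact h ` A \<inter> A \<noteq> {}"
  shows "(\<lambda>n. real (card (quotient_ball \<Gamma> H \<phi> b n)) / real (card (orbit_ball \<Gamma> \<phi> b n))) \<longlonglongrightarrow> 0"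
proof (rule ccontr)
  have Hc: "k \<in> carrier \<Gamma>" if "k \<in> H" for k using subgroup_carrier[OF H that] .
  assume "\<not> ?thesis"
  then obtain e where e: "e > 0"
    "\<And>N. \<exists>n\<ge>N. real (card (quotient_ball \<Gamma> H \<phi> b n)) / real (card (orbit_ball \<Gamma> \<phi> b n)) \<ge> e"
    unfolding LIMSEQ_iff by (auto simp: not_less)
  obtain c where c: "c > 0" "\<And>n::nat. real n \<ge> D \<Longrightarrow> real (card (orbit_ball \<Gamma> \<phi> b n)) \<ge> c * exp (\<omega> * real n)"
    using growth_lower by blast
  have "\<exists>n\<ge>N. real (card (quotient_ball \<Gamma> H \<phi> b n)) \<ge> (e * c) * exp (\<omega> * real n)" for N
  proof -
    obtain n where n: "n \<ge> max N (nat \<lceil>D\<rceil>)" "real (card (quotient_ball \<Gamma> H \<phi> b n)) / real (card (orbit_ball \<Gamma> \<phi> b n)) \<ge> e"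
      using e(2) by blast
    have "real n \<ge> D" using n(1) by linarith
    hence "e * (c * exp (\<omega> * real n)) \<le> e * real (card (orbit_ball \<Gamma> \<phi> b n))"
      using c(2) e(1) by (intro mult_left_mono) auto
    also have "\<dots> \<le> real (card (quotient_ball \<Gamma> H \<phi> b n))"
      using n(2) orbit_ball_pos[of n] by (simp add: pos_le_divide_eq)
    finally show ?thesis using n(1) by (intro exI[of _ n]) (simp add: mult.assoc)
  qed
  then obtain E and K :: nat where E: "E \<in> sets \<mu>" "E \<subseteq> boundary_part b" "measure \<mu> E > 0"
    "\<forall>p\<in>E. \<forall>J. finite J \<longrightarrow> J \<subseteq> H \<longrightarrow> (\<forall>h\<in>J. gact h p \<in> E) \<longrightarrow> card J \<le> K"
    using limsup_shadows[OF H, of "e * c"] e(1) c(1) by (metis mult_pos_pos)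
  have "\<exists>B J. B \<in> sets \<mu> \<and> B \<subseteq> E \<and> measure \<mu> B > 0 \<and> finite J \<and> J \<subseteq> H \<and> J \<noteq> {} \<and> card J \<ge> j \<and>
     (\<forall>h\<in>J. gact h ` B \<subseteq> E)" for j :: nat
  proof (induction j)
    case 0
    show ?case using E subgroup.one_closed[OF H] by (intro exI[of _ E] exI[of _ "{\<one>}"]) (auto simp: image_def)
  next
    case (Suc j)
    then obtain B J where BJ: "B \<in> sets \<mu>" "B \<subseteq> E" "measure \<mu> B > 0" "finite J" "J \<subseteq> H" "J \<noteq> {}" "card J \<ge> j"
      "\<And>h. h \<in> J \<Longrightarrow> gact h ` B \<subseteq> E" by blast
    obtain k where k: "k \<in> H" "k \<noteq> \<one>" "measure \<mu> (gact k ` B \<inter> B) > 0"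
      using recurrent_positive[OF H rec BJ(1) _ BJ(3)] BJ(2) E(2) by blast
    \<comment> \<open>Points of \<open>?B\<close> come from \<open>B\<close> under \<open>k\<close>,
      so \<open>inv k\<close> takes them back into \<open>B\<close>, and any \<open>x\<close> in
      \<open>J\<close> preceded by \<open>inv k\<close> carries \<open>?B\<close> into
      \<open>E\<close>.\<close>
    let ?B = "gact k ` B \<inter> B" and ?h = "inv k"
    have h: "?h \<in> H" "?h \<in> carrier \<Gamma>" "?h \<noteq> \<one>"
      using k subgroup.m_inv_closed[OF H k(1)] Hc by (auto simp: \<Gamma>.inv_eq_1_iff)
    let ?J = "J \<union> (\<lambda>x. x \<otimes> ?h) ` J"
    have "\<not> (\<lambda>x. x \<otimes> ?h) ` J \<subseteq> J"
    proof
      assume sub: "(\<lambda>x. x \<otimes> ?h) ` J \<subseteq> J"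
      obtain x where x: "x \<in> J" using BJ(6) by blast
      have xc: "x \<in> carrier \<Gamma>" using x BJ(5) Hc by blast
      have pw: "x \<otimes> ?h [^] n \<in> J" for n :: nat
      proof (induction n)
        case 0 thus ?case using x xc by simp
      next
        case (Suc n)
        hence "(x \<otimes> ?h [^] n) \<otimes> ?h \<in> J" using sub by blast
        thus ?case using xc h by (simp add: \<Gamma>.m_assoc)
      qed
      have "\<not> inj (\<lambda>n::nat. x \<otimes> ?h [^] n)"
      proof
        assume "inj (\<lambda>n::nat. x \<otimes> ?h [^] n)"
        hence "infinite (range (\<lambda>n::nat. x \<otimes> ?h [^] n))" by (simp add: finite_image_iff)
        moreover have "range (\<lambda>n::nat. x \<otimes> ?h [^] n) \<subseteq> J" using pw by blast
        ultimately show False using BJ(4) finite_subset by blast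
      qed
      then obtain i j :: nat where "i < j" "x \<otimes> ?h [^] i = x \<otimes> ?h [^] j"
        unfolding inj_def by (metis linorder_neqE_nat)
      hence "?h [^] j = ?h [^] i" using xc h by simp
      moreover have "?h [^] i \<otimes> ?h [^] (j - i) = ?h [^] (i + (j - i))" by (rule \<Gamma>.nat_pow_mult[OF h(2)])
      moreover have "i + (j - i) = j" using \<open>i < j\<close> by simp
      ultimately have "?h [^] i \<otimes> ?h [^] (j - i) = ?h [^] i" by (simp only:)
      hence "?h [^] (j - i) = \<one>" using h(2) by (simp only: \<Gamma>.l_cancel_one \<Gamma>.nat_pow_closed)
      hence "?h [^]\<^bsub>\<Gamma>\<lparr>carrier := H\<rparr>\<^esub> (j - i) = \<one>" using \<Gamma>.nat_pow_consistent by metis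
      moreover have "?h \<in> carrier (\<Gamma>\<lparr>carrier := H\<rparr>) - {\<one>\<^bsub>\<Gamma>\<lparr>carrier := H\<rparr>\<^esub>}" using h by simp
      moreover have "j - i > 0" using \<open>i < j\<close> by simp
      ultimately show False using tf unfolding torsion_free_def by auto
    qed
    hence "J \<subset> ?J" by blast
    hence cJ: "card J < card ?J" using BJ(4) by (intro psubset_card_mono) auto
    have gJ: "gact x ` ?B \<subseteq> E" if "x \<in> ?J" for x
    proof -
      consider "x \<in> J" | y where "y \<in> J" "x = y \<otimes> ?h" using \<open>x \<in> ?J\<close> by blast
      thus ?thesis
      proof cases
        case 1 thus ?thesis using BJ(8) by blast
      next
        case 2
        have yc: "y \<in> carrier \<Gamma>" using 2 BJ(5) Hc by blast
        have "gact x p \<in> E" if pB: "p \<in> ?B" for p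
        proof -
          obtain q where q: "q \<in> B" "p = gact k q" using pB by blast
          have "gact x p = gact y q" using 2 q yc h Hc[OF k(1)] by (simp add: gact_mult)
          thus ?thesis using BJ(8)[OF 2(1)] q(1) by blast
        qed
        thus ?thesis by blast
      qed
    qed
    have JH: "?J \<subseteq> H" using BJ(5) h subgroup.m_closed[OF H] by blast
    have Bm: "?B \<in> sets \<mu>" using gact_sets[OF Hc[OF k(1)] BJ(1)] BJ(1) by blast
    show ?case
    proof (rule exI[of _ ?B], rule exI[of _ ?J], intro conjI ballI)
      show "?B \<in> sets \<mu>" "measure \<mu> ?B > 0" "?J \<subseteq> H" by (fact Bm k(3) JH)+
      show "?B \<subseteq> E" using BJ(2) by blast
      show "finite ?J" "?J \<noteq> {}" using BJ(4,6) by simp_all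
      show "Suc j \<le> card ?J" using cJ BJ(7) by linarith
      show "gact x ` ?B \<subseteq> E" if "x \<in> ?J" for x by (rule gJ[OF that])
    qed
  qed
  \<comment> \<open>One more element than the bound on returns to \<open>E\<close> permits.\<close>
  from this[of "Suc K"] obtain B J where BJ: "B \<in> sets \<mu>" "B \<subseteq> E" "measure \<mu> B > 0" "finite J" "J \<subseteq> H"
      "card J \<ge> Suc K" "\<forall>h\<in>J. gact h ` B \<subseteq> E" by (elim exE conjE)
  have "B \<noteq> {}" using BJ(3) by auto
  then obtain p where p: "p \<in> B" by blast
  have "\<forall>h\<in>J. gact h p \<in> E" using BJ(7) p by blast
  hence "card J \<le> K" using E(4)[rule_format, of p J] BJ p by blast
  thus False using BJ(6) by simp
qed

end

theorem corollary1p20: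
  fixes \<Gamma> :: "('g, 'c) monoid_scheme"
    and H :: "'g set"
    and \<phi> :: "'g \<Rightarrow> 'a::heine_borel \<Rightarrow> 'a"
    and b :: 'a
    and \<mu> :: "('a + (nat \<Rightarrow> 'a) set) measure"
  assumes "geodesic_space TYPE('a)"
    and "gromov_hyperbolic TYPE('a)"
    and "isometric_action \<Gamma> \<phi>"
    and "proper_action \<Gamma> \<phi>"
    and "cocompact_action \<Gamma> \<phi>"
    and "\<not> elementary_group \<Gamma>"
    and "patterson_sullivan \<Gamma> \<phi> b \<mu>"
    and "subgroup H \<Gamma>"
    and "torsion_free (\<Gamma>\<lparr>carrier := H\<rparr>)"
  shows "conservative (\<Gamma>\<lparr>carrier := H\<rparr>) (restrict_space \<mu> (boundary_part b)) (boundary_action b \<phi>)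
     \<longleftrightarrow> (\<lambda>n. real (card (quotient_ball \<Gamma> H \<phi> b n)) / real (card (orbit_ball \<Gamma> \<phi> b n)))
           \<longlonglongrightarrow> 0"
proof -
  obtain \<delta> where "\<delta> \<ge> 0" "\<forall>b x y z :: 'a.
     gromov_product b x z \<ge> min (gromov_product b x y) (gromov_product b y z) - \<delta>"
    using assms(2) unfolding gromov_hyperbolic_def by blast
  then interpret patterson_nonelementary b \<delta> \<Gamma> \<phi> \<mu>
    using assms by unfold_locales auto
  show ?thesis
    unfolding conservative_iff[OF assms(8)]
    using small_quotient_imp_recurrent[OF assms(8)] recurrent_imp_small_quotient[OF assms(8,9)]
    by blast
qed

end
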